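(* Let $A_0$ be the operator in $L^2(\mathbb{R},\mathbb{C}^2)$ $$A_0=-i\partial_x\sigma_1+ixI_2=\begin{pmatrix}ix&-i\partial_x\\-i\partial_x&ix\end{pmatrix},\qquad\mathrm{Dom}(A_0)=H^1(\mathbb{R},\mathbb{C}^2)\cap\mathrm{Dom}(xI_2).$$ Then $A_0$ is closed, $A_0^*=-i\partial_x\sigma_1-ixI_2$ with $\mathrm{Dom}(A_0^* )=\mathrm{Dom}(A_0)$, and $$\sigma(A_0)=\sigma_{\mathrm p}(A_0)=\sigma_{\mathrm e5}(A_0)=\mathbb{C},\qquad\sigma_{\mathrm ek}(A_0)=\emptyset,\quad k\in\{1,2,3,4\}.$$ The same spectral results also hold for $A_0^*$. Furthermore, each eigenvalue $\lambda\in\mathbb{C}$ has geometric multiplicity equal to $1$ and algebraic multiplicity equal to $\infty$ for both $A_0$ and $A_0^*$.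
   Context: $\sigma_1=\begin{pmatrix}0&1\\1&0\end{pmatrix}$, $I_2$ is the $2\times2$ identity matrix, $\mathrm{Dom}(xI_2)=\{u\in L^2(\mathbb{R},\mathbb{C}^2):xu\in L^2(\mathbb{R},\mathbb{C}^2)\}$. $\sigma$ and $\sigma_{\mathrm p}$ denote the spectrum and the point spectrum (set of eigenvalues). The essential spectra $\sigma_{\mathrm ek}(T)$, $k=1,\dots,5$, of a closed densely defined operator $T$ are those of Edmunds–Evans (Spectral Theory and Differential Operators, Chap. IX): $\sigma_{\mathrm ek}(T)=\mathbb{C}\setminus\Delta_k(T)$, where $\Delta_1(T)$ is the set of $\lambda$ for which $T-\lambda$ is semi-Fredholm (closed range and at least one of nullity $\dim\mathrm{Ker}(T-\lambda)$ and deficiency $\operatorname{codim}\mathrm{Ran}(T-\lambda)$ finite); $\Delta_2(T)$ is the set of $\lambda$ for which $T-\lambda$ has closed range and finite nullity; $\Delta_3(T)$ is the set of $\lambda$ for which $T-\lambda$ is Fredholm; $\Delta_4(T)$ is the set of $\lambda$ for which $T-\lambda$ is Fredholm with index $0$; $\Delta_5(T)$ is the union of all connected components of $\Delta_1(T)$ which intersect the resolvent set $\rho(T)$. The geometric multiplicity of an eigenvalue $\lambda$ of $T$ is $\dim\mathrm{Ker}(T-\lambda)$, and its algebraic multiplicity is $\dim\bigcup_{n=1}^\infty\mathrm{Ker}((T-\lambda)^n)$. *)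

theory Defs
  imports "HOL-Analysis.Analysis" "HOL-Library.Extended_Nat"
begin

section \<open>Complex Hilbert spaces\<close>

text \<open>The inner product \<open>cinner\<close> is linear in its first argument.\<close>

class complex_hilbert = real_inner + complete_space +
  fixes scaleC :: "complex \<Rightarrow> 'a \<Rightarrow> 'a" (infixr "*\<^sub>C" 75)
    and cinner :: "'a \<Rightarrow> 'a \<Rightarrow> complex"
  assumes scaleC_add_right: "c *\<^sub>C (x + y) = c *\<^sub>C x + c *\<^sub>C y"
    and scaleC_add_left: "(c + d) *\<^sub>C x = c *\<^sub>C x + d *\<^sub>C x"
    and scaleC_scaleC: "c *\<^sub>C (d *\<^sub>C x) = (c * d) *\<^sub>C x"
    and scaleC_of_real: "complex_of_real r *\<^sub>C x = r *\<^sub>R x"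
    and cinner_commute: "cinner x y = cnj (cinner y x)"
    and cinner_add_left: "cinner (x + y) z = cinner x z + cinner y z"
    and cinner_scaleC_left: "cinner (c *\<^sub>C x) y = c * cinner x y"
    and Re_cinner: "Re (cinner x y) = inner x y"

interpretation complex_vector: vector_space "scaleC :: complex \<Rightarrow> 'a \<Rightarrow> 'a::complex_hilbert"
proof
  fix x :: 'a
  show "1 *\<^sub>C x = x"
    using scaleC_of_real[of 1 x] by simp
qed (simp_all add: scaleC_add_right scaleC_add_left scaleC_scaleC)

text \<open>The library's \<open>dim\<close> is 0 on infinite-dimensional sets; \<open>cdim\<close> is \<open>\<infinity>\<close> there.\<close>

definition cdim :: "'a::complex_hilbert set \<Rightarrow> enat" where
  "cdim S = (if \<exists>B. finite B \<and> S \<subseteq> complex_vector.span B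
             then enat (complex_vector.dim S) else \<infinity>)"

text \<open>The dimension of the quotient by \<open>R\<close>, i.e. the least number of vectors whose cosets span
  the quotient; the infimum of the empty set is \<open>\<infinity>\<close>.\<close>

definition codim :: "'a::complex_hilbert set \<Rightarrow> enat" where
  "codim R = Inf {enat (card B) | B. finite B \<and> complex_vector.span (R \<union> B) = UNIV}"

lemma codim_eq_cdim_complement:
  fixes R M :: "'a::complex_hilbert set"
  assumes R: "complex_vector.subspace R" and M: "complex_vector.subspace M"
    and disj: "R \<inter> M = {0}" and sum: "\<And>x. \<exists>r\<in>R. \<exists>m\<in>M. x = r + m"
  shows "codim R = cdim M"
proof -
  have upper: "\<exists>D. finite D \<and> card D \<le> card C \<and> M \<subseteq> complex_vector.span D"
    if C: "finite C" "complex_vector.span (R \<union> C) = UNIV" for C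
  proof -
    have "\<exists>m. m \<in> M \<and> c - m \<in> R" for c
      using sum[of c] by (metis add_diff_cancel_right')
    then obtain p where p: "\<And>c. p c \<in> M" "\<And>c. c - p c \<in> R" by metis
    have sub: "complex_vector.span (p ` C) \<subseteq> M"
      using p M by (intro complex_vector.span_minimal) auto
    have "R \<union> C \<subseteq> complex_vector.span (R \<union> p ` C)"
    proof safe
      fix c assume "c \<in> C"
      then have "(c - p c) + p c \<in> complex_vector.span (R \<union> p ` C)"
        using p by (intro complex_vector.span_add complex_vector.span_base) auto
      then show "c \<in> complex_vector.span (R \<union> p ` C)" by simp
    qed (simp add: complex_vector.span_base)
    then have all: "complex_vector.span (R \<union> p ` C) = UNIV"
      using C(2) complex_vector.span_minimal[of "R \<union> C" "complex_vector.span (R \<union> p ` C)"]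
      by auto
    have "M \<subseteq> complex_vector.span (p ` C)"
    proof
      fix x assume x: "x \<in> M"
      have "x \<in> complex_vector.span (R \<union> p ` C)" using all by simp
      then obtain r s where rs: "x = r + s" "r \<in> R" "s \<in> complex_vector.span (p ` C)"
        unfolding complex_vector.span_Un
        using complex_vector.span_eq_iff[THEN iffD2, OF R] by blast
      have "x - s \<in> M"
        using x rs(3) sub M complex_vector.subspace_diff by blast
      then have "r \<in> R \<inter> M" using rs by simp
      then show "x \<in> complex_vector.span (p ` C)" using disj rs by simp
    qed
    then show ?thesis
      using C(1) card_image_le[of C p] by (intro exI[of _ "p ` C"]) auto
  qed
  let ?S = "{enat (card B) | B. finite B \<and> complex_vector.span (R \<union> B) = UNIV}"
  show ?thesis
  proof (cases "\<exists>B. finite B \<and> M \<subseteq> complex_vector.span B")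
    case True
    then obtain B0 where B0: "finite B0" "M \<subseteq> complex_vector.span B0" by blast
    obtain B where B: "B \<subseteq> M" "\<not> complex_vector.dependent B" "M \<subseteq> complex_vector.span B"
        "card B = complex_vector.dim M"
      using complex_vector.basis_exists[of M] by blast
    have finB: "finite B"
      using complex_vector.independent_span_bound[OF B0(1) B(2)] B(1) B0(2) by blast
    have "complex_vector.span (R \<union> B) = UNIV"
    proof -
      have "x \<in> complex_vector.span (R \<union> B)" for x
      proof -
        obtain r m where rm: "r \<in> R" "m \<in> M" "x = r + m" using sum by blast
        have "r \<in> complex_vector.span (R \<union> B)" using rm by (simp add: complex_vector.span_base)
        moreover have "m \<in> complex_vector.span (R \<union> B)"
          using rm B(3) complex_vector.span_mono[of B "R \<union> B"] by auto
        ultimately show ?thesis using rm complex_vector.span_add by blast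
      qed
      then show ?thesis by auto
    qed
    then have in_S: "enat (complex_vector.dim M) \<in> ?S" using finB B(4) by force
    have "enat (complex_vector.dim M) \<le> z" if z: "z \<in> ?S" for z
    proof -
      obtain C where C: "finite C" "complex_vector.span (R \<union> C) = UNIV" "z = enat (card C)"
        using z by blast
      obtain D where D: "finite D" "card D \<le> card C" "M \<subseteq> complex_vector.span D"
        using upper[OF C(1,2)] by blast
      show ?thesis using complex_vector.dim_le_card[OF D(3,1)] D(2) C(3) by simp
    qed
    then have "Inf ?S = enat (complex_vector.dim M)"
      using in_S by (intro antisym Inf_lower Inf_greatest)
    then show ?thesis using True by (simp add: codim_def cdim_def)
  next
    case False
    then have "?S = {}" using upper by blast
    then have "Inf ?S = \<infinity>" by (simp add: Inf_enat_def)
    then show ?thesis using False by (simp add: codim_def cdim_def)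
  qed
qed


section \<open>Unbounded operators\<close>

text \<open>An operator in \<open>'a\<close> is a partial map, with domain \<open>dom T\<close> and range \<open>ran T\<close>; equality
  of operators thus includes equality of domains.\<close>

type_synonym 'a operator = "'a \<rightharpoonup> 'a"

definition linear_operator :: "'a::complex_hilbert operator \<Rightarrow> bool" where
  "linear_operator T \<longleftrightarrow>
     complex_vector.subspace (dom T) \<and>
     (\<forall>u\<in>dom T. \<forall>v\<in>dom T. T (u + v) = Some (the (T u) + the (T v))) \<and>
     (\<forall>c. \<forall>u\<in>dom T. T (c *\<^sub>C u) = Some (c *\<^sub>C the (T u)))"

definition closed_operator :: "'a::complex_hilbert operator \<Rightarrow> bool" where
  "closed_operator T \<longleftrightarrow> linear_operator T \<and> closed {(u, w). T u = Some w}"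

text \<open>If \<open>dom T\<close> is dense, there is at most one \<open>w\<close> for each \<open>v\<close>, so that this is the usual
  adjoint. If \<open>dom T\<close> is a subspace that is not dense, then \<open>w\<close> is never unique and the map
  below is empty.\<close>

definition op_adjoint :: "'a::complex_hilbert operator \<Rightarrow> 'a operator" where
  "op_adjoint T = (\<lambda>v.
     if \<exists>!w. \<forall>u\<in>dom T. cinner (the (T u)) v = cinner u w
     then Some (THE w. \<forall>u\<in>dom T. cinner (the (T u)) v = cinner u w)
     else None)"

definition shift :: "'a::complex_hilbert operator \<Rightarrow> complex \<Rightarrow> 'a operator" where
  "shift T z = (\<lambda>u. map_option (\<lambda>w. w - z *\<^sub>C u) (T u))"

definition ker :: "'a::complex_hilbert operator \<Rightarrow> 'a set" where
  "ker T = {u. T u = Some 0}"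

primrec op_pow :: "'a operator \<Rightarrow> nat \<Rightarrow> 'a operator" where
  "op_pow T 0 = Some"
| "op_pow T (Suc n) = T \<circ>\<^sub>m op_pow T n"

definition resolvent_set :: "'a::complex_hilbert operator \<Rightarrow> complex set" where
  "resolvent_set T = {z. inj_on (shift T z) (dom T) \<and> ran (shift T z) = UNIV \<and>
     (\<exists>C. \<forall>u w. shift T z u = Some w \<longrightarrow> norm u \<le> C * norm w)}"

definition spectrum :: "'a::complex_hilbert operator \<Rightarrow> complex set" where
  "spectrum T = - resolvent_set T"

definition point_spectrum :: "'a::complex_hilbert operator \<Rightarrow> complex set" where
  "point_spectrum T = {z. \<exists>u. u \<noteq> 0 \<and> T u = Some (z *\<^sub>C u)}"

definition geometric_multiplicity :: "'a::complex_hilbert operator \<Rightarrow> complex \<Rightarrow> enat" where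
  "geometric_multiplicity T z = cdim (ker (shift T z))"

definition algebraic_multiplicity :: "'a::complex_hilbert operator \<Rightarrow> complex \<Rightarrow> enat" where
  "algebraic_multiplicity T z = cdim (\<Union>n\<in>{1..}. ker (op_pow (shift T z) n))"


subsection \<open>Essential spectra\<close>

text \<open>The five essential spectra of Edmunds and Evans (Spectral Theory and Differential
  Operators, Chap. IX), which are meant for closed densely defined operators.\<close>

definition nullity :: "'a::complex_hilbert operator \<Rightarrow> enat" where
  "nullity T = cdim (ker T)"

definition deficiency :: "'a::complex_hilbert operator \<Rightarrow> enat" where
  "deficiency T = codim (ran T)"

definition semi_fredholm :: "'a::complex_hilbert operator \<Rightarrow> bool" where
  "semi_fredholm T \<longleftrightarrow> closed (ran T) \<and> (nullity T \<noteq> \<infinity> \<or> deficiency T \<noteq> \<infinity>)"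

definition fredholm :: "'a::complex_hilbert operator \<Rightarrow> bool" where
  "fredholm T \<longleftrightarrow> closed (ran T) \<and> nullity T \<noteq> \<infinity> \<and> deficiency T \<noteq> \<infinity>"

text \<open>\<open>the_enat\<close> is unspecified at \<open>\<infinity>\<close>, so the index is meaningful for Fredholm operators only.\<close>

definition fredholm_index :: "'a::complex_hilbert operator \<Rightarrow> int" where
  "fredholm_index T = int (the_enat (nullity T)) - int (the_enat (deficiency T))"

definition Delta1 :: "'a::complex_hilbert operator \<Rightarrow> complex set" where
  "Delta1 T = {z. semi_fredholm (shift T z)}"

definition Delta2 :: "'a::complex_hilbert operator \<Rightarrow> complex set" where
  "Delta2 T = {z. closed (ran (shift T z)) \<and> nullity (shift T z) \<noteq> \<infinity>}"

definition Delta3 :: "'a::complex_hilbert operator \<Rightarrow> complex set" where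
  "Delta3 T = {z. fredholm (shift T z)}"

definition Delta4 :: "'a::complex_hilbert operator \<Rightarrow> complex set" where
  "Delta4 T = {z. fredholm (shift T z) \<and> fredholm_index (shift T z) = 0}"

definition Delta5 :: "'a::complex_hilbert operator \<Rightarrow> complex set" where
  "Delta5 T = \<Union>{K \<in> components (Delta1 T). K \<inter> resolvent_set T \<noteq> {}}"

definition ess_spectrum1 :: "'a::complex_hilbert operator \<Rightarrow> complex set" where
  "ess_spectrum1 T = - Delta1 T"

definition ess_spectrum2 :: "'a::complex_hilbert operator \<Rightarrow> complex set" where
  "ess_spectrum2 T = - Delta2 T"

definition ess_spectrum3 :: "'a::complex_hilbert operator \<Rightarrow> complex set" where
  "ess_spectrum3 T = - Delta3 T"

definition ess_spectrum4 :: "'a::complex_hilbert operator \<Rightarrow> complex set" where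
  "ess_spectrum4 T = - Delta4 T"

definition ess_spectrum5 :: "'a::complex_hilbert operator \<Rightarrow> complex set" where
  "ess_spectrum5 T = - Delta5 T"


section \<open>The space of square-integrable functions from the reals to \<open>complex^2\<close>\<close>

definition square_integrable :: "(real \<Rightarrow> complex^2) \<Rightarrow> bool" where
  "square_integrable u \<longleftrightarrow>
     u \<in> borel_measurable lborel \<and> integrable lborel (\<lambda>x. (norm (u x))\<^sup>2)"

lemma square_integrable_measurable [measurable_dest]:
  "square_integrable u \<Longrightarrow> u \<in> borel_measurable borel"
  by (simp add: square_integrable_def)

lemma square_integrable_zero: "square_integrable (\<lambda>x. 0)"
  by (simp add: square_integrable_def)

lemma square_integrable_bounded_linear:
  assumes u: "square_integrable u" and L: "bounded_linear L"
  shows "square_integrable (\<lambda>x. L (u x))"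
proof -
  obtain K where K: "\<And>y. norm (L y) \<le> norm y * K"
    using bounded_linear.bounded[OF L] by blast
  have meas [measurable]: "(\<lambda>x. L (u x)) \<in> borel_measurable borel"
    using borel_measurable_continuous_onI[OF linear_continuous_on[OF L]] u
    by (auto simp: square_integrable_def intro: measurable_compose)
  have "integrable lborel (\<lambda>x. (norm (L (u x)))\<^sup>2)"
  proof (rule Bochner_Integration.integrable_bound)
    show "integrable lborel (\<lambda>x. K\<^sup>2 * (norm (u x))\<^sup>2)"
      using u by (simp add: square_integrable_def)
    have "(norm (L (u x)))\<^sup>2 \<le> (norm (u x) * K)\<^sup>2" for x
      using K by (intro power_mono) auto
    then show "AE x in lborel. norm ((norm (L (u x)))\<^sup>2) \<le> norm (K\<^sup>2 * (norm (u x))\<^sup>2)"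
      by (simp add: power_mult_distrib mult.commute)
  qed simp
  then show ?thesis by (simp add: square_integrable_def)
qed

lemma square_integrable_add:
  assumes u: "square_integrable u" and v: "square_integrable v"
  shows "square_integrable (\<lambda>x. u x + v x)"
proof -
  have [measurable]: "u \<in> borel_measurable borel" "v \<in> borel_measurable borel"
    using u v by (auto simp: square_integrable_def)
  have "integrable lborel (\<lambda>x. (norm (u x + v x))\<^sup>2)"
  proof (rule Bochner_Integration.integrable_bound)
    show "integrable lborel (\<lambda>x. 2 * (norm (u x))\<^sup>2 + 2 * (norm (v x))\<^sup>2)"
      using u v by (simp add: square_integrable_def)
    have "(norm (u x + v x))\<^sup>2 \<le> 2 * (norm (u x))\<^sup>2 + 2 * (norm (v x))\<^sup>2" for x
    proof -
      have "(norm (u x + v x))\<^sup>2 \<le> (norm (u x) + norm (v x))\<^sup>2"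
        by (intro power_mono norm_triangle_ineq) auto
      also have "\<dots> \<le> 2 * (norm (u x))\<^sup>2 + 2 * (norm (v x))\<^sup>2"
        using sum_squares_bound[of "norm (u x)" "norm (v x)"] by (simp add: power2_sum)
      finally show ?thesis .
    qed
    then show "AE x in lborel. norm ((norm (u x + v x))\<^sup>2)
        \<le> norm (2 * (norm (u x))\<^sup>2 + 2 * (norm (v x))\<^sup>2)"
      by simp
  qed simp
  then show ?thesis by (simp add: square_integrable_def)
qed

lemma integrable_inner_square_integrable:
  assumes u: "square_integrable u" and v: "square_integrable v"
  shows "integrable lborel (\<lambda>x. u x \<bullet> v x)"
proof (rule Bochner_Integration.integrable_bound)
  show "integrable lborel (\<lambda>x. (norm (u x))\<^sup>2 + (norm (v x))\<^sup>2)"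
    using u v by (simp add: square_integrable_def)
  show "(\<lambda>x. u x \<bullet> v x) \<in> borel_measurable lborel"
    using u v by (auto simp: square_integrable_def intro: borel_measurable_inner)
  have "\<bar>u x \<bullet> v x\<bar> \<le> (norm (u x))\<^sup>2 + (norm (v x))\<^sup>2" for x
    using Cauchy_Schwarz_ineq2[of "u x" "v x"] sum_squares_bound[of "norm (u x)" "norm (v x)"]
      mult_nonneg_nonneg[OF norm_ge_zero[of "u x"] norm_ge_zero[of "v x"]]
    by linarith
  then show "AE x in lborel. norm (u x \<bullet> v x) \<le> norm ((norm (u x))\<^sup>2 + (norm (v x))\<^sup>2)"
    by simp
qed

lemma bounded_linear_matrix: "bounded_linear (\<lambda>y::complex^2. (M::complex^2^2) *v y)"
proof -
  have "linear (\<lambda>y::complex^2. M *v y)"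
    by (rule linearI) (simp_all add: vec_eq_iff matrix_vector_mult_def sum_distrib_left
        scaleR_right.sum distrib_left sum.distrib)
  then show ?thesis by (simp add: linear_conv_bounded_linear)
qed

lemma bounded_linear_vector_scalar: "bounded_linear (\<lambda>y::complex^2. (c::complex) *s y)"
proof -
  have "linear (\<lambda>y::complex^2. c *s y)"
    by (rule linearI) (simp_all add: vec_eq_iff distrib_left)
  then show ?thesis by (simp add: linear_conv_bounded_linear)
qed

definition vec_cinner :: "complex^2 \<Rightarrow> complex^2 \<Rightarrow> complex" where
  "vec_cinner a b = (\<Sum>j\<in>UNIV. a $ j * cnj (b $ j))"

lemma Re_vec_cinner: "Re (vec_cinner a b) = a \<bullet> b"
  by (simp add: vec_cinner_def inner_vec_def inner_complex_def)

lemma vec_cinner_scaleC: "vec_cinner (c *s a) b = c * vec_cinner a b"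
  by (simp add: vec_cinner_def sum_distrib_left mult.assoc)

lemma vec_cinner_add: "vec_cinner (a + b) d = vec_cinner a d + vec_cinner b d"
  by (simp add: vec_cinner_def distrib_right sum.distrib)

lemma vec_cinner_commute: "vec_cinner a b = cnj (vec_cinner b a)"
  by (simp add: vec_cinner_def mult.commute)

lemma vec_cinner_eq: "vec_cinner a b = of_real (a \<bullet> b) + \<i> * of_real (((- \<i>) *s a) \<bullet> b)"
  unfolding Re_vec_cinner[symmetric] vec_cinner_scaleC by (simp add: complex_eq_iff)

lemma integrable_vec_cinner:
  assumes u: "square_integrable u" and v: "square_integrable v"
  shows "integrable lborel (\<lambda>x. vec_cinner (u x) (v x))"
  unfolding vec_cinner_eq
  using integrable_inner_square_integrable[OF u v]
    integrable_inner_square_integrable[OF square_integrable_bounded_linear[OF u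
        bounded_linear_vector_scalar[of "- \<i>"]] v]
  by (intro Bochner_Integration.integrable_add integrable_mult_right integrable_of_real)

quotient_type ltwo = "real \<Rightarrow> complex^2" /
  partial: "\<lambda>u v. square_integrable u \<and> square_integrable v \<and> (AE x in lborel. u x = v x)"
proof (rule part_equivpI)
  show "\<exists>u. square_integrable u \<and> square_integrable u \<and> (AE x in lborel. u x = u x)"
    using square_integrable_zero by auto
qed (auto simp: symp_def transp_def elim: eventually_mono eventually_elim2)

instantiation ltwo :: real_vector
begin

lift_definition zero_ltwo :: ltwo is "\<lambda>x. 0"
  by (simp add: square_integrable_zero)

lift_definition plus_ltwo :: "ltwo \<Rightarrow> ltwo \<Rightarrow> ltwo" is "\<lambda>u v x. u x + v x"
  by (auto intro: square_integrable_add elim: eventually_elim2)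

lift_definition scaleR_ltwo :: "real \<Rightarrow> ltwo \<Rightarrow> ltwo" is "\<lambda>r u x. r *\<^sub>R u x"
  by (auto intro: square_integrable_bounded_linear[OF _ bounded_linear_scaleR_right]
      elim: eventually_mono)

lift_definition uminus_ltwo :: "ltwo \<Rightarrow> ltwo" is "\<lambda>u x. - u x"
  by (auto intro: square_integrable_bounded_linear[OF _ bounded_linear_minus[OF bounded_linear_ident]]
      elim: eventually_mono)

definition minus_ltwo :: "ltwo \<Rightarrow> ltwo \<Rightarrow> ltwo" where
  "minus_ltwo u v = u + (- v)"

instance
proof
  fix u v w :: ltwo and r s :: real
  show "u + v + w = u + (v + w)"
    by transfer (auto simp: add.assoc intro: square_integrable_add)
  show "u + v = v + u"
    by transfer (auto simp: add.commute intro: square_integrable_add)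
  show "0 + u = u" by transfer auto
  show "- u + u = 0"
    by transfer (auto intro: square_integrable_zero)
  show "u - v = u + - v" by (rule minus_ltwo_def)
  show "r *\<^sub>R (u + v) = r *\<^sub>R u + r *\<^sub>R v"
    by transfer (auto simp: scaleR_add_right intro!: square_integrable_add
        square_integrable_bounded_linear[OF _ bounded_linear_scaleR_right])
  show "(r + s) *\<^sub>R u = r *\<^sub>R u + s *\<^sub>R u"
    by transfer (auto simp: scaleR_add_left intro!: square_integrable_add
        square_integrable_bounded_linear[OF _ bounded_linear_scaleR_right])
  show "r *\<^sub>R s *\<^sub>R u = (r * s) *\<^sub>R u"
    by transfer (auto intro!: square_integrable_bounded_linear[OF _ bounded_linear_scaleR_right])
  show "1 *\<^sub>R u = u" by transfer auto
qed

end

instantiation ltwo :: real_inner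
begin

lift_definition inner_ltwo :: "ltwo \<Rightarrow> ltwo \<Rightarrow> real" is "\<lambda>u v. LINT x|lborel. u x \<bullet> v x"
  by (rule integral_cong_AE) (auto simp: square_integrable_def elim: eventually_elim2)

definition norm_ltwo :: "ltwo \<Rightarrow> real" where
  "norm_ltwo u = sqrt (u \<bullet> u)"

definition dist_ltwo :: "ltwo \<Rightarrow> ltwo \<Rightarrow> real" where
  "dist_ltwo u v = norm (u - v)"

definition sgn_ltwo :: "ltwo \<Rightarrow> ltwo" where
  "sgn_ltwo u = inverse (norm u) *\<^sub>R u"

definition uniformity_ltwo :: "(ltwo \<times> ltwo) filter" where
  "uniformity_ltwo = (INF e\<in>{0<..}. principal {(u, v). dist u v < e})"

definition open_ltwo :: "ltwo set \<Rightarrow> bool" where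
  "open_ltwo U \<longleftrightarrow> (\<forall>x\<in>U. eventually (\<lambda>(x', y). x' = x \<longrightarrow> y \<in> U) uniformity)"

instance
proof
  fix u v w :: ltwo and r :: real and U :: "ltwo set"
  show "dist u v = norm (u - v)" by (rule dist_ltwo_def)
  show "sgn u = inverse (norm u) *\<^sub>R u" by (rule sgn_ltwo_def)
  show "uniformity = (INF e\<in>{0<..}. principal {(u::ltwo, v). dist u v < e})"
    by (rule uniformity_ltwo_def)
  show "open U \<longleftrightarrow> (\<forall>x\<in>U. eventually (\<lambda>(x', y). x' = x \<longrightarrow> y \<in> U) uniformity)"
    by (rule open_ltwo_def)
  show "norm u = sqrt (u \<bullet> u)" by (rule norm_ltwo_def)
  show "u \<bullet> v = v \<bullet> u" by transfer (simp add: inner_commute)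
  show "(u + v) \<bullet> w = u \<bullet> w + v \<bullet> w"
    by transfer (simp add: inner_add_left integrable_inner_square_integrable)
  show "(r *\<^sub>R u) \<bullet> v = r * (u \<bullet> v)" by transfer simp
  show "0 \<le> u \<bullet> u" by transfer simp
  show "u \<bullet> u = 0 \<longleftrightarrow> u = 0"
  proof transfer
    fix u :: "real \<Rightarrow> complex^2"
    assume u: "square_integrable u \<and> square_integrable u \<and> (AE x in lborel. u x = u x)"
    have "(LINT x|lborel. u x \<bullet> u x) = 0 \<longleftrightarrow> (AE x in lborel. u x \<bullet> u x = 0)"
      using u integrable_inner_square_integrable by (intro integral_nonneg_eq_0_iff_AE) auto
    then show "(LINT x|lborel. u x \<bullet> u x) = 0 \<longleftrightarrow>
        square_integrable u \<and> square_integrable (\<lambda>x. 0) \<and> (AE x in lborel. u x = 0)"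
      using u square_integrable_zero by simp
  qed
qed

end

lemma square_integrable_diff:
  "square_integrable u \<Longrightarrow> square_integrable v \<Longrightarrow> square_integrable (\<lambda>x. u x - v x)"
  using square_integrable_add[of u "\<lambda>x. - v x"]
    square_integrable_bounded_linear[OF _ bounded_linear_minus[OF bounded_linear_ident], of v]
  by simp

lemma dist_abs_ltwo:
  assumes "square_integrable u" "square_integrable v"
  shows "ennreal ((dist (abs_ltwo u) (abs_ltwo v))\<^sup>2) = (\<integral>\<^sup>+x. ennreal ((norm (u x - v x))\<^sup>2) \<partial>lborel)"
proof -
  have d: "square_integrable (\<lambda>x. u x - v x)" using assms by (rule square_integrable_diff)
  have m: "square_integrable (\<lambda>x. - v x)"
    using square_integrable_bounded_linear[OF assms(2) bounded_linear_minus[OF bounded_linear_ident]] .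
  have "abs_ltwo u - abs_ltwo v = abs_ltwo (\<lambda>x. u x - v x)"
    using assms m by (simp add: minus_ltwo_def uminus_ltwo.abs_eq plus_ltwo.abs_eq)
  then have "(dist (abs_ltwo u) (abs_ltwo v))\<^sup>2 = (LINT x|lborel. (norm (u x - v x))\<^sup>2)"
    using d by (simp add: dist_norm power2_norm_eq_inner inner_ltwo.abs_eq)
  then show ?thesis
    using d by (simp add: square_integrable_def nn_integral_eq_integral)
qed

lemma ltwo_cases:
  obtains u where "square_integrable u" "x = abs_ltwo u"
proof -
  obtain u where "square_integrable u" "abs_ltwo u = x"
    using Quotient_ltwo
    by (metis (no_types, lifting) Quotient_abs_rep Quotient_rep_reflp)
  then show ?thesis using that by auto
qed

text \<open>A sequence that is Cauchy in quadratic mean at a geometric rate converges almost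
  everywhere, because \<open>\<Sum>k. 4 ^ k * (norm (F (Suc k) x - F k x))\<^sup>2\<close> has finite integral.\<close>

lemma fast_Cauchy_AE_convergent:
  fixes F :: "nat \<Rightarrow> real \<Rightarrow> complex^2"
  assumes F: "\<And>k. square_integrable (F k)"
    and fast: "\<And>k. (\<integral>\<^sup>+x. ennreal ((norm (F (Suc k) x - F k x))\<^sup>2) \<partial>lborel) \<le> ennreal ((1/16) ^ k)"
  shows "AE x in lborel. convergent (\<lambda>k. F k x)"
proof -
  define d where "d k x = norm (F (Suc k) x - F k x)" for k x
  have [measurable]: "F k \<in> borel_measurable borel" for k
    using F by (simp add: square_integrable_def)
  have [measurable]: "d k \<in> borel_measurable borel" for k
    unfolding d_def by measurable
  have "(\<integral>\<^sup>+x. (\<Sum>k. ennreal (4 ^ k * (d k x)\<^sup>2)) \<partial>lborel)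
      = (\<Sum>k. \<integral>\<^sup>+x. ennreal (4 ^ k * (d k x)\<^sup>2) \<partial>lborel)"
    by (rule nn_integral_suminf) measurable
  also have "\<dots> \<le> (\<Sum>k. ennreal ((1/4) ^ k))"
  proof (intro suminf_le summableI)
    fix k
    have "(\<integral>\<^sup>+x. ennreal (4 ^ k * (d k x)\<^sup>2) \<partial>lborel)
        = (\<integral>\<^sup>+x. ennreal (4 ^ k) * ennreal ((d k x)\<^sup>2) \<partial>lborel)"
      by (simp add: ennreal_mult)
    also have "\<dots> = ennreal (4 ^ k) * (\<integral>\<^sup>+x. ennreal ((d k x)\<^sup>2) \<partial>lborel)"
      by (rule nn_integral_cmult) measurable
    also have "\<dots> \<le> ennreal (4 ^ k) * ennreal ((1/16) ^ k)"
      using fast[of k] by (intro mult_left_mono) (auto simp: d_def)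
    also have "\<dots> = ennreal ((1/4) ^ k)"
      by (simp add: ennreal_mult[symmetric] power_mult_distrib[symmetric])
    finally show "(\<integral>\<^sup>+x. ennreal (4 ^ k * (d k x)\<^sup>2) \<partial>lborel) \<le> ennreal ((1/4) ^ k)" .
  qed
  also have "\<dots> < \<infinity>"
    using summable_geometric[of "1/4::real"] by (simp add: ennreal_suminf_neq_top less_top)
  finally have "(\<integral>\<^sup>+x. (\<Sum>k. ennreal (4 ^ k * (d k x)\<^sup>2)) \<partial>lborel) \<noteq> \<infinity>" by simp
  then have "AE x in lborel. (\<Sum>k. ennreal (4 ^ k * (d k x)\<^sup>2)) \<noteq> \<infinity>"
    by (intro nn_integral_PInf_AE) measurable
  then show ?thesis
  proof (rule eventually_mono)
    fix x
    assume fin: "(\<Sum>k. ennreal (4 ^ k * (d k x)\<^sup>2)) \<noteq> \<infinity>"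
    have "summable (\<lambda>k. 4 ^ k * (d k x)\<^sup>2)"
      using fin by (intro summable_suminf_not_top) auto
    then have "Bseq (\<lambda>k. 4 ^ k * (d k x)\<^sup>2)"
      using summable_LIMSEQ_zero convergent_imp_Bseq convergentI by blast
    then obtain K where K: "K > 0" "\<And>k. norm (4 ^ k * (d k x)\<^sup>2) \<le> K" by (auto elim: BseqE)
    have bound: "norm (F (Suc k) x - F k x) \<le> sqrt K * (1/2) ^ k" for k
    proof -
      have "(2 ^ k * d k x)\<^sup>2 \<le> K"
        using K(2)[of k] power_mult[of "2::real" 2 k] power_mult[of "2::real" k 2]
        by (simp add: power_mult_distrib mult.commute)
      then have "2 ^ k * d k x \<le> sqrt K" by (rule real_le_rsqrt)
      then show ?thesis by (simp add: d_def field_simps power_divide)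
    qed
    have "summable (\<lambda>k. F (Suc k) x - F k x)"
      by (rule summable_comparison_test'[where g = "\<lambda>k. sqrt K * (1/2) ^ k"])
        (use bound in \<open>auto intro!: summable_mult summable_geometric\<close>)
    then have "convergent (\<lambda>n. \<Sum>k<n. F (Suc k) x - F k x)"
      by (simp add: summable_iff_convergent)
    then have "convergent (\<lambda>n. F n x - F 0 x)" by (simp add: sum_lessThan_telescope[of "\<lambda>k. F k x"])
    then have "convergent (\<lambda>n. (F n x - F 0 x) + F 0 x)"
      by (intro convergent_add convergent_const)
    then show "convergent (\<lambda>n. F n x)" by simp
  qed
qed

lemma fast_Cauchy_ltwo:
  fixes X :: "nat \<Rightarrow> ltwo"
  assumes fast: "\<And>k m. k \<le> m \<Longrightarrow> dist (X m) (X k) \<le> (1/4) ^ k"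
  shows "\<exists>l. X \<longlonglongrightarrow> l"
proof -
  obtain F where F: "\<And>k. square_integrable (F k)" "\<And>k. X k = abs_ltwo (F k)"
  proof -
    have "\<exists>f. square_integrable f \<and> X k = abs_ltwo f" for k
      using ltwo_cases[of "X k"] by blast
    then obtain F where "\<forall>k. square_integrable (F k) \<and> X k = abs_ltwo (F k)"
      using choice[of "\<lambda>k f. square_integrable f \<and> X k = abs_ltwo f"] by blast
    then show ?thesis using that by blast
  qed
  have [measurable]: "F k \<in> borel_measurable borel" for k
    using F by (simp add: square_integrable_def)
  have dF: "(\<integral>\<^sup>+x. ennreal ((norm (F m x - F k x))\<^sup>2) \<partial>lborel) \<le> ennreal ((1/16) ^ k)"
    if "k \<le> m" for k m
  proof -
    have "(dist (X m) (X k))\<^sup>2 \<le> ((1/4) ^ k)\<^sup>2"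
      using fast[OF that] by (intro power_mono) auto
    also have "\<dots> = (1/16) ^ k"
      by (simp add: power_mult_distrib[symmetric] power2_eq_square)
    finally show ?thesis
      unfolding dist_abs_ltwo[OF F(1)[of m] F(1)[of k], symmetric] F(2)[symmetric]
      by (rule ennreal_leI)
  qed
  define f where "f x = lim (\<lambda>k. F k x)" for x
  have [measurable]: "f \<in> borel_measurable borel"
    unfolding f_def by (rule borel_measurable_lim_metric) measurable
  have lim: "AE x in lborel. (\<lambda>k. F k x) \<longlonglongrightarrow> f x"
    using fast_Cauchy_AE_convergent[OF F(1) dF]
    by (auto simp: f_def convergent_LIMSEQ_iff)
  have fatou: "(\<integral>\<^sup>+x. ennreal ((norm (f x - F k x))\<^sup>2) \<partial>lborel) \<le> ennreal ((1/16) ^ k)" for k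
  proof -
    have "(\<integral>\<^sup>+x. ennreal ((norm (f x - F k x))\<^sup>2) \<partial>lborel)
        = (\<integral>\<^sup>+x. liminf (\<lambda>m. ennreal ((norm (F m x - F k x))\<^sup>2)) \<partial>lborel)"
    proof (rule nn_integral_cong_AE)
      show "AE x in lborel. ennreal ((norm (f x - F k x))\<^sup>2)
          = liminf (\<lambda>m. ennreal ((norm (F m x - F k x))\<^sup>2))"
        using lim
      proof (rule eventually_mono)
        fix x assume "(\<lambda>k. F k x) \<longlonglongrightarrow> f x"
        then have "(\<lambda>m. ennreal ((norm (F m x - F k x))\<^sup>2)) \<longlonglongrightarrow> ennreal ((norm (f x - F k x))\<^sup>2)"
          by (intro tendsto_intros tendsto_ennrealI)
        then show "ennreal ((norm (f x - F k x))\<^sup>2)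
            = liminf (\<lambda>m. ennreal ((norm (F m x - F k x))\<^sup>2))"
          by (rule lim_imp_Liminf[OF sequentially_bot, symmetric])
      qed
    qed
    also have "\<dots> \<le> liminf (\<lambda>m. \<integral>\<^sup>+x. ennreal ((norm (F m x - F k x))\<^sup>2) \<partial>lborel)"
      by (rule nn_integral_liminf) measurable
    also have "\<dots> \<le> ennreal ((1/16) ^ k)"
      using dF[of k] by (intro Liminf_le) (auto simp: eventually_sequentially)
    finally show ?thesis .
  qed
  have "square_integrable (\<lambda>x. f x - F 0 x)"
    unfolding square_integrable_def using fatou[of 0]
    by (auto intro!: integrableI_bounded simp: le_less_trans)
  from square_integrable_add[OF this F(1)[of 0]] have f: "square_integrable f" by simp
  have "dist (X k) (abs_ltwo f) \<le> (1/4) ^ k" for k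
  proof -
    have "ennreal ((dist (abs_ltwo f) (X k))\<^sup>2) \<le> ennreal ((1/16) ^ k)"
      using dist_abs_ltwo[OF f F(1)[of k]] F(2) fatou[of k] by simp
    then have "(dist (abs_ltwo f) (X k))\<^sup>2 \<le> ((1/4) ^ k)\<^sup>2"
      by (simp add: power_mult_distrib[symmetric] power2_eq_square)
    then have "dist (abs_ltwo f) (X k) \<le> (1/4) ^ k"
      by (rule power2_le_imp_le) simp
    then show ?thesis by (simp only: dist_commute)
  qed
  then have "X \<longlonglongrightarrow> abs_ltwo f"
    unfolding tendsto_dist_iff[of X]
    by (intro tendsto_sandwich[OF _ _ tendsto_const LIMSEQ_realpow_zero[of "1/4"]]) auto
  then show ?thesis by blast
qed

instance ltwo :: complete_space
proof
  fix X :: "nat \<Rightarrow> ltwo"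
  assume X: "Cauchy X"
  have "\<exists>N. \<forall>m\<ge>N. \<forall>n\<ge>N. dist (X m) (X n) < (1/4) ^ k" for k :: nat
    using X by (intro metric_CauchyD) auto
  then obtain N where N: "\<And>k m n. m \<ge> N k \<Longrightarrow> n \<ge> N k \<Longrightarrow> dist (X m) (X n) < (1/4) ^ k"
    by metis
  define r where "r k = k + (\<Sum>i\<le>k. N i)" for k
  have r: "strict_mono r" by (rule strict_monoI_Suc) (simp add: r_def)
  have rN: "N k \<le> r k" for k
    unfolding r_def using member_le_sum[of k "{..k}" N] by simp
  have "\<exists>l. (X \<circ> r) \<longlonglongrightarrow> l"
  proof (rule fast_Cauchy_ltwo)
    fix k m :: nat assume "k \<le> m"
    then have "N k \<le> r m" using rN[of k] strict_mono_less_eq[OF r, of k m] by linarith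
    then show "dist ((X \<circ> r) m) ((X \<circ> r) k) \<le> (1/4) ^ k"
      using N[of k "r m" "r k"] rN[of k] by simp
  qed
  then obtain l where "(X \<circ> r) \<longlonglongrightarrow> l" by blast
  then show "convergent X"
    using X r Cauchy_converges_subseq unfolding convergent_def by blast
qed

instantiation ltwo :: complex_hilbert
begin

lift_definition scaleC_ltwo :: "complex \<Rightarrow> ltwo \<Rightarrow> ltwo" is "\<lambda>c u x. c *s u x"
  by (auto intro: square_integrable_bounded_linear[OF _ bounded_linear_vector_scalar]
      elim: eventually_mono)

lift_definition cinner_ltwo :: "ltwo \<Rightarrow> ltwo \<Rightarrow> complex" is
  "\<lambda>u v. LINT x|lborel. vec_cinner (u x) (v x)"
  by (rule integral_cong_AE)
    (use borel_measurable_integrable[OF integrable_vec_cinner] in \<open>auto elim: eventually_elim2\<close>)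

instance
proof
  fix u v w :: ltwo and c d :: complex and r :: real
  note sq = square_integrable_add square_integrable_bounded_linear[OF _ bounded_linear_vector_scalar]
    square_integrable_bounded_linear[OF _ bounded_linear_scaleR_right]
  show "c *\<^sub>C (u + v) = c *\<^sub>C u + c *\<^sub>C v"
    by transfer (auto simp: vector_add_ldistrib intro!: sq)
  show "(c + d) *\<^sub>C u = c *\<^sub>C u + d *\<^sub>C u"
    by transfer (auto simp: vector_sadd_rdistrib intro!: sq)
  show "c *\<^sub>C d *\<^sub>C u = (c * d) *\<^sub>C u"
    by transfer (auto simp: vector_smult_assoc intro!: sq)
  show "complex_of_real r *\<^sub>C u = r *\<^sub>R u"
  proof transfer
    fix r :: real and u :: "real \<Rightarrow> complex^2"
    assume u: "square_integrable u \<and> square_integrable u \<and> (AE x in lborel. u x = u x)"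
    have "complex_of_real r *s u x = r *\<^sub>R u x" for x
      unfolding vec_eq_iff vector_smult_component vector_scaleR_component
      by (simp add: scaleR_conv_of_real)
    then show "square_integrable (\<lambda>x. complex_of_real r *s u x) \<and>
        square_integrable (\<lambda>x. r *\<^sub>R u x) \<and> (AE x in lborel. complex_of_real r *s u x = r *\<^sub>R u x)"
      using u by (auto intro!: sq)
  qed
  show "cinner u v = cnj (cinner v u)"
  proof transfer
    fix u v :: "real \<Rightarrow> complex^2"
    show "(LINT x|lborel. vec_cinner (u x) (v x)) = cnj (LINT x|lborel. vec_cinner (v x) (u x))"
      by (subst vec_cinner_commute) simp
  qed
  show "cinner (u + v) w = cinner u w + cinner v w"
    by transfer (simp add: vec_cinner_add integrable_vec_cinner)
  show "cinner (c *\<^sub>C u) v = c * cinner u v"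
    by transfer (simp add: vec_cinner_scaleC)
  show "Re (cinner u v) = u \<bullet> v"
  proof transfer
    fix u v :: "real \<Rightarrow> complex^2"
    assume "square_integrable u \<and> square_integrable u \<and> (AE x in lborel. u x = u x)"
      and "square_integrable v \<and> square_integrable v \<and> (AE x in lborel. v x = v x)"
    then show "Re (LINT x|lborel. vec_cinner (u x) (v x)) = (LINT x|lborel. u x \<bullet> v x)"
      by (simp add: integral_Re[symmetric] integrable_vec_cinner Re_vec_cinner)
  qed
qed

end


section \<open>The operators\<close>

text \<open>Real-valued test functions suffice: for complex ones, split into real and imaginary
  parts.\<close>

definition test_function :: "(real \<Rightarrow> real) \<Rightarrow> bool" where
  "test_function \<phi> \<longleftrightarrow>
     (\<forall>n x. (deriv ^^ n) \<phi> differentiable (at x)) \<and> compact (closure {x. \<phi> x \<noteq> 0})"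

lift_definition has_weak_deriv :: "ltwo \<Rightarrow> ltwo \<Rightarrow> bool" is
  "\<lambda>u v. \<forall>\<phi>. test_function \<phi> \<longrightarrow>
     (LINT x|lborel. deriv \<phi> x *\<^sub>R u x) = - (LINT x|lborel. \<phi> x *\<^sub>R v x)"
proof -
  have meas: "\<phi> \<in> borel_measurable borel" "deriv \<phi> \<in> borel_measurable borel"
    if "test_function \<phi>" for \<phi>
  proof -
    have "(deriv ^^ n) \<phi> \<in> borel_measurable borel" for n
      using that unfolding test_function_def
      by (intro borel_measurable_continuous_onI continuous_at_imp_continuous_on ballI
          differentiable_imp_continuous_within) auto
    from this[of 0] this[of 1]
    show "\<phi> \<in> borel_measurable borel" "deriv \<phi> \<in> borel_measurable borel" by simp_all
  qed
  have eq: "(LINT x|lborel. \<psi> x *\<^sub>R u x) = (LINT x|lborel. \<psi> x *\<^sub>R u' x)"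
    if "\<psi> \<in> borel_measurable borel" "square_integrable u" "square_integrable u'"
      "AE x in lborel. u x = u' x" for \<psi> :: "real \<Rightarrow> real" and u u' :: "real \<Rightarrow> complex^2"
    using that by (intro integral_cong_AE) (auto simp: square_integrable_def elim: eventually_mono)
  fix u u' v v' :: "real \<Rightarrow> complex^2"
  assume "square_integrable u \<and> square_integrable u' \<and> (AE x in lborel. u x = u' x)"
    and "square_integrable v \<and> square_integrable v' \<and> (AE x in lborel. v x = v' x)"
  then show "(\<forall>\<phi>. test_function \<phi> \<longrightarrow>
      (LINT x|lborel. deriv \<phi> x *\<^sub>R u x) = - (LINT x|lborel. \<phi> x *\<^sub>R v x)) \<longleftrightarrow>
    (\<forall>\<phi>. test_function \<phi> \<longrightarrow>
      (LINT x|lborel. deriv \<phi> x *\<^sub>R u' x) = - (LINT x|lborel. \<phi> x *\<^sub>R v' x))"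
    using eq[of _ u u'] eq[of _ v v'] meas by simp
qed

text \<open>\<open>H1\<close> is the Sobolev space of order 1. Weak derivatives are unique by the fundamental lemma
  of the calculus of variations.\<close>

definition H1 :: "ltwo set" where
  "H1 = {u. \<exists>v. has_weak_deriv u v}"

definition weak_deriv :: "ltwo \<Rightarrow> ltwo" where
  "weak_deriv u = (THE v. has_weak_deriv u v)"

text \<open>\<open>is_mult_x u v\<close>: the function \<open>x * u(x)\<close> is square-integrable and represents \<open>v\<close>.\<close>

lift_definition is_mult_x :: "ltwo \<Rightarrow> ltwo \<Rightarrow> bool" is
  "\<lambda>u v. AE x in lborel. v x = x *\<^sub>R u x"
  by (intro iffI) (auto elim: eventually_elim2 simp: eventually_conj_iff)

text \<open>\<open>Dom_x\<close> is the maximal domain of multiplication by the coordinate \<open>x\<close>.\<close>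

definition Dom_x :: "ltwo set" where
  "Dom_x = {u. \<exists>v. is_mult_x u v}"

definition mult_x :: "ltwo \<Rightarrow> ltwo" where
  "mult_x u = (THE v. is_mult_x u v)"

lift_definition mult_matrix :: "complex^2^2 \<Rightarrow> ltwo \<Rightarrow> ltwo" is "\<lambda>M u x. M *v u x"
  by (auto intro: square_integrable_bounded_linear[OF _ bounded_linear_matrix]
      elim: eventually_mono)

definition sigma1 :: "complex^2^2" where
  "sigma1 = vector [vector [0, 1], vector [1, 0]]"

definition A0 :: "ltwo operator" where
  "A0 = (\<lambda>u. if u \<in> H1 \<inter> Dom_x
     then Some ((- \<i>) *\<^sub>C mult_matrix sigma1 (weak_deriv u) + \<i> *\<^sub>C mult_x u) else None)"

definition A0_star :: "ltwo operator" where
  "A0_star = (\<lambda>u. if u \<in> H1 \<inter> Dom_x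
     then Some ((- \<i>) *\<^sub>C mult_matrix sigma1 (weak_deriv u) - \<i> *\<^sub>C mult_x u) else None)"

end

(*
On the eigenvectors (1, +-1) of sigma1 the operators A0 - z and A0* - z become, up to constants, the
scalar operators d/dx + (x + mu) and d/dx - (x + mu). The first is surjective with kernel spanned by
g(x) = exp(- x^2/2 - mu x), the second is injective with range { f : integral of g f = 0 }. Solutions are
given by variation of constants; that they lie in the domain follows by integrating the derivative
of x |q|^2 over [-R, R]. Weakly differentiable functions have absolutely continuous
representatives (du Bois-Reymond), so that integration by parts shows that A0 and A0* are formally
adjoint. These solvability facts alone determine ranges and kernels and make the two operators
each other's adjoints, and repeated solution of (A0 - z) u' = u from an eigenvector
gives an infinite Jordan chain.
*)

theory Submission
  imports Defs
begin

section \<open>Smooth bump functions\<close>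

text \<open>The resolvent set turns out to be empty, so the equations are solved directly, at every
  \<open>z\<close>. Along the eigenvector \<open>(1, \<sigma>)\<close> of \<open>sigma1\<close>, the
  equation \<open>(A0 - z) u = F\<close> reads
  \<open>q' - \<sigma> (x + i z) q = i \<sigma> c\<close>, where \<open>c\<close> is the matching
  component of \<open>F\<close>. The eigenvalue thus enters only as the complex translation
  \<open>\<mu> = i z\<close> of an oscillator, which is why no \<open>z\<close> is exceptional. The
  one-dimensional kernel comes from \<open>\<sigma> = - 1\<close> and the one-dimensional cokernel
  from \<open>\<sigma> = 1\<close>. The two scalar operators have indices 1 and - 1, so the index of
  \<open>A0 - z\<close> is 0 although it is never invertible; for the adjoint the chiralities
  exchange roles. The obstacle is the passage from classes of functions with weak derivatives to
  differential equations. Right-hand sides are only square-integrable, so solutions are locally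
  absolutely continuous and in general not differentiable everywhere. All calculus therefore runs
  through the integral relation \<open>is_primitive\<close>, with a product rule obtained from
  Fubini. The passage itself requires enough test functions, hence the explicit bumps.\<close>

definition flat :: "nat \<Rightarrow> real \<Rightarrow> real \<Rightarrow> real" where
  "flat n k y = (if y > 0 then k * (1 / y) ^ n * exp (- (1 / y)) else 0)"

lemma flat_tendsto_0: "(flat n k \<longlongrightarrow> 0) (at 0)"
proof (rule filterlim_split_at)
  have "\<forall>\<^sub>F y in at_left (0::real). flat n k y = 0"
    by (simp add: eventually_at_filter flat_def)
  then show "(flat n k \<longlongrightarrow> 0) (at_left 0)" by (rule tendsto_eventually)
next
  have "((\<lambda>t::real. k * (t ^ n / exp t)) \<longlongrightarrow> k * 0) at_top"
    by (intro tendsto_mult_left tendsto_power_div_exp_0)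
  moreover have "\<forall>\<^sub>F t in at_top. flat n k (inverse t) = k * (t ^ n / exp t)"
    using eventually_gt_at_top[of 0]
    by (rule eventually_mono) (simp add: flat_def exp_minus field_simps)
  ultimately show "(flat n k \<longlongrightarrow> 0) (at_right 0)"
    unfolding filterlim_at_right_to_top by (simp add: tendsto_cong)
qed

text \<open>Differentiating \<open>(1 / y) ^ n * exp (- (1 / y))\<close> raises the power of
  \<open>1 / y\<close> by 2 or by 1; the parameter \<open>k\<close> absorbs the factor
  \<open>- n\<close>, so the family reproduces itself. At 0 the difference quotient of
  \<open>flat n k\<close> is \<open>flat (n + 1) k\<close> itself, which tends to 0.\<close>

lemma has_real_derivative_flat:
  "(flat n k has_real_derivative flat (n + 2) k y + flat (n + 1) (- (real n * k)) y) (at y)"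
proof (cases y "0::real" rule: linorder_cases)
  case less
  have "((\<lambda>_. 0) has_real_derivative 0) (at y)" by simp
  then have "(flat n k has_real_derivative 0) (at y)"
    using less by (elim has_field_derivative_transform_within_open[where S = "{..<0}"])
      (auto simp: flat_def)
  then show ?thesis using less by (simp add: flat_def)
next
  case equal
  have "(\<lambda>h. (flat n k (0 + h) - flat n k 0) / h) = flat (n + 1) k"
    by (auto simp: flat_def fun_eq_iff)
  then have "(flat n k has_real_derivative 0) (at 0)"
    unfolding DERIV_def using flat_tendsto_0[of "n + 1" k] by simp
  then show ?thesis using equal by (simp add: flat_def)
next
  case greater
  have "((\<lambda>y. k * (1 / y) ^ n * exp (- (1 / y))) has_real_derivative
      flat (n + 2) k y + flat (n + 1) (- (real n * k)) y) (at y)"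
    using greater
    by (auto intro!: derivative_eq_intros simp: flat_def)
      (cases n; simp add: field_simps power2_eq_square)
  then show ?thesis
    using greater by (elim has_field_derivative_transform_within_open[where S = "{0<..}"])
      (auto simp: flat_def)
qed

text \<open>The algebra generated by the functions \<open>flat n k\<close> composed with affine maps is closed under
  differentiation, whence all its members are smooth.\<close>

inductive flat_algebra :: "(real \<Rightarrow> real) \<Rightarrow> bool" where
  base: "flat_algebra (\<lambda>x. flat n k (c * x + d))"
| add: "flat_algebra f \<Longrightarrow> flat_algebra g \<Longrightarrow> flat_algebra (\<lambda>x. f x + g x)"
| mult: "flat_algebra f \<Longrightarrow> flat_algebra g \<Longrightarrow> flat_algebra (\<lambda>x. f x * g x)"

lemma flat_algebra_deriv:
  "flat_algebra f \<Longrightarrow> \<exists>f'. flat_algebra f' \<and> (\<forall>x. (f has_real_derivative f' x) (at x))"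
proof (induction rule: flat_algebra.induct)
  case (base n k c d)
  \<comment> \<open>The algebra has no rule for scalar multiples; the inner derivative
    \<open>c\<close> goes into the parameter \<open>k\<close> of \<open>flat\<close>.\<close>
  let ?f' = "\<lambda>x. flat (n + 2) (c * k) (c * x + d) + flat (n + 1) (c * (- (real n * k))) (c * x + d)"
  have "((\<lambda>x. flat n k (c * x + d)) has_real_derivative ?f' x) (at x)" for x
  proof -
    have "((\<lambda>x. c * x + d) has_real_derivative c) (at x)"
      by (auto intro!: derivative_eq_intros)
    from DERIV_chain2[OF has_real_derivative_flat this] show ?thesis
      by (rule DERIV_cong) (simp add: flat_def algebra_simps)
  qed
  then show ?case by (intro exI[of _ ?f']) (auto intro: flat_algebra.intros)
next
  case (add f g)
  then obtain f' g' where "flat_algebra f'" "flat_algebra g'"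
    "\<forall>x. (f has_real_derivative f' x) (at x)" "\<forall>x. (g has_real_derivative g' x) (at x)" by blast
  then show ?case
    by (intro exI[of _ "\<lambda>x. f' x + g' x"]) (auto intro: flat_algebra.intros DERIV_add)
next
  case (mult f g)
  then obtain f' g' where "flat_algebra f'" "flat_algebra g'"
    "\<forall>x. (f has_real_derivative f' x) (at x)" "\<forall>x. (g has_real_derivative g' x) (at x)" by blast
  with mult show ?case
    by (intro exI[of _ "\<lambda>x. f' x * g x + g' x * f x"]) (auto intro: flat_algebra.intros DERIV_mult)
qed

lemma flat_algebra_funpow_deriv: "flat_algebra f \<Longrightarrow> flat_algebra ((deriv ^^ n) f)"
proof (induction n arbitrary: f)
  case (Suc n)
  obtain f' where "flat_algebra f'" "\<forall>x. (f has_real_derivative f' x) (at x)"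
    using flat_algebra_deriv[OF Suc.prems] by blast
  then have "deriv f = f'" "flat_algebra f'" by (auto intro!: DERIV_imp_deriv)
  then show ?case using Suc.IH[of f'] by (simp add: funpow_Suc_right del: funpow.simps)
qed simp

lemma flat_algebra_smooth: "flat_algebra f \<Longrightarrow> (deriv ^^ n) f differentiable (at x)"
  using flat_algebra_deriv[OF flat_algebra_funpow_deriv[of f n]]
  by (auto simp: real_differentiable_def)

lemma flat_algebra_continuous: "flat_algebra f \<Longrightarrow> continuous_on A f"
  using flat_algebra_deriv by (meson DERIV_isCont continuous_at_imp_continuous_on)

lemma flat_algebra_measurable: "flat_algebra f \<Longrightarrow> f \<in> borel_measurable borel"
  by (intro borel_measurable_continuous_onI flat_algebra_continuous)

text \<open>Inside \<open>(a, b)\<close> the exponents shrink as \<open>n\<close> grows, so the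
  bumps approach the indicator of the open interval from below. The arguments are expanded to the
  shape \<open>c * x + d\<close> of the base rule of \<open>flat_algebra\<close>.\<close>

definition bump :: "real \<Rightarrow> real \<Rightarrow> nat \<Rightarrow> real \<Rightarrow> real" where
  "bump a b n x = flat 0 1 (real (Suc n) * x + - real (Suc n) * a) *
     flat 0 1 (- real (Suc n) * x + real (Suc n) * b)"

lemma flat_algebra_bump: "flat_algebra (bump a b n)"
  unfolding bump_def[abs_def] by (intro flat_algebra.intros)

lemma flat_affine: "c > 0 \<Longrightarrow> flat 0 1 (c * y) = (if y > 0 then exp (- (1 / (c * y))) else 0)"
  by (auto simp: flat_def zero_less_mult_iff)

lemma bump_eq: "bump a b n x = (if a < x \<and> x < b
    then exp (- (1 / (real (Suc n) * (x - a)))) * exp (- (1 / (real (Suc n) * (b - x)))) else 0)"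
proof -
  have "bump a b n x = flat 0 1 (real (Suc n) * (x - a)) * flat 0 1 (real (Suc n) * (b - x))"
    unfolding bump_def by (simp only: right_diff_distrib) (simp add: algebra_simps)
  then show ?thesis by (simp only: flat_affine) auto
qed

lemma bump_bounds: "0 \<le> bump a b n x" "bump a b n x \<le> indicator {a<..<b} x"
  by (auto simp: bump_eq mult_le_one)

lemma bump_tendsto: "(\<lambda>n. bump a b n x) \<longlonglongrightarrow> indicator {a<..<b} x"
proof (cases "a < x \<and> x < b")
  case True
  have *: "(\<lambda>n. exp (- (1 / (real (Suc n) * t)))) \<longlonglongrightarrow> 1" if "t > 0" for t :: real
  proof -
    have "(\<lambda>n. exp (- (inverse (real (Suc n)) * (1 / t)))) \<longlonglongrightarrow> exp (- (0 * (1 / t)))"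
      by (intro tendsto_intros LIMSEQ_inverse_real_of_nat)
    then show ?thesis by (simp add: field_simps)
  qed
  have "(\<lambda>n. bump a b n x) \<longlonglongrightarrow> 1 * 1"
    unfolding bump_eq using True by (simp only: if_True simp_thms) (intro tendsto_mult *; simp)
  then show ?thesis using True by simp
qed (auto simp: bump_eq)

lemma flat_algebra_scaled_bump: "flat_algebra (\<lambda>x. k * bump a b n x)"
proof -
  have "(\<lambda>x. k * bump a b n x) = (\<lambda>x. flat 0 k (real (Suc n) * x + - real (Suc n) * a) *
     flat 0 1 (- real (Suc n) * x + real (Suc n) * b))"
    by (auto simp: bump_def fun_eq_iff flat_def)
  then show ?thesis by (simp only:) (intro flat_algebra.intros)
qed

section \<open>Locally integrable functions determined by their interval integrals\<close>

definition locally_integrable :: "(real \<Rightarrow> 'a::{banach, second_countable_topology}) \<Rightarrow> bool" where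
  "locally_integrable f \<longleftrightarrow> (\<forall>a b. set_integrable lborel {a..b} f)"

lemma locally_integrable_measurable:
  assumes "locally_integrable f" shows "f \<in> borel_measurable borel"
proof (rule borel_measurable_LIMSEQ_metric)
  show "(\<lambda>x. indicator {- real n..real n} x *\<^sub>R f x) \<in> borel_measurable borel" for n
    using assms borel_measurable_integrable
    by (fastforce simp: locally_integrable_def set_integrable_def)
  show "(\<lambda>n. indicator {- real n..real n} x *\<^sub>R f x) \<longlonglongrightarrow> f x" for x
  proof (rule tendsto_eventually, rule eventually_mono)
    show "\<forall>\<^sub>F n in sequentially. \<bar>x\<bar> \<le> real n"
      using eventually_ge_at_top[of "nat \<lceil>\<bar>x\<bar>\<rceil>"] by eventually_elim linarith
  qed (simp add: abs_le_iff)
qed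

lemma locally_integrable_Ioo: "locally_integrable f \<Longrightarrow> set_integrable lborel {a<..<b} f"
  by (rule set_integrable_subset[of _ "{a..b}"]) (auto simp: locally_integrable_def)

lemma bump_integral_tendsto:
  fixes z :: "real \<Rightarrow> 'a::{banach, second_countable_topology}"
  assumes z: "locally_integrable z"
  shows "(\<lambda>n. LINT x|lborel. bump a b n x *\<^sub>R z x) \<longlonglongrightarrow> (LINT x:{a<..<b}|lborel. z x)"
  unfolding set_lebesgue_integral_def
proof (rule integral_dominated_convergence[where w = "\<lambda>x. norm (indicator {a<..<b} x *\<^sub>R z x)"])
  note [measurable] = locally_integrable_measurable[OF z] flat_algebra_measurable[OF flat_algebra_bump]
  show "(\<lambda>x. indicat_real {a<..<b} x *\<^sub>R z x) \<in> borel_measurable lborel" by measurable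
  show "(\<lambda>x. bump a b n x *\<^sub>R z x) \<in> borel_measurable lborel" for n by measurable
  show "integrable lborel (\<lambda>x. norm (indicat_real {a<..<b} x *\<^sub>R z x))"
    using locally_integrable_Ioo[OF z] unfolding set_integrable_def by (rule integrable_norm)
  show "AE x in lborel. (\<lambda>n. bump a b n x *\<^sub>R z x) \<longlonglongrightarrow> indicat_real {a<..<b} x *\<^sub>R z x"
    by (intro AE_I2 tendsto_scaleR bump_tendsto tendsto_const)
  show "AE x in lborel. norm (bump a b n x *\<^sub>R z x) \<le> norm (indicat_real {a<..<b} x *\<^sub>R z x)" for n
    using bump_bounds[of a b n] by (intro AE_I2) (auto intro!: mult_right_mono)
qed

lemma Int_stable_Ioo: "Int_stable (range (\<lambda>(a, b). {a<..<b::'a::linorder}))"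
  by (rule Int_stableI) (force simp: image_iff)

text \<open>The Borel sets over which the integral vanishes form a Dynkin system containing the
  intersection-stable open intervals, hence all Borel sets. Cutting off to \<open>(- n, n)\<close>
  makes the function integrable on the whole line, so that complements make sense, and intersecting
  an interval with \<open>(- n, n)\<close> gives an interval again.\<close>

lemma AE_zero_if_interval_integrals_zero:
  fixes z :: "real \<Rightarrow> 'a::{banach, second_countable_topology}"
  assumes z: "locally_integrable z"
    and zero: "\<And>a b. (LINT x:{a<..<b}|lborel. z x) = 0"
  shows "AE x in lborel. z x = 0"
proof -
  have "AE x in lborel. indicator {- real n<..<real n} x *\<^sub>R z x = 0" for n
  proof (rule sigma_finite_measure.density_zero[OF sigma_finite_lborel])
    define w where "w x = indicator {- real n<..<real n} x *\<^sub>R z x" for x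
    show w: "integrable lborel (\<lambda>x. indicator {- real n<..<real n} x *\<^sub>R z x)"
      using locally_integrable_Ioo[OF z] by (simp add: set_integrable_def)
    have int: "set_integrable lborel A w" if "A \<in> sets borel" for A
      using w that unfolding w_def[symmetric] set_integrable_def
      by (intro integrable_mult_indicator) auto
    fix A :: "real set" assume "A \<in> sets lborel"
    then have A: "A \<in> sigma_sets UNIV (range (\<lambda>(a, b). {a<..<b::real}))"
      by (simp add: borel_eq_box box_real)
    have sub: "range (\<lambda>(a, b). {a<..<b::real}) \<subseteq> Pow UNIV" by simp
    from Int_stable_Ioo sub A have "A \<in> sets borel \<and> (LINT x:A|lborel. w x) = 0"
    proof (induction rule: sigma_sets_induct_disjoint)
      case (basic A)
      then obtain a b where A: "A = {a<..<b}" by auto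
      have "(LINT x:A|lborel. w x) = (LINT x:{max a (- real n)<..<min b (real n)}|lborel. z x)"
        unfolding set_lebesgue_integral_def w_def A
        by (rule Bochner_Integration.integral_cong) (auto simp: indicator_def)
      then show ?case using zero A by simp
    next
      case (compl A)
      then have A: "A \<in> sets borel" by simp
      have "(LINT x:A \<union> (UNIV - A)|lborel. w x) = (LINT x:A|lborel. w x) + (LINT x:UNIV - A|lborel. w x)"
        using A by (intro set_integral_Un int) auto
      moreover have "(LINT x:A \<union> (UNIV - A)|lborel. w x) = 0"
        using zero[of "- real n" "real n"] by (simp add: set_lebesgue_integral_def w_def)
      ultimately show ?case using compl by auto
    next
      case (union A)
      then have "(LINT x:(\<Union>i. A i)|lborel. w x) = (\<Sum>i. (LINT x:(A i)|lborel. w x))"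
        by (intro lebesgue_integral_countable_add int)
          (auto simp: disjoint_family_on_def image_subset_iff)
      then show ?case using union by auto
    qed (auto simp: set_lebesgue_integral_def)
    then show "(LINT x:A|lborel. indicator {- real n<..<real n} x *\<^sub>R z x) = 0"
      by (simp add: w_def)
  qed
  then have "AE x in lborel. \<forall>n. indicator {- real n<..<real n} x *\<^sub>R z x = 0"
    by (subst AE_all_countable) blast
  then show ?thesis
  proof eventually_elim
    case (elim x)
    obtain n where "\<bar>x\<bar> < real n" using reals_Archimedean2 by blast
    then show ?case using elim[rule_format, of n] by (auto simp: indicator_def split: if_splits)
  qed
qed

section \<open>Primitives of locally integrable functions\<close>

lemma locally_integrable_continuous:
  fixes f :: "real \<Rightarrow> 'a::{banach, second_countable_topology}"
  assumes "continuous_on UNIV f" shows "locally_integrable f"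
  unfolding locally_integrable_def
  using assms by (auto intro!: borel_integrable_atLeastAtMost' continuous_on_subset[OF assms])

lemma locally_integrable_add:
  "locally_integrable f \<Longrightarrow> locally_integrable g \<Longrightarrow> locally_integrable (\<lambda>x. f x + g x)"
  by (simp add: locally_integrable_def)

lemma locally_integrable_bounded_linear:
  assumes f: "locally_integrable f" and L: "bounded_linear L"
  shows "locally_integrable (\<lambda>x. L (f x))"
  unfolding locally_integrable_def set_integrable_def
proof (intro allI)
  fix a b
  have "integrable lborel (\<lambda>x. L (indicator {a..b} x *\<^sub>R f x))"
    using f by (intro integrable_bounded_linear[OF L]) (simp add: locally_integrable_def set_integrable_def)
  then show "integrable lborel (\<lambda>x. indicator {a..b} x *\<^sub>R L (f x))"
    by (simp add: linear_simps[OF L])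
qed

lemma locally_integrable_integrable: "integrable lborel f \<Longrightarrow> locally_integrable f"
  unfolding locally_integrable_def set_integrable_def
  by (auto intro: integrable_mult_indicator)

lemma locally_integrable_bilinear:
  fixes f :: "real \<Rightarrow> 'a::{banach, second_countable_topology}"
    and g :: "real \<Rightarrow> 'b::{banach, second_countable_topology}"
    and p :: "'a \<Rightarrow> 'b \<Rightarrow> 'c::{banach, second_countable_topology}"
  assumes p: "bounded_bilinear p" and f: "locally_integrable f" and g: "continuous_on UNIV g"
  shows "locally_integrable (\<lambda>x. p (f x) (g x))"
  unfolding locally_integrable_def set_integrable_def
proof (intro allI)
  fix a b :: real
  obtain K where K: "K > 0" "\<And>x y. norm (p x y) \<le> norm x * norm y * K"
    using bounded_bilinear.pos_bounded[OF p] by blast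
  have "compact (g ` {a..b})"
    by (intro compact_continuous_image continuous_on_subset[OF g]) auto
  then obtain M where M: "M > 0" "\<And>x. x \<in> {a..b} \<Longrightarrow> norm (g x) \<le> M"
    using compact_imp_bounded bounded_pos by (metis imageI)
  note [measurable] = locally_integrable_measurable[OF f] borel_measurable_continuous_onI[OF g]
  have cont: "continuous_on UNIV (\<lambda>z. p (fst z) (snd z))"
    by (intro bounded_bilinear.continuous_on[OF p] continuous_intros)
  have [measurable]: "(\<lambda>x. p (f x) (g x)) \<in> borel_measurable borel"
    by (rule borel_measurable_continuous_Pair[OF _ _ cont]) measurable
  show "integrable lborel (\<lambda>x. indicator {a..b} x *\<^sub>R p (f x) (g x))"
  proof (rule Bochner_Integration.integrable_bound)
    show "integrable lborel (\<lambda>x. norm (indicator {a..b} x *\<^sub>R f x) * (M * K))"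
      using f unfolding locally_integrable_def set_integrable_def
      by (intro integrable_mult_left integrable_norm) auto
    have "norm (p (f x) (g x)) \<le> norm (f x) * (M * K)" if "x \<in> {a..b}" for x
    proof -
      have "norm (f x) * norm (g x) * K \<le> norm (f x) * M * K"
        using M(2)[OF that] K(1) by (intro mult_right_mono mult_left_mono) auto
      then show ?thesis using K(2)[of "f x" "g x"] by (simp add: mult.assoc)
    qed
    then show "AE x in lborel. norm (indicator {a..b} x *\<^sub>R p (f x) (g x))
        \<le> norm (norm (indicator {a..b} x *\<^sub>R f x) * (M * K))"
      using M(1) K(1) by (intro AE_I2) (auto simp: indicator_def)
  qed measurable
qed

text \<open>This is local absolute continuity of \<open>f\<close> with almost everywhere derivative
  \<open>g\<close>, encoded by the fundamental theorem of calculus. The restriction to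
  \<open>a \<le> b\<close> is there because a set integral carries no orientation.\<close>

definition is_primitive :: "(real \<Rightarrow> 'a::{banach, second_countable_topology}) \<Rightarrow> (real \<Rightarrow> 'a) \<Rightarrow> bool" where
  "is_primitive f g \<longleftrightarrow> locally_integrable g \<and>
     (\<forall>a b. a \<le> b \<longrightarrow> f b - f a = (LINT x:{a..b}|lborel. g x))"

lemma is_primitiveD:
  assumes "is_primitive f g"
  shows "locally_integrable g" "a \<le> b \<Longrightarrow> (LINT x:{a..b}|lborel. g x) = f b - f a"
  using assms by (auto simp: is_primitive_def)

lemma is_primitive_locally_integrable: "is_primitive f g \<Longrightarrow> set_integrable lborel {a..b} g"
  by (simp add: is_primitive_def locally_integrable_def)

lemma is_primitive_continuous:
  fixes f :: "real \<Rightarrow> 'a::euclidean_space"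
  assumes "is_primitive f g" shows "continuous_on UNIV f"
proof -
  have "continuous_on {a..b} f" for a b
  proof (rule continuous_on_eq)
    show "continuous_on {a..b} (\<lambda>x. f a + integral {a..x} g)"
      using is_primitive_locally_integrable[OF assms]
      by (intro continuous_intros indefinite_integral_continuous_1 set_borel_integral_eq_integral)
    show "f a + integral {a..x} g = f x" if "x \<in> {a..b}" for x
      using that is_primitiveD(2)[OF assms, of a x]
        set_borel_integral_eq_integral(2)[OF is_primitive_locally_integrable[OF assms]]
      by (auto simp: algebra_simps)
  qed
  then have "continuous_on {x - 1<..<x + 1} f" for x
    by (rule continuous_on_subset[where s = "{x - 1..x + 1}"]) auto
  then have "isCont f x" for x
    using continuous_on_eq_continuous_at[of "{x - 1<..<x + 1}" f] by force
  then show ?thesis by (simp add: continuous_at_imp_continuous_on)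
qed

lemma is_primitive_measurable:
  fixes f :: "real \<Rightarrow> 'a::euclidean_space"
  assumes "is_primitive f g"
  shows "f \<in> borel_measurable borel" "g \<in> borel_measurable borel"
  using is_primitive_continuous[OF assms] is_primitiveD(1)[OF assms]
  by (auto intro: borel_measurable_continuous_onI locally_integrable_measurable)

lemma is_primitive_FTC:
  fixes f :: "real \<Rightarrow> 'a::euclidean_space"
  assumes "\<And>x. (f has_vector_derivative g x) (at x)" "continuous_on UNIV g"
  shows "is_primitive f g"
  unfolding is_primitive_def
proof (intro conjI allI impI)
  show "locally_integrable g" by (rule locally_integrable_continuous) fact
  show "f b - f a = (LINT x:{a..b}|lborel. g x)" if "a \<le> b" for a b
    unfolding set_lebesgue_integral_def using that assms
    by (intro integral_FTC_atLeastAtMost[symmetric])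
      (auto intro: has_vector_derivative_at_within continuous_on_subset)
qed

lemma is_primitive_exists:
  fixes g :: "real \<Rightarrow> 'a::euclidean_space"
  assumes g: "locally_integrable g"
  shows "\<exists>f. is_primitive f g"
proof -
  have int: "set_integrable lborel {a..b} g" for a b using g by (simp add: locally_integrable_def)
  \<comment> \<open>One of the two intervals is always empty or a point, so this is the oriented
    integral from 0 to \<open>x\<close>.\<close>
  define f where "f x = integral {0..x} g - integral {x..0} g" for x
  note combine = Henstock_Kurzweil_Integration.integral_combine[OF _ _ set_borel_integral_eq_integral(1)[OF int]]
  have "f b - f a = integral {a..b} g" if "a \<le> b" for a b
  proof -
    consider "0 \<le> a" | "a \<le> 0" "0 \<le> b" | "b \<le> 0" by linarith
    then show ?thesis
    proof cases
      case 1
      then show ?thesis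
        using combine[of 0 a b] that unfolding f_def by (cases "a = 0"; cases "b = 0") (auto simp: algebra_simps)
    next
      case 2
      then show ?thesis
        using combine[of a 0 b] that unfolding f_def by (cases "a = 0"; cases "b = 0") (auto simp: algebra_simps)
    next
      case 3
      then show ?thesis
        using combine[of a b 0] that unfolding f_def by (cases "a = 0"; cases "b = 0") (auto simp: algebra_simps)
    qed
  qed
  then show ?thesis
    using g set_borel_integral_eq_integral(2)[OF int] by (auto simp: is_primitive_def)
qed

lemma is_primitive_bounded_linear:
  assumes "is_primitive f g" "bounded_linear L"
  shows "is_primitive (\<lambda>x. L (f x)) (\<lambda>x. L (g x))"
  unfolding is_primitive_def
proof (intro conjI allI impI locally_integrable_bounded_linear[OF is_primitiveD(1)[OF assms(1)] assms(2)])
  fix a b :: real assume "a \<le> b"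
  have "(LINT x:{a..b}|lborel. L (g x)) = L (LINT x:{a..b}|lborel. g x)"
    using integral_bounded_linear[OF assms(2), of lborel "\<lambda>x. indicator {a..b} x *\<^sub>R g x"]
      is_primitive_locally_integrable[OF assms(1), of a b]
    by (simp add: set_lebesgue_integral_def set_integrable_def linear_simps[OF assms(2)])
  then show "L (f b) - L (f a) = (LINT x:{a..b}|lborel. L (g x))"
    using is_primitiveD(2)[OF assms(1) \<open>a \<le> b\<close>] by (simp add: linear_simps[OF assms(2)])
qed

lemma is_primitive_add:
  assumes "is_primitive f f'" "is_primitive g g'"
  shows "is_primitive (\<lambda>x. f x + g x) (\<lambda>x. f' x + g' x)"
  unfolding is_primitive_def
proof (intro conjI allI impI locally_integrable_add is_primitiveD(1)[OF assms(1)] is_primitiveD(1)[OF assms(2)])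
  fix a b :: real assume ab: "a \<le> b"
  show "f b + g b - (f a + g a) = (LINT x:{a..b}|lborel. f' x + g' x)"
    using is_primitiveD(2)[OF assms(1) ab] is_primitiveD(2)[OF assms(2) ab]
    by (subst set_integral_add) (simp_all add: is_primitive_locally_integrable[OF assms(1)]
        is_primitive_locally_integrable[OF assms(2)])
qed

lemma is_primitive_const: "is_primitive (\<lambda>x. c) (\<lambda>x. 0)"
  by (simp add: is_primitive_def locally_integrable_def set_lebesgue_integral_def set_integrable_def)

lemma is_primitive_cong: "is_primitive f g \<Longrightarrow> (\<And>x. g x = h x) \<Longrightarrow> is_primitive f h"
  by (simp add: ext[of g h])

text \<open>Both half-lines occur because the product rule cuts a square into the part on or below
  the diagonal and the part strictly above it; a single point is null, so the values agree.\<close>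

lemma is_primitive_increment:
  fixes f :: "real \<Rightarrow> 'a::euclidean_space"
  assumes f: "is_primitive f f'" and x: "x \<in> {a..b}"
  shows "(LINT y|lborel. indicator {..x} y *\<^sub>R indicator {a..b} y *\<^sub>R f' y) = f x - f a" (is ?le)
    and "(LINT y|lborel. indicator {..<x} y *\<^sub>R indicator {a..b} y *\<^sub>R f' y) = f x - f a" (is ?lt)
proof -
  note [measurable] = is_primitive_measurable(2)[OF f]
  have "(LINT y|lborel. indicator {..x} y *\<^sub>R indicator {a..b} y *\<^sub>R f' y) = (LINT y:{a..x}|lborel. f' y)"
    unfolding set_lebesgue_integral_def using x
    by (intro Bochner_Integration.integral_cong) (auto simp: indicator_def)
  also have "\<dots> = f x - f a" using is_primitiveD(2)[OF f] x by auto
  finally show ?le .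
  moreover have "(LINT y|lborel. indicator {..<x} y *\<^sub>R indicator {a..b} y *\<^sub>R f' y)
      = (LINT y|lborel. indicator {..x} y *\<^sub>R indicator {a..b} y *\<^sub>R f' y)"
  proof (rule integral_cong_AE)
    show "AE y in lborel. indicat_real {..<x} y *\<^sub>R indicat_real {a..b} y *\<^sub>R f' y
        = indicat_real {..x} y *\<^sub>R indicat_real {a..b} y *\<^sub>R f' y"
      using AE_lborel_singleton[of x] by eventually_elim (auto simp: indicator_def)
  qed measurable
  ultimately show ?lt by simp
qed

text \<open>With \<open>F\<close>, \<open>G\<close> the derivatives cut off to \<open>[a, b]\<close>, splitting the square at the diagonal
  turns \<open>p (\<integral>F) (\<integral>G)\<close> into the two integrals of the product rule.\<close>

lemma is_primitive_bilinear:
  fixes f :: "real \<Rightarrow> 'a::euclidean_space" and g :: "real \<Rightarrow> 'b::euclidean_space"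
    and p :: "'a \<Rightarrow> 'b \<Rightarrow> 'c::euclidean_space"
  assumes p: "bounded_bilinear p" and f: "is_primitive f f'" and g: "is_primitive g g'"
  shows "is_primitive (\<lambda>x. p (f x) (g x)) (\<lambda>x. p (f' x) (g x) + p (f x) (g' x))"
  unfolding is_primitive_def
proof (intro conjI allI impI)
  interpret p: bounded_bilinear p by fact
  have li1: "locally_integrable (\<lambda>x. p (f' x) (g x))"
    by (intro locally_integrable_bilinear[OF p] is_primitiveD(1)[OF f] is_primitive_continuous[OF g])
  have li2: "locally_integrable (\<lambda>x. p (f x) (g' x))"
    by (intro locally_integrable_bilinear[OF p.flip] is_primitiveD(1)[OF g] is_primitive_continuous[OF f])
  show "locally_integrable (\<lambda>x. p (f' x) (g x) + p (f x) (g' x))"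
    using li1 li2 by (rule locally_integrable_add)
  fix a b :: real assume ab: "a \<le> b"
  define F where "F x = indicator {a..b} x *\<^sub>R f' x" for x
  define G where "G x = indicator {a..b} x *\<^sub>R g' x" for x
  note [measurable] = is_primitive_measurable[OF f] is_primitive_measurable[OF g]
  have intF: "integrable lborel F" and intG: "integrable lborel G"
    using is_primitive_locally_integrable[OF f, of a b] is_primitive_locally_integrable[OF g, of a b]
    by (simp_all add: F_def[abs_def] G_def[abs_def] set_integrable_def)
  have [measurable]: "F \<in> borel_measurable borel" "G \<in> borel_measurable borel"
    unfolding F_def G_def by measurable
  have cont: "continuous_on UNIV (\<lambda>z. p (fst z) (snd z))"
    by (intro p.continuous_on continuous_intros)
  have [measurable]: "(\<lambda>z. p (F (fst z)) (G (snd z))) \<in> borel_measurable (lborel \<Otimes>\<^sub>M lborel)"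
    by (rule borel_measurable_continuous_Pair[OF _ _ cont]) measurable
  have int_norm: "integrable (lborel \<Otimes>\<^sub>M lborel) (\<lambda>z. norm (F (fst z)) * norm (G (snd z)))"
    using intF intG by (intro lborel_pair.Fubini_integrable) auto
  obtain K where K: "K > 0" "\<And>x y. norm (p x y) \<le> norm x * norm y * K"
    using p.pos_bounded by blast
  have int_p: "integrable (lborel \<Otimes>\<^sub>M lborel) (\<lambda>z. p (F (fst z)) (G (snd z)))"
  proof (rule Bochner_Integration.integrable_bound)
    show "integrable (lborel \<Otimes>\<^sub>M lborel) (\<lambda>z. norm (F (fst z)) * norm (G (snd z)) * K)"
      using int_norm by (rule integrable_mult_left)
    show "AE z in lborel \<Otimes>\<^sub>M lborel. norm (p (F (fst z)) (G (snd z)))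
        \<le> norm (norm (F (fst z)) * norm (G (snd z)) * K)"
      using K by (intro AE_I2) auto
  qed measurable
  have int_ind: "integrable (lborel \<Otimes>\<^sub>M lborel)
      (\<lambda>z. indicator {z. snd z \<le> fst z} z *\<^sub>R p (F (fst z)) (G (snd z)))"
    "integrable (lborel \<Otimes>\<^sub>M lborel)
      (\<lambda>z. indicator {z. fst z < snd z} z *\<^sub>R p (F (fst z)) (G (snd z)))"
    using int_p borel_closed[OF closed_Collect_le, of "snd :: real \<times> real \<Rightarrow> real" fst]
      borel_open[OF open_Collect_less, of "fst :: real \<times> real \<Rightarrow> real" snd]
    by (auto intro!: integrable_mult_indicator simp: lborel_prod continuous_on_id
        continuous_on_fst continuous_on_snd)
  \<comment> \<open>Below the diagonal the inner integral is \<open>g x - g a\<close>. This gives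
    one integral of the product rule minus a boundary term at \<open>a\<close>; together with its
    counterpart above the diagonal and \<open>p (f b - f a) (g b - g a)\<close>, the boundary terms
    combine to the increment of \<open>p (f x) (g x)\<close>.\<close>
  have 1: "(LINT x|lborel. LINT y|lborel. indicator {z. snd z \<le> fst z} (x, y) *\<^sub>R p (F x) (G y))
      = (LINT x:{a..b}|lborel. p (f' x) (g x)) - p (f b - f a) (g a)"
  proof -
    have "(LINT y|lborel. indicator {z. snd z \<le> fst z} (x, y) *\<^sub>R p (F x) (G y))
        = indicator {a..b} x *\<^sub>R p (f' x) (g x) - p (F x) (g a)" for x
    proof -
      have "(LINT y|lborel. indicator {z. snd z \<le> fst z} (x, y) *\<^sub>R p (F x) (G y))
          = (LINT y|lborel. p (F x) (indicator {..x} y *\<^sub>R G y))"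
        by (intro Bochner_Integration.integral_cong) (auto simp: indicator_def p.zero_right)
      also have "\<dots> = p (F x) (LINT y|lborel. indicator {..x} y *\<^sub>R G y)"
        using intG by (intro integral_bounded_linear p.bounded_linear_right integrable_mult_indicator) auto
      also have "\<dots> = indicator {a..b} x *\<^sub>R p (f' x) (g x) - p (F x) (g a)"
        using is_primitive_increment(1)[OF g, of x a b] by (auto simp: G_def F_def indicator_def p.diff_right p.zero_left)
      finally show ?thesis .
    qed
    then have "(LINT x|lborel. LINT y|lborel. indicator {z. snd z \<le> fst z} (x, y) *\<^sub>R p (F x) (G y))
      = (LINT x|lborel. indicator {a..b} x *\<^sub>R p (f' x) (g x) - p (F x) (g a))" by simp
    also have "\<dots> = (LINT x:{a..b}|lborel. p (f' x) (g x)) - p (LINT x|lborel. F x) (g a)"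
      using li1 intF
      by (subst Bochner_Integration.integral_diff)
        (auto simp: locally_integrable_def set_integrable_def set_lebesgue_integral_def
          integral_bounded_linear[OF p.bounded_linear_left]
          intro: integrable_bounded_linear[OF p.bounded_linear_left])
    finally show ?thesis
      using is_primitiveD(2)[OF f ab] by (simp add: F_def[abs_def] set_lebesgue_integral_def)
  qed
  have 2: "(LINT x|lborel. LINT y|lborel. indicator {z. fst z < snd z} (x, y) *\<^sub>R p (F x) (G y))
      = (LINT x:{a..b}|lborel. p (f x) (g' x)) - p (f a) (g b - g a)"
  proof -
    have "(LINT x|lborel. indicator {z. fst z < snd z} (x, y) *\<^sub>R p (F x) (G y))
        = indicator {a..b} y *\<^sub>R p (f y) (g' y) - p (f a) (G y)" for y
    proof -
      have "(LINT x|lborel. indicator {z. fst z < snd z} (x, y) *\<^sub>R p (F x) (G y))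
          = (LINT x|lborel. p (indicator {..<y} x *\<^sub>R F x) (G y))"
        by (intro Bochner_Integration.integral_cong) (auto simp: indicator_def p.zero_left)
      also have "\<dots> = p (LINT x|lborel. indicator {..<y} x *\<^sub>R F x) (G y)"
        using intF by (intro integral_bounded_linear p.bounded_linear_left integrable_mult_indicator) auto
      also have "\<dots> = indicator {a..b} y *\<^sub>R p (f y) (g' y) - p (f a) (G y)"
        using is_primitive_increment(2)[OF f, of y a b] by (auto simp: G_def F_def indicator_def p.diff_left p.zero_right)
      finally show ?thesis .
    qed
    then have "(LINT y|lborel. LINT x|lborel. indicator {z. fst z < snd z} (x, y) *\<^sub>R p (F x) (G y))
      = (LINT y|lborel. indicator {a..b} y *\<^sub>R p (f y) (g' y) - p (f a) (G y))" by simp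
    also have "\<dots> = (LINT x:{a..b}|lborel. p (f x) (g' x)) - p (f a) (LINT x|lborel. G x)"
      using li2 intG
      by (subst Bochner_Integration.integral_diff)
        (auto simp: locally_integrable_def set_integrable_def set_lebesgue_integral_def
          integral_bounded_linear[OF p.bounded_linear_right]
          intro: integrable_bounded_linear[OF p.bounded_linear_right])
    \<comment> \<open>Above the diagonal \<open>x\<close> was integrated first; Fubini restores the
      order used in the other half, so that the two can be added.\<close>
    also have "(LINT y|lborel. LINT x|lborel. indicator {z. fst z < snd z} (x, y) *\<^sub>R p (F x) (G y))
        = (LINT x|lborel. LINT y|lborel. indicator {z. fst z < snd z} (x, y) *\<^sub>R p (F x) (G y))"
      using int_ind(2) by (intro lborel_pair.Fubini_integral) (simp add: case_prod_beta')
    finally show ?thesis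
      using is_primitiveD(2)[OF g ab] by (simp add: G_def[abs_def] set_lebesgue_integral_def)
  qed
  have "(LINT x|lborel. LINT y|lborel. indicator {z. snd z \<le> fst z} (x, y) *\<^sub>R p (F x) (G y))
      + (LINT x|lborel. LINT y|lborel. indicator {z. fst z < snd z} (x, y) *\<^sub>R p (F x) (G y))
      = (LINT z|(lborel \<Otimes>\<^sub>M lborel). indicator {z. snd z \<le> fst z} z *\<^sub>R p (F (fst z)) (G (snd z))
          + indicator {z. fst z < snd z} z *\<^sub>R p (F (fst z)) (G (snd z)))"
    using lborel_pair.integral_fst'[OF int_ind(1)] lborel_pair.integral_fst'[OF int_ind(2)]
      Bochner_Integration.integral_add[OF int_ind] by simp
  also have "\<dots> = (LINT z|(lborel \<Otimes>\<^sub>M lborel). p (F (fst z)) (G (snd z)))"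
    by (intro Bochner_Integration.integral_cong) (auto simp: indicator_def)
  also have "\<dots> = (LINT x|lborel. LINT y|lborel. p (F x) (G y))"
    using lborel_pair.integral_fst'[OF int_p] by simp
  also have "\<dots> = (LINT x|lborel. p (F x) (LINT y|lborel. G y))"
    by (simp add: integral_bounded_linear[OF p.bounded_linear_right intG])
  also have "\<dots> = p (LINT x|lborel. F x) (LINT y|lborel. G y)"
    by (simp add: integral_bounded_linear[OF p.bounded_linear_left intF])
  also have "\<dots> = p (f b - f a) (g b - g a)"
    using is_primitiveD(2)[OF f ab] is_primitiveD(2)[OF g ab]
    by (simp add: F_def[abs_def] G_def[abs_def] set_lebesgue_integral_def)
  finally show "p (f b) (g b) - p (f a) (g a) = (LINT x:{a..b}|lborel. p (f' x) (g x) + p (f x) (g' x))"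
    using li1 li2 unfolding 1 2
    by (subst set_integral_add) (auto simp: locally_integrable_def p.diff_left p.diff_right algebra_simps)
qed

section \<open>Weak derivatives\<close>

lemma test_function_flat_algebra:
  assumes "flat_algebra \<psi>" and supp: "\<And>x. \<psi> x \<noteq> 0 \<Longrightarrow> a < x \<and> x < b"
  shows "test_function \<psi>"
  unfolding test_function_def
proof (intro conjI allI)
  have "closure {x. \<psi> x \<noteq> 0} \<subseteq> {a..b}"
    using supp by (intro closure_minimal) force+
  then show "compact (closure {x. \<psi> x \<noteq> 0})"
    by (metis bounded_closed_interval bounded_subset closed_closure compact_eq_bounded_closed)
qed (rule flat_algebra_smooth[OF assms(1)])

lemma integral_eq_set_integral_support:
  fixes f :: "real \<Rightarrow> 'a::{banach, second_countable_topology}"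
  assumes "\<And>x. f x \<noteq> 0 \<Longrightarrow> x \<in> A"
  shows "(LINT x|lborel. f x) = (LINT x:A|lborel. f x)"
  unfolding set_lebesgue_integral_def
  using assms by (intro Bochner_Integration.integral_cong) (auto simp: indicator_def)

lemma integrable_compact_support:
  fixes z :: "real \<Rightarrow> 'a::{banach, second_countable_topology}" and \<phi> :: "real \<Rightarrow> real"
  assumes "locally_integrable z" "continuous_on UNIV \<phi>" "\<And>x. \<phi> x \<noteq> 0 \<Longrightarrow> a < x \<and> x < b"
  shows "integrable lborel (\<lambda>x. \<phi> x *\<^sub>R z x)"
proof -
  have "set_integrable lborel {a..b} (\<lambda>x. \<phi> x *\<^sub>R z x)"
    using locally_integrable_bilinear[OF bounded_bilinear.flip[OF bounded_bilinear_scaleR] assms(1,2)]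
    by (simp add: locally_integrable_def)
  moreover have "indicator {a..b} x *\<^sub>R \<phi> x *\<^sub>R z x = \<phi> x *\<^sub>R z x" for x
    using assms(3)[of x] by (auto simp: indicator_def)
  ultimately show ?thesis by (simp only: set_integrable_def)
qed

text \<open>Normalised to vanish at \<open>a\<close>, the antiderivative is zero to the left of the
  support, and the vanishing mean makes it zero to the right as well. Its higher derivatives are
  those of \<open>\<psi>\<close>, hence it is smooth.\<close>

lemma test_function_antiderivative:
  assumes \<psi>: "flat_algebra \<psi>" and supp: "\<And>x. \<psi> x \<noteq> 0 \<Longrightarrow> a < x \<and> x < b" and ab: "a \<le> b"
    and zero: "(LINT x|lborel. \<psi> x) = 0"
  shows "\<exists>\<phi>. test_function \<phi> \<and> deriv \<phi> = \<psi>"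
proof -
  have "continuous_on UNIV \<psi>" using \<psi> by (rule flat_algebra_continuous)
  then have "\<exists>F. \<forall>x. (F has_vector_derivative \<psi> x) (at x)"
    using einterval_antiderivative[of "-\<infinity>" "\<infinity>" \<psi>] by (auto simp: continuous_on_eq_continuous_at)
  then obtain F where F: "\<And>x. (F has_vector_derivative \<psi> x) (at x)" by blast
  define \<phi> where "\<phi> x = F x - F a" for x
  have d: "(\<phi> has_vector_derivative \<psi> x) (at x)" for x
    using F[of x] unfolding \<phi>_def by (auto intro!: derivative_eq_intros)
  have prim: "is_primitive \<phi> \<psi>"
    using d flat_algebra_continuous[OF \<psi>] by (rule is_primitive_FTC)
  have deriv: "deriv \<phi> = \<psi>"
    using d by (auto simp: fun_eq_iff has_real_derivative_iff_has_vector_derivative intro!: DERIV_imp_deriv)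
  have out: "\<phi> x = 0" if "\<not> (a < x \<and> x < b)" for x
  proof (cases "x \<le> a")
    case True
    have "\<phi> a - \<phi> x = (LINT t:{x..a}|lborel. \<psi> t)" using is_primitiveD(2)[OF prim True] by simp
    also have "\<dots> = (LINT t:{x..a}|lborel. 0)"
      using supp by (intro set_lebesgue_integral_cong) force+
    finally show ?thesis by (simp add: \<phi>_def)
  next
    case False
    then have x: "a \<le> x" "b \<le> x" using that by auto
    have "\<phi> x - \<phi> a = (LINT t:{a..x}|lborel. \<psi> t)" using is_primitiveD(2)[OF prim x(1)] by simp
    also have "\<dots> = 0"
      using integral_eq_set_integral_support[of \<psi> "{a..x}"] supp x zero by force
    finally show ?thesis by (simp add: \<phi>_def)
  qed
  have "test_function \<phi>"
    unfolding test_function_def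
  proof (intro conjI allI)
    have "closure {x. \<phi> x \<noteq> 0} \<subseteq> {a..b}"
      using out by (intro closure_minimal closed_atLeastAtMost subsetI)
        (metis (mono_tags) atLeastAtMost_iff less_imp_le mem_Collect_eq)
    then show "compact (closure {x. \<phi> x \<noteq> 0})"
      by (metis bounded_closed_interval bounded_subset closed_closure compact_eq_bounded_closed)
    show "(deriv ^^ n) \<phi> differentiable at x" for n x
    proof (cases n)
      case 0
      then show ?thesis
        using d by (auto simp: real_differentiable_def has_real_derivative_iff_has_vector_derivative)
    next
      case (Suc m)
      then show ?thesis
        using flat_algebra_smooth[OF \<psi>, of m x] by (simp add: funpow_Suc_right deriv del: funpow.simps)
    qed
  qed
  then show ?thesis using deriv by blast
qed

lemma test_functionD:
  assumes "test_function \<phi>"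
  shows "(\<phi> has_real_derivative deriv \<phi> x) (at x)"
    and "continuous_on UNIV \<phi>" "continuous_on UNIV (deriv \<phi>)"
    and "\<exists>a b. a \<le> b \<and> (\<forall>x. \<phi> x \<noteq> 0 \<or> deriv \<phi> x \<noteq> 0 \<longrightarrow> a < x \<and> x < b)"
proof -
  have diff: "(deriv ^^ n) \<phi> differentiable (at x)" for n x
    using assms by (simp add: test_function_def)
  show "(\<phi> has_real_derivative deriv \<phi> x) (at x)" for x
    using diff[of 0 x] by (auto simp: real_differentiable_def intro: DERIV_imp_deriv[THEN ssubst])
  show "continuous_on UNIV \<phi>" "continuous_on UNIV (deriv \<phi>)"
    using diff[of 0] diff[of 1]
    by (auto intro!: continuous_at_imp_continuous_on differentiable_imp_continuous_within)
  let ?S = "closure {x. \<phi> x \<noteq> 0}"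
  obtain R where R: "R > 0" "\<And>x. x \<in> ?S \<Longrightarrow> \<bar>x\<bar> \<le> R"
    using assms compact_imp_bounded[of ?S] by (auto simp: test_function_def bounded_pos)
  have "deriv \<phi> x = 0" if "x \<notin> ?S" for x
  proof -
    have "((\<lambda>_. 0) has_real_derivative 0) (at x)" by simp
    then have "(\<phi> has_real_derivative 0) (at x)"
      using that closure_subset[of "{x. \<phi> x \<noteq> 0}"]
      by (elim has_field_derivative_transform_within_open[where S = "- ?S"]) auto
    then show ?thesis by (rule DERIV_imp_deriv)
  qed
  then have "x \<in> ?S" if "\<phi> x \<noteq> 0 \<or> deriv \<phi> x \<noteq> 0" for x
    using that closure_subset[of "{x. \<phi> x \<noteq> 0}"] by auto
  \<comment> \<open>The margin 1 turns the bound by \<open>R\<close> into the strict inequalities of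
    an open interval, so that the function vanishes at its end points.\<close>
  then have "\<forall>x. \<phi> x \<noteq> 0 \<or> deriv \<phi> x \<noteq> 0 \<longrightarrow> - R - 1 < x \<and> x < R + 1"
    using R(2) by (smt (verit))
  then show "\<exists>a b. a \<le> b \<and> (\<forall>x. \<phi> x \<noteq> 0 \<or> deriv \<phi> x \<noteq> 0 \<longrightarrow> a < x \<and> x < b)"
    using R(1) by (intro exI[of _ "- R - 1"] exI[of _ "R + 1"]) auto
qed

section \<open>Integration by parts against test functions and du Bois-Reymond\<close>

lemma integrable_test_function:
  fixes z :: "real \<Rightarrow> 'a::{banach, second_countable_topology}"
  assumes "test_function \<phi>" "locally_integrable z"
  shows "integrable lborel (\<lambda>x. \<phi> x *\<^sub>R z x)" "integrable lborel (\<lambda>x. deriv \<phi> x *\<^sub>R z x)"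
  using test_functionD(2-4)[OF assms(1)] assms(2)
  by (blast intro: integrable_compact_support)+

lemma integral_test_function_by_parts:
  fixes f :: "real \<Rightarrow> 'a::euclidean_space"
  assumes \<phi>: "test_function \<phi>" and f: "is_primitive f g"
  shows "(LINT x|lborel. deriv \<phi> x *\<^sub>R f x) = - (LINT x|lborel. \<phi> x *\<^sub>R g x)"
proof -
  have p\<phi>: "is_primitive \<phi> (deriv \<phi>)"
    using test_functionD(1,3)[OF \<phi>]
    by (intro is_primitive_FTC) (auto simp: has_real_derivative_iff_has_vector_derivative)
  obtain a b where ab: "a \<le> b" "\<And>x. \<phi> x \<noteq> 0 \<or> deriv \<phi> x \<noteq> 0 \<Longrightarrow> a < x \<and> x < b"
    using test_functionD(4)[OF \<phi>] by blast
  have "(LINT x|lborel. deriv \<phi> x *\<^sub>R f x + \<phi> x *\<^sub>R g x)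
      = (LINT x:{a..b}|lborel. deriv \<phi> x *\<^sub>R f x + \<phi> x *\<^sub>R g x)"
    by (rule integral_eq_set_integral_support)
      (metis ab(2) add_0 atLeastAtMost_iff less_imp_le scaleR_zero_left)
  also have "\<dots> = \<phi> b *\<^sub>R f b - \<phi> a *\<^sub>R f a"
    by (rule is_primitiveD(2)[OF is_primitive_bilinear[OF bounded_bilinear_scaleR p\<phi> f] ab(1)])
  also have "\<dots> = 0"
  proof -
    have "\<phi> a = 0" "\<phi> b = 0" using ab(2) by blast+
    then show ?thesis by simp
  qed
  finally have "(LINT x|lborel. deriv \<phi> x *\<^sub>R f x + \<phi> x *\<^sub>R g x) = 0" .
  then show ?thesis
    using integrable_test_function(1)[OF \<phi> is_primitiveD(1)[OF f]]
      integrable_test_function(2)[OF \<phi> locally_integrable_continuous[OF is_primitive_continuous[OF f]]]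
    by (simp add: add_eq_0_iff)
qed

lemma bump_support: "bump a b n x \<noteq> 0 \<Longrightarrow> a < x \<and> x < b"
  by (auto simp: bump_eq split: if_splits)

text \<open>Bumps are test functions, and their limits are indicators of intervals, so all interval
  integrals vanish.\<close>

lemma AE_zero_if_test_integrals_zero:
  fixes z :: "real \<Rightarrow> 'a::{banach, second_countable_topology}"
  assumes z: "locally_integrable z"
    and zero: "\<And>\<phi>. test_function \<phi> \<Longrightarrow> (LINT x|lborel. \<phi> x *\<^sub>R z x) = 0"
  shows "AE x in lborel. z x = 0"
proof (rule AE_zero_if_interval_integrals_zero[OF z])
  fix a b :: real
  have "test_function (bump a b n)" for n
    using flat_algebra_bump bump_support by (rule test_function_flat_algebra)
  then show "(LINT x:{a<..<b}|lborel. z x) = 0"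
    using bump_integral_tendsto[OF z, of a b] zero by (simp add: LIMSEQ_const_iff)
qed

text \<open>A bump with its mean removed by a multiple of a fixed bump \<open>\<eta>\<close> is the derivative of a
  test function.\<close>

lemma AE_const_if_test_deriv_integrals_zero:
  fixes w :: "real \<Rightarrow> 'a::euclidean_space"
  assumes w: "locally_integrable w"
    and zero: "\<And>\<phi>. test_function \<phi> \<Longrightarrow> (LINT x|lborel. deriv \<phi> x *\<^sub>R w x) = 0"
  shows "\<exists>c. AE x in lborel. w x = c"
proof -
  have int_bump: "integrable lborel (bump a b n)" for a b n
    using integrable_compact_support[OF locally_integrable_continuous
        flat_algebra_continuous[OF flat_algebra_bump] bump_support, of "\<lambda>_. 1::real" a b n] by simp
  have intw: "integrable lborel (\<lambda>x. bump a b n x *\<^sub>R w x)" for a b n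
    by (rule integrable_compact_support[OF w
        flat_algebra_continuous[OF flat_algebra_bump] bump_support])
  have "(\<lambda>n. LINT x|lborel. bump 0 1 n x) \<longlonglongrightarrow> 1"
    using bump_integral_tendsto[OF locally_integrable_continuous, of "\<lambda>_. 1::real" 0 1]
    by (simp add: set_lebesgue_integral_def)
  then have "\<forall>\<^sub>F n in sequentially. (LINT x|lborel. bump 0 1 n x) > 0"
    by (rule order_tendstoD) simp
  then obtain N where N: "(LINT x|lborel. bump 0 1 N x) > 0"
    using eventually_happens trivial_limit_sequentially by blast
  define \<eta> where "\<eta> = bump 0 1 N"
  define m where "m = (LINT x|lborel. \<eta> x)"
  \<comment> \<open>The only candidate: testing \<open>w = c\<close> against \<open>\<eta>\<close>
    shows that \<open>c\<close> is the mean of \<open>w\<close> with weight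
    \<open>\<eta>\<close>.\<close>
  define c where "c = (1 / m) *\<^sub>R (LINT x|lborel. \<eta> x *\<^sub>R w x)"
  have m: "m > 0" using N by (simp add: m_def \<eta>_def)
  have main: "(LINT x|lborel. bump a b n x *\<^sub>R (w x - c)) = 0" for a b n
  proof -
    define \<kappa> where "\<kappa> = (LINT x|lborel. bump a b n x) / m"
    define \<psi> where "\<psi> x = bump a b n x + (- \<kappa>) * \<eta> x" for x
    have "flat_algebra \<psi>"
      unfolding \<psi>_def[abs_def] \<eta>_def
      by (intro flat_algebra.add flat_algebra_bump flat_algebra_scaled_bump)
    \<comment> \<open>This interval contains the supports of both bumps and is nonempty even if
      \<open>b < a\<close>.\<close>
    moreover have "\<psi> x \<noteq> 0 \<Longrightarrow> min a 0 < x \<and> x < max b 1" for x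
      using bump_support[of a b n x] bump_support[of 0 1 N x]
      by (cases "bump a b n x = 0"; cases "bump 0 1 N x = 0") (auto simp: \<psi>_def \<eta>_def)
    moreover have "min a 0 \<le> max b 1" by simp
    moreover have "(LINT x|lborel. \<psi> x) = 0"
      using int_bump m by (simp add: \<psi>_def \<eta>_def[symmetric] m_def[symmetric] \<kappa>_def
          int_bump[of 0 1 N, folded \<eta>_def])
    ultimately obtain \<phi> where "test_function \<phi>" "deriv \<phi> = \<psi>"
      using test_function_antiderivative by blast
    then have "0 = (LINT x|lborel. bump a b n x *\<^sub>R w x - \<kappa> *\<^sub>R \<eta> x *\<^sub>R w x)"
      using zero[of \<phi>] by (simp add: \<psi>_def algebra_simps)
    also have "\<dots> = (LINT x|lborel. bump a b n x *\<^sub>R w x) - \<kappa> *\<^sub>R (LINT x|lborel. \<eta> x *\<^sub>R w x)"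
      using intw[of a b n] intw[of 0 1 N, folded \<eta>_def]
      by (subst Bochner_Integration.integral_diff) (auto simp del: scaleR_scaleR)
    also have "\<kappa> *\<^sub>R (LINT x|lborel. \<eta> x *\<^sub>R w x) = (LINT x|lborel. bump a b n x *\<^sub>R c)"
      using int_bump by (simp add: \<kappa>_def c_def)
    also have "(LINT x|lborel. bump a b n x *\<^sub>R w x) - (LINT x|lborel. bump a b n x *\<^sub>R c)
        = (LINT x|lborel. bump a b n x *\<^sub>R (w x - c))"
      using intw int_bump by (simp add: algebra_simps)
    finally show ?thesis by simp
  qed
  have li: "locally_integrable (\<lambda>x. w x - c)"
    using locally_integrable_add[OF w locally_integrable_continuous, of "\<lambda>_. - c"] by simp
  have "AE x in lborel. w x - c = 0"
  proof (rule AE_zero_if_interval_integrals_zero[OF li])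
    show "(LINT x:{a<..<b}|lborel. w x - c) = 0" for a b
      using bump_integral_tendsto[OF li, of a b] by (simp add: main LIMSEQ_const_iff)
  qed
  then show ?thesis by auto
qed

text \<open>Any primitive \<open>V\<close> of \<open>v\<close> has the same weak derivative as
  \<open>u\<close>, by integration by parts. The difference then annihilates all derivatives of test
  functions and is almost everywhere constant; adding that constant to \<open>V\<close> gives the
  representative.\<close>

lemma primitive_of_weak_derivative:
  fixes u v :: "real \<Rightarrow> 'a::euclidean_space"
  assumes u: "locally_integrable u" and v: "locally_integrable v"
    and weak: "\<And>\<phi>. test_function \<phi> \<Longrightarrow>
      (LINT x|lborel. deriv \<phi> x *\<^sub>R u x) = - (LINT x|lborel. \<phi> x *\<^sub>R v x)"
  shows "\<exists>f. is_primitive f v \<and> (AE x in lborel. u x = f x)"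
proof -
  obtain V where V: "is_primitive V v" using is_primitive_exists[OF v] by blast
  have liV: "locally_integrable V"
    by (intro locally_integrable_continuous is_primitive_continuous[OF V])
  have li: "locally_integrable (\<lambda>x. u x - V x)"
    using locally_integrable_add[OF u locally_integrable_bounded_linear[OF liV bounded_linear_minus[OF bounded_linear_ident]]]
    by simp
  have "\<exists>c. AE x in lborel. u x - V x = c"
  proof (rule AE_const_if_test_deriv_integrals_zero[OF li])
    fix \<phi> assume \<phi>: "test_function \<phi>"
    show "(LINT x|lborel. deriv \<phi> x *\<^sub>R (u x - V x)) = 0"
      using weak[OF \<phi>] integral_test_function_by_parts[OF \<phi> V]
        integrable_test_function(2)[OF \<phi> u] integrable_test_function(2)[OF \<phi> liV]
      by (simp add: scaleR_diff_right)
  qed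
  then obtain c where c: "AE x in lborel. u x - V x = c" by blast
  have "is_primitive (\<lambda>x. V x + c) v"
    using is_primitive_add[OF V is_primitive_const[of c]] by simp
  moreover have "AE x in lborel. u x = V x + c"
    using c by eventually_elim (simp add: algebra_simps)
  ultimately show ?thesis by blast
qed

section \<open>The scalar equations\<close>

lemma integrable_imp_set_integrable:
  fixes f :: "'a \<Rightarrow> 'b::{banach, second_countable_topology}"
  shows "integrable M f \<Longrightarrow> A \<in> sets M \<Longrightarrow> set_integrable M A f"
  unfolding set_integrable_def by (rule integrable_mult_indicator)

text \<open>Fatou's lemma along \<open>[- n, n]\<close>. Bounds for large \<open>n\<close> suffice,
  which is all that decay at infinity provides.\<close>

lemma integrable_if_bounded_on_intervals:
  fixes h :: "real \<Rightarrow> real"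
  assumes h: "locally_integrable h" and nonneg: "\<And>x. h x \<ge> 0"
    and bound: "\<And>n::nat. n \<ge> n0 \<Longrightarrow> (LINT x:{- real n..real n}|lborel. h x) \<le> C"
  shows "integrable lborel h"
proof -
  note [measurable] = locally_integrable_measurable[OF h]
  have int: "set_integrable lborel {a..b} h" for a b
    using h by (simp add: locally_integrable_def)
  have lim: "(\<lambda>n. ennreal (indicator {- real n..real n} x * h x)) \<longlonglongrightarrow> ennreal (h x)" for x
  proof (rule tendsto_eventually, rule eventually_mono)
    show "\<forall>\<^sub>F n in sequentially. \<bar>x\<bar> \<le> real n"
      using eventually_ge_at_top[of "nat \<lceil>\<bar>x\<bar>\<rceil>"] by eventually_elim linarith
  qed (simp add: abs_le_iff)
  have "(\<integral>\<^sup>+x. ennreal (h x) \<partial>lborel)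
      = (\<integral>\<^sup>+x. liminf (\<lambda>n. ennreal (indicator {- real n..real n} x * h x)) \<partial>lborel)"
    using lim_imp_Liminf[OF sequentially_bot lim] by simp
  also have "\<dots> \<le> liminf (\<lambda>n. \<integral>\<^sup>+x. ennreal (indicator {- real n..real n} x * h x) \<partial>lborel)"
    by (rule nn_integral_liminf) measurable
  also have "\<dots> \<le> ennreal C"
  proof (rule Liminf_le)
    show "\<forall>\<^sub>F n in sequentially. (\<integral>\<^sup>+x. ennreal (indicator {- real n..real n} x * h x) \<partial>lborel) \<le> ennreal C"
      using eventually_ge_at_top[of n0]
    proof eventually_elim
      case (elim n)
      have "(\<integral>\<^sup>+x. ennreal (indicator {- real n..real n} x * h x) \<partial>lborel)
          = ennreal (LINT x:{- real n..real n}|lborel. h x)"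
        using int[of "- real n" "real n"] nonneg unfolding set_lebesgue_integral_def set_integrable_def
        by (subst nn_integral_eq_integral) auto
      then show ?case using bound[OF elim] by (simp add: ennreal_leI)
    qed
  qed simp
  finally have "(\<integral>\<^sup>+x. ennreal (norm (h x)) \<partial>lborel) < \<infinity>"
    using nonneg by (simp add: le_less_trans)
  then show ?thesis by (intro integrableI_bounded) auto
qed

text \<open>To be read with \<open>Q = |q|^2\<close>, \<open>i\<close> the inner product of
  \<open>q\<close> and \<open>f\<close>, \<open>\<phi> = |f|\<close> and
  \<open>r = Re \<mu>\<close>. The leading term is \<open>2 * x^2 * Q\<close>; completing squares,
  the cross terms with \<open>i\<close> and with \<open>r\<close> cost a quarter of
  \<open>x^2 * Q\<close> each, which leaves \<open>3 / 2\<close>.\<close>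

lemma energy_pointwise_bound:
  fixes x r \<epsilon> Q i \<phi> :: real
  assumes \<epsilon>: "\<epsilon> = 1 \<or> \<epsilon> = - 1" and Q: "Q \<ge> 0" and i: "\<bar>i\<bar> \<le> sqrt Q * \<phi>" and \<phi>: "\<phi> \<ge> 0"
  shows "(3 / 2 * x\<^sup>2 - 1 - 4 * r\<^sup>2) * Q \<le> \<epsilon> * (Q + 2 * x * (i + \<epsilon> * (x + r) * Q)) + 4 * \<phi>\<^sup>2"
proof -
  have "2 * (\<bar>x\<bar> * sqrt Q / 2) * (2 * \<phi>) \<le> (\<bar>x\<bar> * sqrt Q / 2)\<^sup>2 + (2 * \<phi>)\<^sup>2"
    by (rule sum_squares_bound)
  then have "2 * \<bar>x\<bar> * (sqrt Q * \<phi>) \<le> x\<^sup>2 * Q / 4 + 4 * \<phi>\<^sup>2"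
    using Q by (simp add: power_mult_distrib power_divide)
  moreover have "\<bar>2 * x * i\<bar> \<le> 2 * \<bar>x\<bar> * (sqrt Q * \<phi>)"
    using mult_left_mono[OF i, of "2 * \<bar>x\<bar>"] by (simp add: abs_mult)
  ultimately have 1: "\<bar>2 * x * i\<bar> \<le> x\<^sup>2 * Q / 4 + 4 * \<phi>\<^sup>2" by linarith
  have "0 \<le> (x / 2 + 2 * r)\<^sup>2" by simp
  then have "- (x\<^sup>2 / 4) - 4 * r\<^sup>2 \<le> 2 * x * r" by (simp add: power2_sum power_mult_distrib power_divide)
  then have 2: "(- (x\<^sup>2 / 4) - 4 * r\<^sup>2) * Q \<le> 2 * x * r * Q" using Q by (rule mult_right_mono)
  show ?thesis using \<epsilon>
  proof
    assume "\<epsilon> = 1"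
    then show ?thesis using 1 2 Q by (simp add: algebra_simps power2_eq_square)
  next
    assume "\<epsilon> = - 1"
    then show ?thesis using 1 2 Q by (simp add: algebra_simps power2_eq_square)
  qed
qed

text \<open>Integrate the derivative of \<open>x * (norm (q x))\<^sup>2\<close>; for \<open>\<epsilon> = - 1\<close> the boundary terms have the
  favourable sign.\<close>

lemma weighted_square_integrable_solution:
  fixes q f :: "real \<Rightarrow> complex"
  assumes q: "is_primitive q (\<lambda>x. f x + complex_of_real \<epsilon> * ((of_real x + \<mu>) * q x))"
    and \<epsilon>: "\<epsilon> = 1 \<or> \<epsilon> = - 1"
    and f: "integrable lborel (\<lambda>x. (norm (f x))\<^sup>2)"
    and boundary: "\<epsilon> = 1 \<Longrightarrow> \<exists>B n0. \<forall>n::nat. n \<ge> n0 \<longrightarrow>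
      real n * (norm (q (real n)))\<^sup>2 + real n * (norm (q (- real n)))\<^sup>2 \<le> B"
  shows "integrable lborel (\<lambda>x. (1 + x\<^sup>2) * (norm (q x))\<^sup>2)"
proof -
  \<comment> \<open>The imaginary part of \<open>\<mu>\<close> contributes a real multiple of
    \<open>\<i> * q x\<close>, which is orthogonal to \<open>q x\<close> in the real inner product;
    only the real part affects the energy.\<close>
  define r where "r = Re \<mu>"
  let ?q' = "\<lambda>x. f x + complex_of_real \<epsilon> * ((of_real x + \<mu>) * q x)"
  define D where "D x = (norm (q x))\<^sup>2 + 2 * x * (q x \<bullet> f x + \<epsilon> * (x + r) * (norm (q x))\<^sup>2)" for x
  have cont: "continuous_on UNIV q" by (rule is_primitive_continuous[OF q])
  have "is_primitive (\<lambda>x. x * (q x \<bullet> q x)) D"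
  proof (rule is_primitive_cong)
    have "is_primitive (\<lambda>x::real. x) (\<lambda>x. 1)"
      by (rule is_primitive_FTC) (auto intro!: derivative_eq_intros)
    from is_primitive_bilinear[OF bounded_bilinear_mult this is_primitive_bilinear[OF bounded_bilinear_inner q q]]
    show "is_primitive (\<lambda>x. x * (q x \<bullet> q x)) (\<lambda>x. 1 * (q x \<bullet> q x) + x * (?q' x \<bullet> q x + q x \<bullet> ?q' x))" .
    fix x
    have "q x \<bullet> (of_real \<epsilon> * ((of_real x + \<mu>) * q x)) = \<epsilon> * (x + r) * (norm (q x))\<^sup>2"
      unfolding cmod_power2 inner_complex_def r_def by (simp add: algebra_simps power2_eq_square)
    then have *: "q x \<bullet> ?q' x = q x \<bullet> f x + \<epsilon> * (x + r) * (norm (q x))\<^sup>2"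
      by (simp only: inner_add_right)
    show "1 * (q x \<bullet> q x) + x * (?q' x \<bullet> q x + q x \<bullet> ?q' x) = D x"
      unfolding inner_commute[of "?q' x" "q x"] * D_def power2_norm_eq_inner by simp
  qed
  then have prim: "is_primitive (\<lambda>x. x * (norm (q x))\<^sup>2) D"
    by (simp add: power2_norm_eq_inner)
  obtain B n0 where B: "\<And>n::nat. n \<ge> n0 \<Longrightarrow> \<epsilon> * (LINT x:{- real n..real n}|lborel. D x) \<le> B"
  proof (cases "\<epsilon> = 1")
    case True
    then obtain B n0 where "\<And>n::nat. n \<ge> n0 \<Longrightarrow>
        real n * (norm (q (real n)))\<^sup>2 + real n * (norm (q (- real n)))\<^sup>2 \<le> B"
      using boundary by blast
    then show ?thesis using is_primitiveD(2)[OF prim] True by (intro that[of n0 B]) simp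
  next
    case False
    then have e: "\<epsilon> = - 1" using \<epsilon> by simp
    show ?thesis
    proof (rule that[of 0 0])
      fix n
      have "0 \<le> real n * (norm (q (real n)))\<^sup>2 + real n * (norm (q (- real n)))\<^sup>2" by simp
      moreover have "(LINT x:{- real n..real n}|lborel. D x)
          = real n * (norm (q (real n)))\<^sup>2 + real n * (norm (q (- real n)))\<^sup>2"
        using is_primitiveD(2)[OF prim, of "- real n" "real n"] by simp
      ultimately show "\<epsilon> * (LINT x:{- real n..real n}|lborel. D x) \<le> 0"
        unfolding e by linarith
    qed
  qed
  \<comment> \<open>For \<open>\<bar>x\<bar> > M\<close> one has
    \<open>x^2 / 2 > 2 + 4 * r^2\<close>, so the coefficient
    \<open>3 / 2 * x^2 - 1 - 4 * r^2\<close> dominates the weight \<open>1 + x^2\<close>.\<close>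
  define M where "M = sqrt (4 + 8 * r\<^sup>2)"
  have "compact (q ` {- M..M})"
    by (intro compact_continuous_image continuous_on_subset[OF cont]) auto
  then obtain S where S: "\<And>x. \<bar>x\<bar> \<le> M \<Longrightarrow> norm (q x) \<le> S"
    using compact_imp_bounded bounded_pos
    by (metis (no_types, lifting) abs_le_iff atLeastAtMost_iff imageI minus_le_iff)
  \<comment> \<open>On \<open>[- M, M]\<close> the weight may exceed the coefficient, by at most
    \<open>2 + M^2 + 4 * r^2\<close>; continuity of \<open>q\<close> on this compact interval bounds
    the loss by \<open>K\<close>.\<close>
  define K where "K = (2 + M\<^sup>2 + 4 * r\<^sup>2) * S\<^sup>2"
  have pw: "(1 + x\<^sup>2) * (norm (q x))\<^sup>2 \<le> \<epsilon> * D x + 4 * (norm (f x))\<^sup>2 + K * indicator {- M..M} x" for x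
  proof -
    let ?Q = "(norm (q x))\<^sup>2"
    have main: "(3 / 2 * x\<^sup>2 - 1 - 4 * r\<^sup>2) * ?Q \<le> \<epsilon> * D x + 4 * (norm (f x))\<^sup>2"
      unfolding D_def using Cauchy_Schwarz_ineq2[of "q x" "f x"]
      by (intro energy_pointwise_bound \<epsilon>) auto
    show ?thesis
    proof (cases "\<bar>x\<bar> \<le> M")
      case True
      have "x\<^sup>2 \<le> M\<^sup>2" "?Q \<le> S\<^sup>2"
        using True S[OF True] by (simp_all add: abs_le_square_iff[symmetric] power_mono)
      then have "(2 + x\<^sup>2 + 4 * r\<^sup>2) * ?Q \<le> K"
        unfolding K_def by (intro mult_mono) auto
      then have "2 * ?Q + x\<^sup>2 * ?Q + 4 * (r\<^sup>2 * ?Q) \<le> K" by (simp add: algebra_simps)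
      moreover have "0 \<le> x\<^sup>2 * ?Q" by (rule mult_nonneg_nonneg) simp_all
      moreover have "3 / 2 * (x\<^sup>2 * ?Q) - ?Q - 4 * (r\<^sup>2 * ?Q) \<le> \<epsilon> * D x + 4 * (norm (f x))\<^sup>2"
        using main by (simp add: algebra_simps)
      moreover have "K * indicator {- M..M} x = K" using True by (simp add: abs_le_iff)
      moreover have "(1 + x\<^sup>2) * ?Q = ?Q + x\<^sup>2 * ?Q" by (simp add: algebra_simps)
      ultimately show ?thesis by linarith
    next
      case False
      have "M\<^sup>2 < x\<^sup>2"
        using False by (intro power2_strict_mono) (auto simp: M_def)
      then have "0 \<le> (x\<^sup>2 / 2 - 2 - 4 * r\<^sup>2) * ?Q"
        by (simp add: M_def)
      moreover have "indicator {- M..M} x = (0::real)" using False by (auto simp: abs_le_iff)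
      ultimately show ?thesis using main by (simp add: algebra_simps)
    qed
  qed
  show ?thesis
  proof (rule integrable_if_bounded_on_intervals)
    show li: "locally_integrable (\<lambda>x. (1 + x\<^sup>2) * (norm (q x))\<^sup>2)"
      by (intro locally_integrable_continuous continuous_intros cont)
    let ?C = "B + 4 * (LINT x|lborel. (norm (f x))\<^sup>2) + \<bar>K\<bar> * (2 * M)"
    fix n :: nat assume n: "n \<ge> n0"
    let ?I = "{- real n..real n}"
    have intD: "set_integrable lborel ?I (\<lambda>x. \<epsilon> * D x)"
      by (intro set_integrable_mult_right is_primitive_locally_integrable[OF prim])
    have intf: "set_integrable lborel ?I (\<lambda>x. 4 * (norm (f x))\<^sup>2)"
      using f by (intro set_integrable_mult_right integrable_imp_set_integrable) auto
    have intK: "integrable lborel (\<lambda>x. K * indicator {- M..M} x)" for K :: real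
      by (intro integrable_mult_right integrable_real_indicator) (auto simp: emeasure_lborel_Icc_eq)
    have intK': "set_integrable lborel ?I (\<lambda>x. K * indicator {- M..M} x)"
      using intK by (intro integrable_imp_set_integrable) auto
    have "(LINT x:?I|lborel. (1 + x\<^sup>2) * (norm (q x))\<^sup>2)
        \<le> (LINT x:?I|lborel. \<epsilon> * D x + 4 * (norm (f x))\<^sup>2 + K * indicator {- M..M} x)"
      using li by (intro set_integral_mono pw set_integral_add intD intf intK') (auto simp: locally_integrable_def)
    also have "\<dots> = \<epsilon> * (LINT x:?I|lborel. D x) + (LINT x:?I|lborel. 4 * (norm (f x))\<^sup>2)
        + (LINT x:?I|lborel. K * indicator {- M..M} x)"
      using intD intf intK' by (simp add: set_integral_add)
    also have "(LINT x:?I|lborel. 4 * (norm (f x))\<^sup>2) \<le> (LINT x|lborel. 4 * (norm (f x))\<^sup>2)"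
      using f intf unfolding set_lebesgue_integral_def set_integrable_def
      by (intro integral_mono) (auto simp: indicator_def)
    also have "(LINT x:?I|lborel. K * indicator {- M..M} x) \<le> (LINT x|lborel. \<bar>K\<bar> * indicator {- M..M} x)"
      using intK' intK unfolding set_lebesgue_integral_def set_integrable_def
      by (intro integral_mono) (auto simp: indicator_def)
    also have "(LINT x|lborel. \<bar>K\<bar> * indicator {- M..M} x) = \<bar>K\<bar> * (2 * M)"
      by (simp add: M_def)
    finally show "(LINT x:?I|lborel. (1 + x\<^sup>2) * (norm (q x))\<^sup>2) \<le> ?C"
      using B[OF n] by simp
  qed simp
qed

section \<open>Exponential integrals, Gaussians and variation of constants\<close>

lemma
  fixes c a :: real
  assumes c: "c > 0"
  shows integrable_exp_abs: "integrable lborel (\<lambda>x. exp (- (c * \<bar>x - a\<bar>)))" (is ?int)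
    and integral_exp_abs: "(LINT x|lborel. exp (- (c * \<bar>x - a\<bar>))) = 2 / c" (is ?eq)
proof -
  have half: "(\<integral>\<^sup>+x. ennreal (exp (- (c * x))) * indicator {0..} x \<partial>lborel) = ennreal (1 / c)"
  proof -
    have "((\<lambda>x. exp (- (c * x))) \<longlongrightarrow> 0) at_top"
      using c by real_asymp
    then have "((\<lambda>x. - (exp (- (c * x)) / c)) \<longlongrightarrow> - (0 / c)) at_top"
      using c by (intro tendsto_intros) auto
    then have "(\<integral>\<^sup>+x. ennreal (exp (- (c * x))) * indicator {0..} x \<partial>lborel)
        = - (0 / c) - - (exp (- (c * 0)) / c)"
      using c by (intro nn_integral_FTC_atLeast) (auto intro!: derivative_eq_intros)
    then show ?thesis by simp
  qed
  have "(\<integral>\<^sup>+x. ennreal (exp (- (c * \<bar>x - a\<bar>))) \<partial>lborel) = (\<integral>\<^sup>+x. ennreal (exp (- (c * \<bar>x\<bar>))) \<partial>lborel)"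
    by (subst nn_integral_real_affine[where c = 1 and t = a]) auto
  also have "\<dots> = (\<integral>\<^sup>+x. ennreal (exp (- (c * x))) * indicator {0..} x
      + ennreal (exp (- (c * (- x)))) * indicator {0..} (- x) \<partial>lborel)"
  \<comment> \<open>The origin belongs to both half-lines, so the splitting holds only almost
    everywhere.\<close>
  proof (rule nn_integral_cong_AE)
    show "AE x in lborel. ennreal (exp (- (c * \<bar>x\<bar>))) = ennreal (exp (- (c * x))) * indicator {0..} x
      + ennreal (exp (- (c * (- x)))) * indicator {0..} (- x)"
      using AE_lborel_singleton[of 0] by eventually_elim (auto simp: indicator_def)
  qed
  also have "\<dots> = (\<integral>\<^sup>+x. ennreal (exp (- (c * x))) * indicator {0..} x \<partial>lborel)
      + (\<integral>\<^sup>+x. ennreal (exp (- (c * (- x)))) * indicator {0..} (- x) \<partial>lborel)"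
    by (rule nn_integral_add) measurable
  also have "(\<integral>\<^sup>+x. ennreal (exp (- (c * (- x)))) * indicator {0..} (- x) \<partial>lborel)
      = (\<integral>\<^sup>+x. ennreal (exp (- (c * x))) * indicator {0..} x \<partial>lborel)"
    by (subst (2) nn_integral_real_affine[where c = "-1" and t = 0]) auto
  finally have eq: "(\<integral>\<^sup>+x. ennreal (exp (- (c * \<bar>x - a\<bar>))) \<partial>lborel) = ennreal (2 / c)"
    using c unfolding half by (simp add: ennreal_plus[symmetric] del: ennreal_plus)
  show ?int using eq by (intro integrableI_bounded) auto
  show ?eq using eq c by (intro integral_eq_nn_integral[THEN trans]) auto
qed

definition gauss :: "complex \<Rightarrow> real \<Rightarrow> complex" where
  "gauss \<mu> x = exp (- (of_real (x\<^sup>2) / 2 + \<mu> * of_real x))"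

lemma gauss_neq_0 [simp]: "gauss \<mu> x \<noteq> 0"
  by (simp add: gauss_def)

lemma norm_gauss: "norm (gauss \<mu> x) = exp (- (x\<^sup>2 / 2 + Re \<mu> * x))"
  by (simp add: gauss_def)

lemma cnj_gauss: "cnj (gauss \<mu> x) = gauss (cnj \<mu>) x"
  by (simp add: gauss_def exp_cnj)

text \<open>With the sign as a parameter, one formula covers the Gaussian
  (\<open>\<epsilon> = - 1\<close>) and its growing inverse (\<open>\<epsilon> = 1\<close>), which
  are the homogeneous solutions of the two scalar equations.\<close>

lemma has_vector_derivative_gauss_power:
  "((\<lambda>x. exp (complex_of_real \<epsilon> * (of_real (x\<^sup>2) / 2 + \<mu> * of_real x))) has_vector_derivative
    of_real \<epsilon> * ((of_real x + \<mu>) * exp (of_real \<epsilon> * (of_real (x\<^sup>2) / 2 + \<mu> * of_real x)))) (at x)"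
proof -
  have "((\<lambda>z. exp (complex_of_real \<epsilon> * (z\<^sup>2 / 2 + \<mu> * z))) has_field_derivative
      of_real \<epsilon> * ((z + \<mu>) * exp (of_real \<epsilon> * (z\<^sup>2 / 2 + \<mu> * z)))) (at z)" for z :: complex
    by (auto intro!: derivative_eq_intros)
  from has_vector_derivative_real_field[OF this[of "of_real x"]] show ?thesis by simp
qed

lemma continuous_gauss_power:
  "continuous_on UNIV (\<lambda>x. exp (complex_of_real \<epsilon> * (of_real (x\<^sup>2) / 2 + \<mu> * of_real x)))"
  by (intro continuous_intros) auto

lemma continuous_gauss: "continuous_on A (gauss \<mu>)"
  unfolding gauss_def[abs_def] by (intro continuous_intros) auto

lemma measurable_gauss [measurable]: "gauss \<mu> \<in> borel_measurable borel"
  by (intro borel_measurable_continuous_onI continuous_gauss)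

text \<open>The product rule applies, and the two exponentials cancel in the term with
  \<open>f\<close>. Since \<open>F\<close> may be any primitive, the constant of integration stays
  free; its choice is what separates the two scalar equations.\<close>

lemma is_primitive_variation_of_constants:
  fixes f F :: "real \<Rightarrow> complex"
  assumes F: "is_primitive F (\<lambda>x. exp (of_real (- \<epsilon>) * (of_real (x\<^sup>2) / 2 + \<mu> * of_real x)) * f x)"
  defines "q \<equiv> \<lambda>x. exp (of_real \<epsilon> * (of_real (x\<^sup>2) / 2 + \<mu> * of_real x)) * F x"
  shows "is_primitive q (\<lambda>x. f x + complex_of_real \<epsilon> * ((of_real x + \<mu>) * q x))"
proof (rule is_primitive_cong)
  let ?e = "\<lambda>x. exp (complex_of_real \<epsilon> * (of_real (x\<^sup>2) / 2 + \<mu> * of_real x))"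
  let ?e' = "\<lambda>x. exp (of_real (- \<epsilon>) * (of_real (x\<^sup>2) / 2 + \<mu> * of_real x)) :: complex"
  have "is_primitive ?e (\<lambda>x. of_real \<epsilon> * ((of_real x + \<mu>) * ?e x))"
    by (rule is_primitive_FTC[OF has_vector_derivative_gauss_power])
      (intro continuous_intros; simp)
  from is_primitive_bilinear[OF bounded_bilinear_mult this F]
  show "is_primitive q (\<lambda>x. of_real \<epsilon> * ((of_real x + \<mu>) * ?e x) * F x + ?e x * (?e' x * f x))"
    by (simp add: q_def)
  have "?e x * ?e' x = 1" for x
    by (simp add: exp_add[symmetric])
  then show "of_real \<epsilon> * ((of_real x + \<mu>) * ?e x) * F x + ?e x * (?e' x * f x)
      = f x + complex_of_real \<epsilon> * ((of_real x + \<mu>) * q x)" for x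
    by (simp add: q_def mult.assoc[symmetric])
qed

lemma is_primitive_gauss: "is_primitive (gauss \<mu>) (\<lambda>x. - ((of_real x + \<mu>) * gauss \<mu> x))"
  using has_vector_derivative_gauss_power[of "- 1" \<mu>]
  by (intro is_primitive_FTC continuous_intros continuous_gauss) (auto simp: gauss_def[abs_def])

text \<open>The energy estimate for the homogeneous equation with \<open>\<epsilon> = - 1\<close>
  takes the place of an explicit Gaussian integral.\<close>

lemma weighted_square_integrable_gauss: "integrable lborel (\<lambda>x. (1 + x\<^sup>2) * (norm (gauss \<mu> x))\<^sup>2)"
  using is_primitive_gauss
  by (intro weighted_square_integrable_solution[of _ "\<lambda>_. 0" "- 1" \<mu>]) auto

lemma square_integrable_weighted:
  fixes q :: "real \<Rightarrow> complex"
  assumes [measurable]: "q \<in> borel_measurable borel"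
    and q: "integrable lborel (\<lambda>x. (1 + x\<^sup>2) * (norm (q x))\<^sup>2)"
  shows "integrable lborel (\<lambda>x. (norm (q x))\<^sup>2)" "integrable lborel (\<lambda>x. (norm (of_real x * q x))\<^sup>2)"
  by (rule Bochner_Integration.integrable_bound[OF q];
      auto simp: algebra_simps norm_mult power_mult_distrib)+

lemma integrable_gauss_mult:
  fixes f :: "real \<Rightarrow> complex"
  assumes [measurable]: "f \<in> borel_measurable borel" and f: "integrable lborel (\<lambda>x. (norm (f x))\<^sup>2)"
  shows "integrable lborel (\<lambda>x. gauss \<mu> x * f x)"
proof (rule Bochner_Integration.integrable_bound)
  show "integrable lborel (\<lambda>x. (norm (gauss \<mu> x))\<^sup>2 + (norm (f x))\<^sup>2)"
    by (intro Bochner_Integration.integrable_add f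
        square_integrable_weighted(1)[OF measurable_gauss weighted_square_integrable_gauss])
  show "AE x in lborel. norm (gauss \<mu> x * f x) \<le> norm ((norm (gauss \<mu> x))\<^sup>2 + (norm (f x))\<^sup>2)"
  proof (rule AE_I2)
    fix x
    have "norm (gauss \<mu> x) * norm (f x) \<le> (norm (gauss \<mu> x))\<^sup>2 + (norm (f x))\<^sup>2"
      using sum_squares_bound[of "norm (gauss \<mu> x)" "norm (f x)"]
        mult_nonneg_nonneg[OF norm_ge_zero[of "gauss \<mu> x"] norm_ge_zero[of "f x"]] by linarith
    then show "norm (gauss \<mu> x * f x) \<le> norm ((norm (gauss \<mu> x))\<^sup>2 + (norm (f x))\<^sup>2)"
      by (simp add: norm_mult)
  qed
qed measurable

text \<open>Two solutions differ by a multiple of the Gaussian, which itself has finite weighted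
  norm, so every primitive \<open>F\<close> serves; the sign \<open>\<epsilon> = - 1\<close> makes
  the energy estimate unconditional.\<close>

lemma annihilation_surjective:
  fixes f :: "real \<Rightarrow> complex"
  assumes f: "f \<in> borel_measurable borel" "integrable lborel (\<lambda>x. (norm (f x))\<^sup>2)"
    and li: "locally_integrable f"
  shows "\<exists>q. is_primitive q (\<lambda>x. f x - (of_real x + \<mu>) * q x)
    \<and> integrable lborel (\<lambda>x. (1 + x\<^sup>2) * (norm (q x))\<^sup>2)"
proof -
  \<comment> \<open>The unreduced \<open>- (- 1)\<close> keeps the exponent literally in the form
    produced by variation of constants at \<open>\<epsilon> = - 1\<close>.\<close>
  let ?e = "\<lambda>x. exp (of_real (- (- 1)) * (of_real (x\<^sup>2) / 2 + \<mu> * of_real x)) :: complex"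
  have "locally_integrable (\<lambda>x. ?e x * f x)"
    using locally_integrable_bilinear[OF bounded_bilinear_mult li continuous_gauss_power[of 1 \<mu>]]
    by (simp add: mult.commute)
  then obtain F where "is_primitive F (\<lambda>x. ?e x * f x)"
    using is_primitive_exists by blast
  from is_primitive_variation_of_constants[OF this] obtain q where
    q: "is_primitive q (\<lambda>x. f x + complex_of_real (- 1) * ((of_real x + \<mu>) * q x))" by blast
  have "integrable lborel (\<lambda>x. (1 + x\<^sup>2) * (norm (q x))\<^sup>2)"
    by (rule weighted_square_integrable_solution[OF q _ f(2)]) auto
  then show ?thesis using q by auto
qed

text \<open>Comes from \<open>(x\<^sup>2 - y\<^sup>2) / 2 + r * (x - y)
  = - (y - x) * ((x + y) / 2 + r)\<close>.\<close>

lemma gauss_quotient_bound: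
  fixes x y r :: real
  assumes x: "2 * \<bar>r\<bar> \<le> \<bar>x\<bar>" and side: "(0 \<le> x \<and> x \<le> y) \<or> (x \<le> 0 \<and> y \<le> x)"
  shows "(x\<^sup>2 / 2 + r * x) - (y\<^sup>2 / 2 + r * y) \<le> - (\<bar>x\<bar> / 2 * \<bar>y - x\<bar>)"
proof -
  have *: "(x\<^sup>2 / 2 + r * x) - (y\<^sup>2 / 2 + r * y) \<le> - (\<bar>x\<bar> / 2 * \<bar>y - x\<bar>)"
    if x: "2 * \<bar>r\<bar> \<le> \<bar>x\<bar>" and s: "0 \<le> x" "x \<le> y" for x y r :: real
  proof -
    have "x / 2 \<le> (x + y) / 2 + r" using s x abs_ge_minus_self[of r] by (simp add: field_simps)
    then have "(y - x) * (x / 2) \<le> (y - x) * ((x + y) / 2 + r)"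
      using s by (intro mult_left_mono) auto
    moreover have "(x\<^sup>2 / 2 + r * x) - (y\<^sup>2 / 2 + r * y) = - ((y - x) * ((x + y) / 2 + r))"
      by (simp add: field_simps power2_eq_square)
    moreover have "\<bar>x\<bar> / 2 * \<bar>y - x\<bar> = (y - x) * (x / 2)" using s by simp
    ultimately show ?thesis by linarith
  qed
  show ?thesis
    using side *[of r x y] *[of "- r" "- x" "- y"] x by (auto simp: abs_minus_commute)
qed

text \<open>On \<open>A\<close>, which lies beyond \<open>x\<close> as seen from the origin, the
  quotient of Gaussians is at most \<open>exp (- (\<bar>x\<bar> / 2 * \<bar>y - x\<bar>))\<close>,
  whose square integrates to at most \<open>2 / \<bar>x\<bar>\<close>. Weighting Young's inequality
  with \<open>s = sqrt \<bar>x\<bar>\<close> makes both of its terms of order \<open>1 / s\<close>.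
  The solution is thus of order \<open>1 / s\<close>, just enough to bound the boundary terms of the
  energy identity.\<close>

lemma creation_solution_decay:
  fixes f :: "real \<Rightarrow> complex"
  assumes [measurable]: "f \<in> borel_measurable borel" and f: "integrable lborel (\<lambda>x. (norm (f x))\<^sup>2)"
    and x: "2 * \<bar>Re \<mu>\<bar> \<le> \<bar>x\<bar>" "x \<noteq> 0"
    and A: "A \<in> sets borel" "\<And>y. y \<in> A \<Longrightarrow> (0 \<le> x \<and> x \<le> y) \<or> (x \<le> 0 \<and> y \<le> x)"
  shows "\<bar>x\<bar> * (norm (inverse (gauss \<mu> x) * (LINT y:A|lborel. gauss \<mu> y * f y)))\<^sup>2
    \<le> (1 + (LINT y|lborel. (norm (f y))\<^sup>2) / 2)\<^sup>2"
proof -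
  define s where "s = sqrt \<bar>x\<bar>"
  have s: "s > 0" "s * s = \<bar>x\<bar>" using x by (auto simp: s_def)
  note int_exp = integrable_exp_abs[of "\<bar>x\<bar>" x] integral_exp_abs[of "\<bar>x\<bar>" x]
  have pw: "norm (indicator A y *\<^sub>R (inverse (gauss \<mu> x) * (gauss \<mu> y * f y)))
      \<le> s / 2 * exp (- (\<bar>x\<bar> * \<bar>y - x\<bar>)) + 1 / (2 * s) * (norm (f y))\<^sup>2" (is "?l \<le> ?r") for y
  proof (cases "y \<in> A")
    case True
    let ?d = "exp (- (\<bar>x\<bar> / 2 * \<bar>y - x\<bar>))"
    have "norm (inverse (gauss \<mu> x) * gauss \<mu> y)
        = exp ((x\<^sup>2 / 2 + Re \<mu> * x) - (y\<^sup>2 / 2 + Re \<mu> * y))"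
      unfolding norm_mult norm_inverse norm_gauss exp_minus[symmetric] exp_add[symmetric]
      by (rule arg_cong[of _ _ exp]) simp
    also have "\<dots> \<le> ?d" using gauss_quotient_bound[OF x(1) A(2)[OF True]] by simp
    finally have "norm (inverse (gauss \<mu> x) * gauss \<mu> y) * norm (f y) \<le> ?d * norm (f y)"
      by (intro mult_right_mono) auto
    also have "\<dots> \<le> s / 2 * ?d\<^sup>2 + 1 / (2 * s) * (norm (f y))\<^sup>2"
    proof -
      have "0 \<le> (s * ?d - norm (f y))\<^sup>2 / (2 * s)" using s by simp
      then show ?thesis using s by (simp add: field_simps power2_eq_square)
    qed
    also have "?d\<^sup>2 = exp (- (\<bar>x\<bar> * \<bar>y - x\<bar>))" by (simp add: exp_double[symmetric])
    finally show ?thesis using True by (simp add: norm_mult mult.assoc)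
  qed (use s in auto)
  have intr: "integrable lborel (\<lambda>y. s / 2 * exp (- (\<bar>x\<bar> * \<bar>y - x\<bar>)) + 1 / (2 * s) * (norm (f y))\<^sup>2)"
    using int_exp(1) f x by auto
  have [measurable]: "A \<in> sets borel" by fact
  have "norm (inverse (gauss \<mu> x) * (LINT y:A|lborel. gauss \<mu> y * f y))
      = norm (LINT y|lborel. indicator A y *\<^sub>R (inverse (gauss \<mu> x) * (gauss \<mu> y * f y)))"
    unfolding set_lebesgue_integral_def
    by (subst integral_mult_right_zero[symmetric]) (simp only: mult_scaleR_right)
  also have "\<dots> \<le> (LINT y|lborel. s / 2 * exp (- (\<bar>x\<bar> * \<bar>y - x\<bar>)) + 1 / (2 * s) * (norm (f y))\<^sup>2)"
    using pw by (intro Bochner_Integration.integral_norm_bound_integral intr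
        Bochner_Integration.integrable_bound[OF intr]) (auto intro!: AE_I2 order_trans[OF _ abs_ge_self])
  also have "\<dots> = s / 2 * (2 / \<bar>x\<bar>) + 1 / (2 * s) * (LINT y|lborel. (norm (f y))\<^sup>2)"
    using int_exp f x by simp
  also have "\<dots> = (1 + (LINT y|lborel. (norm (f y))\<^sup>2) / 2) / s"
    using s unfolding s(2)[symmetric] by (simp add: field_simps)
  finally have "(norm (inverse (gauss \<mu> x) * (LINT y:A|lborel. gauss \<mu> y * f y)))\<^sup>2
      \<le> ((1 + (LINT y|lborel. (norm (f y))\<^sup>2) / 2) / s)\<^sup>2"
    by (intro power_mono) auto
  then have "(s * s) * (norm (inverse (gauss \<mu> x) * (LINT y:A|lborel. gauss \<mu> y * f y)))\<^sup>2
      \<le> (s * s) * ((1 + (LINT y|lborel. (norm (f y))\<^sup>2) / 2) / s)\<^sup>2"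
    using s(1) by (intro mult_left_mono) auto
  moreover have "(s * s) * ((1 + (LINT y|lborel. (norm (f y))\<^sup>2) / 2) / s)\<^sup>2
      = (1 + (LINT y|lborel. (norm (f y))\<^sup>2) / 2)\<^sup>2"
    using s(1) by (simp add: power_divide power2_eq_square)
  ultimately show ?thesis unfolding s(2) by (simp only:)
qed

text \<open>The homogeneous solution grows like \<open>exp (x^2 / 2)\<close>, so the primitive
  \<open>F\<close> has to vanish at both ends. Integrating from minus infinity ensures this on the
  left; orthogonality turns the same \<open>F\<close> into minus the integral over
  \<open>(x, \<infinity>)\<close>, so it also vanishes on the right, and the decay bound applies at
  either end.\<close>

lemma creation_solvable:
  fixes f :: "real \<Rightarrow> complex"
  assumes f: "f \<in> borel_measurable borel" "integrable lborel (\<lambda>x. (norm (f x))\<^sup>2)"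
    and orth: "(LINT x|lborel. gauss \<mu> x * f x) = 0"
  shows "\<exists>q. is_primitive q (\<lambda>x. f x + (of_real x + \<mu>) * q x)
    \<and> integrable lborel (\<lambda>x. (1 + x\<^sup>2) * (norm (q x))\<^sup>2)"
proof -
  have int: "integrable lborel (\<lambda>x. gauss \<mu> x * f x)" by (rule integrable_gauss_mult[OF f])
  then have si: "set_integrable lborel A (\<lambda>x. gauss \<mu> x * f x)" if "A \<in> sets borel" for A
    using that by (intro integrable_imp_set_integrable) auto
  have split: "(LINT y:A \<union> B|lborel. gauss \<mu> y * f y)
      = (LINT y:A|lborel. gauss \<mu> y * f y) + (LINT y:B|lborel. gauss \<mu> y * f y)"
    if "A \<inter> B = {}" "A \<in> sets borel" "B \<in> sets borel" for A B
    using that by (intro set_integral_Un si) auto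
  define F where "F x = (LINT y:{..x}|lborel. gauss \<mu> y * f y)" for x
  have F': "F x = - (LINT y:{x<..}|lborel. gauss \<mu> y * f y)" for x
  proof -
    have "{..x} \<union> {x<..} = UNIV" "{..x} \<inter> {x<..} = {}" by auto
    then have "(LINT y:UNIV|lborel. gauss \<mu> y * f y) = F x + (LINT y:{x<..}|lborel. gauss \<mu> y * f y)"
      using split[of "{..x}" "{x<..}"] by (simp add: F_def)
    then show ?thesis using orth by (simp add: set_lebesgue_integral_def add_eq_0_iff2)
  qed
  have Fprim: "is_primitive F (\<lambda>x. gauss \<mu> x * f x)"
    unfolding is_primitive_def
  proof (intro conjI allI impI locally_integrable_integrable int)
    fix a b :: real assume ab: "a \<le> b"
    have "{..a} \<union> {a<..b} = {..b}" "{..a} \<inter> {a<..b} = {}" using ab by auto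
    then have "F b = F a + (LINT y:{a<..b}|lborel. gauss \<mu> y * f y)"
      using split[of "{..a}" "{a<..b}"] by (simp add: F_def)
    also have "(LINT y:{a<..b}|lborel. gauss \<mu> y * f y) = (LINT y:{a..b}|lborel. gauss \<mu> y * f y)"
      by (intro set_integral_null_delta int null_sets_subset[OF finite_imp_null_set_lborel[of "{a}"]])
        auto
    finally show "F b - F a = (LINT y:{a..b}|lborel. gauss \<mu> y * f y)" by simp
  qed
  define q where "q x = inverse (gauss \<mu> x) * F x" for x
  have inv: "inverse (gauss \<mu> x) = exp (of_real (x\<^sup>2) / 2 + \<mu> * of_real x)" for x
    unfolding gauss_def exp_minus inverse_inverse_eq ..
  have q: "is_primitive q (\<lambda>x. f x + complex_of_real 1 * ((of_real x + \<mu>) * q x))"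
    using is_primitive_variation_of_constants[of F 1 \<mu> f] Fprim
    unfolding q_def[abs_def] inv by (simp add: gauss_def[abs_def])
  let ?C = "(1 + (LINT y|lborel. (norm (f y))\<^sup>2) / 2)\<^sup>2"
  have "integrable lborel (\<lambda>x. (1 + x\<^sup>2) * (norm (q x))\<^sup>2)"
  proof (rule weighted_square_integrable_solution[OF q _ f(2)])
    show "\<exists>B n0. \<forall>n::nat\<ge>n0. real n * (norm (q (real n)))\<^sup>2 + real n * (norm (q (- real n)))\<^sup>2 \<le> B"
    proof (intro exI allI impI)
      \<comment> \<open>The ceiling provides the hypothesis
        \<open>2 * \<bar>Re \<mu>\<bar> \<le> \<bar>x\<bar>\<close> of the decay bound; the
        \<open>+ 1\<close> excludes \<open>n = 0\<close>.\<close>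
      fix n assume n: "n \<ge> nat \<lceil>2 * \<bar>Re \<mu>\<bar>\<rceil> + 1"
      then have n': "2 * \<bar>Re \<mu>\<bar> \<le> real n" "n > 0" by linarith+
      have "real n * (norm (q (real n)))\<^sup>2 \<le> ?C"
        using creation_solution_decay[OF f, of \<mu> "real n" "{real n<..}"] n'
        by (simp add: q_def F' norm_mult)
      moreover have "real n * (norm (q (- real n)))\<^sup>2 \<le> ?C"
        using creation_solution_decay[OF f, of \<mu> "- real n" "{..- real n}"] n'
        by (simp add: q_def F_def)
      ultimately show "real n * (norm (q (real n)))\<^sup>2 + real n * (norm (q (- real n)))\<^sup>2 \<le> ?C + ?C"
        by (rule add_mono)
    qed
  qed auto
  then show ?thesis using q by auto
qed

section \<open>Pairs of adjoint operators\<close>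

lemma cinner_zero_left [simp]: "cinner 0 (y::'a::complex_hilbert) = 0"
  using cinner_add_left[of "0::'a" 0 y] by simp

lemma cinner_zero_right [simp]: "cinner (x::'a::complex_hilbert) 0 = 0"
  by (metis cinner_commute cinner_zero_left complex_cnj_zero)

lemma cinner_diff_left: "cinner (x - y) (z::'a::complex_hilbert) = cinner x z - cinner y z"
  using cinner_add_left[of "x - y" y z] by simp

lemma cinner_scaleC_right: "cinner x (c *\<^sub>C (y::'a::complex_hilbert)) = cnj c * cinner x y"
  by (metis cinner_commute cinner_scaleC_left complex_cnj_mult)

lemma cinner_eq_zero_commute: "cinner x (y::'a::complex_hilbert) = 0 \<longleftrightarrow> cinner y x = 0"
  by (metis cinner_commute complex_cnj_zero)

lemma cinner_self_eq_zero [simp]: "cinner x (x::'a::complex_hilbert) = 0 \<longleftrightarrow> x = 0"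
proof
  assume "cinner x x = 0"
  then have "x \<bullet> x = 0" by (metis Re_cinner zero_complex.simps(1))
  then show "x = 0" by simp
qed simp

text \<open>Splits a complex equation into two real ones, so that closedness follows from continuity
  of the real inner product.\<close>

lemma cinner_eq_inner:
  "cinner x (y::'a::complex_hilbert) = Complex (x \<bullet> y) (x \<bullet> (\<i> *\<^sub>C y))"
  using Re_cinner[of x y] Re_cinner[of x "\<i> *\<^sub>C y"]
  by (simp add: cinner_scaleC_right complex_eq_iff)

lemma closed_orthogonal: "closed {f::'a::complex_hilbert. cinner f h = 0}"
proof -
  have "{f. cinner f h = 0} = {f. f \<bullet> h = 0} \<inter> {f. f \<bullet> (\<i> *\<^sub>C h) = 0}"
    by (auto simp: cinner_eq_inner complex_eq_iff)
  then show ?thesis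
    by (auto intro!: closed_Int closed_Collect_eq continuous_intros)
qed

lemma closed_cinner_eq: "closed {(u::'a::complex_hilbert, w). cinner w v = cinner u z}"
proof -
  have "{(u, w). cinner w v = cinner u z}
      = {p. snd p \<bullet> v = fst p \<bullet> z} \<inter> {p. snd p \<bullet> (\<i> *\<^sub>C v) = fst p \<bullet> (\<i> *\<^sub>C z)}"
    by (auto simp: cinner_eq_inner complex_eq_iff)
  then show ?thesis
    by (auto intro!: closed_Int closed_Collect_eq continuous_intros)
qed

lemma orthogonal_decomposition:
  fixes h :: "'a::complex_hilbert"
  assumes "h \<noteq> 0"
  shows "cinner (x - (cinner x h / cinner h h) *\<^sub>C h) h = 0"
  using assms by (simp add: cinner_diff_left cinner_scaleC_left)

text \<open>The component \<open>f\<close> of \<open>d\<close> orthogonal to \<open>g\<close> is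
  itself an admissible test vector, and testing with it yields \<open>cinner f f = 0\<close>. This
  is how solvability for one operator becomes uniqueness for its partner.\<close>

lemma in_line_if_orthogonal_to_complement:
  fixes d g :: "'a::complex_hilbert"
  assumes g: "g \<noteq> 0" and orth: "\<And>f. cinner f g = 0 \<Longrightarrow> cinner d f = 0"
  shows "\<exists>c. d = c *\<^sub>C g"
proof -
  define c where "c = cinner d g / cinner g g"
  define f where "f = d - c *\<^sub>C g"
  have fg: "cinner f g = 0" unfolding f_def c_def by (rule orthogonal_decomposition[OF g])
  then have "cinner f f = cinner d f - c * cinner g f"
    by (simp add: f_def cinner_diff_left cinner_scaleC_left)
  also have "\<dots> = 0" using orth[OF fg] fg cinner_eq_zero_commute[of f g] by simp
  finally show ?thesis by (auto simp: f_def)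
qed

lemma subspace_orthogonal: "complex_vector.subspace {f::'a::complex_hilbert. cinner f h = 0}"
  by (auto simp: complex_vector.subspace_def cinner_add_left cinner_scaleC_left)

lemma cdim_line:
  fixes h :: "'a::complex_hilbert"
  assumes "h \<noteq> 0" shows "cdim (complex_vector.span {h}) = 1"
proof -
  have "\<not> complex_vector.dependent {h}"
    using assms by simp
  then have "complex_vector.dim {h} = 1"
    by (simp add: complex_vector.dim_eq_card_independent)
  then show ?thesis unfolding cdim_def one_enat_def by (auto intro: exI[of _ "{h}"])
qed

lemma codim_orthogonal:
  fixes h :: "'a::complex_hilbert"
  assumes h: "h \<noteq> 0" shows "codim {f. cinner f h = 0} = 1"
proof -
  have "codim {f. cinner f h = 0} = cdim (complex_vector.span {h})"
  proof (rule codim_eq_cdim_complement[OF subspace_orthogonal complex_vector.subspace_span])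
    show "{f. cinner f h = 0} \<inter> complex_vector.span {h} = {0}"
      using h by (auto simp: complex_vector.span_singleton cinner_scaleC_left complex_vector.span_zero)
    show "\<exists>r\<in>{f. cinner f h = 0}. \<exists>m\<in>complex_vector.span {h}. x = r + m" for x
      using orthogonal_decomposition[OF h, of x]
      by (intro bexI[of _ "x - (cinner x h / cinner h h) *\<^sub>C h"]
          bexI[of _ "(cinner x h / cinner h h) *\<^sub>C h"])
        (auto simp: complex_vector.span_singleton)
  qed
  then show ?thesis using cdim_line[OF h] by simp
qed

section \<open>Linear partial operators and Jordan chains\<close>

lemma linear_operatorI:
  assumes zero: "T 0 = Some 0"
    and add: "\<And>u v a b. T u = Some a \<Longrightarrow> T v = Some b \<Longrightarrow> T (u + v) = Some (a + b)"
    and scale: "\<And>u a c. T u = Some a \<Longrightarrow> T (c *\<^sub>C u) = Some (c *\<^sub>C a)"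
  shows "linear_operator T"
  unfolding linear_operator_def complex_vector.subspace_def
proof (intro conjI ballI allI)
  show "0 \<in> dom T" using zero by auto
  fix u c assume "u \<in> dom T"
  then obtain a where u: "T u = Some a" by auto
  show "c *\<^sub>C u \<in> dom T" "T (c *\<^sub>C u) = Some (c *\<^sub>C the (T u))"
    using scale[OF u] u by auto
  fix v assume "v \<in> dom T"
  then obtain b where v: "T v = Some b" by auto
  show "u + v \<in> dom T" "T (u + v) = Some (the (T u) + the (T v))"
    using add[OF u v] u v by auto
qed

lemma linear_operatorD:
  assumes "linear_operator T"
  shows "T 0 = Some 0"
    and "T u = Some a \<Longrightarrow> T v = Some b \<Longrightarrow> T (u + v) = Some (a + b)"
    and "T u = Some a \<Longrightarrow> T (c *\<^sub>C u) = Some (c *\<^sub>C a)"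
proof -
  show add: "T (u + v) = Some (a + b)" if "T u = Some a" "T v = Some b" for u v a b
    using assms that unfolding linear_operator_def by (metis domI option.sel)
  show scale: "T (c *\<^sub>C u) = Some (c *\<^sub>C a)" if "T u = Some a" for u a c
    using assms that unfolding linear_operator_def by (metis domI option.sel)
  have "0 \<in> dom T"
    using assms by (simp add: linear_operator_def complex_vector.subspace_0)
  then obtain a where "T 0 = Some a" by auto
  from scale[OF this, of 0] show "T 0 = Some 0" by simp
qed

lemma shift_eq_Some: "shift T z u = Some w \<longleftrightarrow> T u = Some (w + z *\<^sub>C u)"
  by (auto simp: shift_def algebra_simps)

lemma linear_operator_shift:
  assumes "linear_operator T" shows "linear_operator (shift T z)"
proof (rule linear_operatorI)
  show "shift T z 0 = Some 0"
    using linear_operatorD(1)[OF assms] by (simp add: shift_eq_Some)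
  show "shift T z (u + v) = Some (a + b)" if "shift T z u = Some a" "shift T z v = Some b" for u v a b
    using linear_operatorD(2)[OF assms that[unfolded shift_eq_Some]]
    unfolding shift_eq_Some by (simp add: scaleC_add_right algebra_simps)
  show "shift T z (c *\<^sub>C u) = Some (c *\<^sub>C a)" if "shift T z u = Some a" for u a c
    using linear_operatorD(3)[OF assms that[unfolded shift_eq_Some]]
    unfolding shift_eq_Some by (simp add: scaleC_add_right scaleC_scaleC mult.commute)
qed

lemma linear_operator_op_pow:
  assumes "linear_operator T" shows "linear_operator (op_pow T n)"
proof (induction n)
  case 0
  then show ?case by (auto intro: linear_operatorI)
next
  case (Suc n)
  show ?case
  proof (rule linear_operatorI)
    show "op_pow T (Suc n) 0 = Some 0"
      by (simp add: linear_operatorD(1)[OF assms] linear_operatorD(1)[OF Suc])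
    show "op_pow T (Suc n) (u + v) = Some (a + b)"
      if uv: "op_pow T (Suc n) u = Some a" "op_pow T (Suc n) v = Some b" for u v a b
    proof -
      obtain u' v' where "op_pow T n u = Some u'" "T u' = Some a" "op_pow T n v = Some v'" "T v' = Some b"
        using uv by (auto simp: map_comp_Some_iff)
      then show ?thesis
        using linear_operatorD(2)[OF Suc, of u u' v v'] linear_operatorD(2)[OF assms, of u' a v' b] by simp
    qed
    show "op_pow T (Suc n) (c *\<^sub>C u) = Some (c *\<^sub>C a)"
      if u: "op_pow T (Suc n) u = Some a" for u a c
    proof -
      obtain u' where "op_pow T n u = Some u'" "T u' = Some a"
        using u by (auto simp: map_comp_Some_iff)
      then show ?thesis
        using linear_operatorD(3)[OF Suc, of u u' c] linear_operatorD(3)[OF assms, of u' a c] by simp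
    qed
  qed
qed

lemma subspace_ker:
  assumes "linear_operator T" shows "complex_vector.subspace (ker T)"
  unfolding complex_vector.subspace_def ker_def
  using linear_operatorD(1)[OF assms] linear_operatorD(2)[OF assms, of _ 0 _ 0]
    linear_operatorD(3)[OF assms, of _ 0]
  by simp

text \<open>The \<open>n\<close>-th power kills \<open>u 0\<close>, ..., \<open>u (n - 1)\<close>,
  hence their span, but sends \<open>u n\<close> to \<open>u 0 \<noteq> 0\<close>. The chain is
  therefore independent and outgrows every finite spanning set.\<close>

lemma algebraic_multiplicity_infinite:
  fixes T :: "'a::complex_hilbert operator"
  assumes T: "linear_operator T"
    and u0: "shift T z (u 0) = Some 0" "u 0 \<noteq> 0"
    and chain: "\<And>n. shift T z (u (Suc n)) = Some (u n)"
  shows "algebraic_multiplicity T z = \<infinity>"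
proof -
  let ?S = "shift T z"
  have lin: "linear_operator (op_pow ?S n)" for n
    by (intro linear_operator_op_pow linear_operator_shift T)
  have pow: "op_pow ?S n (u (n + k)) = Some (u k)" for n k
  proof (induction n arbitrary: k)
    case (Suc n)
    show ?case using Suc[of "Suc k"] chain by simp
  qed simp
  have S0: "?S 0 = Some 0" by (rule linear_operatorD(1)[OF linear_operator_shift[OF T]])
  have "op_pow ?S (Suc (n + k)) (u n) = Some 0" for n k
  proof (induction k)
    case 0
    show ?case using pow[of n 0] u0(1) by simp
  next
    case (Suc k)
    then show ?case using S0 by simp
  qed
  then have pow': "op_pow ?S m (u n) = Some 0" if "n < m" for n m
    using that less_iff_Suc_add by auto
  have indep: "\<not> complex_vector.dependent (u ` {..<n}) \<and> card (u ` {..<n}) = n" for n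
  proof (induction n)
    case (Suc n)
    have "u ` {..<n} \<subseteq> ker (op_pow ?S n)"
      using pow' by (auto simp: ker_def)
    then have "complex_vector.span (u ` {..<n}) \<subseteq> ker (op_pow ?S n)"
      by (intro complex_vector.span_minimal subspace_ker lin)
    moreover have "u n \<notin> ker (op_pow ?S n)"
      using pow[of n 0] u0(2) by (simp add: ker_def)
    ultimately have "u n \<notin> complex_vector.span (u ` {..<n})" by blast
    then show ?case
      using Suc complex_vector.span_base[of "u n" "u ` {..<n}"]
      by (auto simp: lessThan_Suc complex_vector.independent_insert card_insert_if)
  qed (simp add: complex_vector.independent_empty)
  have "\<not> (\<Union>n\<in>{1..}. ker (op_pow ?S n)) \<subseteq> complex_vector.span B" if "finite B" for B
  proof
    assume sub: "(\<Union>n\<in>{1..}. ker (op_pow ?S n)) \<subseteq> complex_vector.span B"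
    have "u i \<in> ker (op_pow ?S (Suc i))" for i
      using pow'[of i "Suc i"] by (simp add: ker_def)
    then have "u ` {..<Suc (card B)} \<subseteq> complex_vector.span B"
      using sub by fastforce
    from complex_vector.independent_span_bound[OF that _ this] indep[of "Suc (card B)"]
    show False by simp
  qed
  then show ?thesis unfolding algebraic_multiplicity_def cdim_def by auto
qed

text \<open>The assumptions are symmetric under exchanging \<open>(T, G)\<close> with
  \<open>(S, H)\<close>, so each conclusion about \<open>T\<close> also holds for \<open>S\<close>.
  Conjugation pairs \<open>z\<close> with \<open>cnj z\<close>: \<open>solvable\<close> says that
  orthogonality to the eigenvector of the partner, the obvious necessary condition, is also
  sufficient.\<close>

locale adjoint_pair =
  fixes T S :: "'a::complex_hilbert operator" and G H :: "complex \<Rightarrow> 'a"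
  assumes linear: "linear_operator T" "linear_operator S"
    and adjoint: "T u = Some a \<Longrightarrow> S v = Some b \<Longrightarrow> cinner a v = cinner u b"
    and eigenvector: "T (G z) = Some (z *\<^sub>C G z)" "S (H z) = Some (z *\<^sub>C H z)"
    and nonzero: "G z \<noteq> 0" "H z \<noteq> 0"
    and solvable: "cinner f (H (cnj z)) = 0 \<Longrightarrow> \<exists>u. T u = Some (f + z *\<^sub>C u)"
      "cinner f (G (cnj z)) = 0 \<Longrightarrow> \<exists>u. S u = Some (f + z *\<^sub>C u)"
begin

lemma swap: "adjoint_pair S T H G"
proof
  show "cinner a v = cinner u b" if "S u = Some a" "T v = Some b" for u a v b
    using adjoint[OF that(2,1)] by (metis cinner_commute)
qed (fact linear eigenvector nonzero solvable)+

lemma ran_shift: "ran (shift T z) = {f. cinner f (H (cnj z)) = 0}"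
proof safe
  fix f assume "f \<in> ran (shift T z)"
  then obtain u where "T u = Some (f + z *\<^sub>C u)" by (auto simp: ran_def shift_eq_Some)
  from adjoint[OF this eigenvector(2)[of "cnj z"]]
  show "cinner f (H (cnj z)) = 0"
    by (simp add: cinner_add_left cinner_scaleC_left cinner_scaleC_right)
next
  fix f assume "cinner f (H (cnj z)) = 0"
  from solvable(1)[OF this] show "f \<in> ran (shift T z)" by (auto simp: ran_def shift_eq_Some)
qed

text \<open>An eigenvector of \<open>T\<close> at \<open>z\<close> is orthogonal to the range of
  \<open>S - cnj z\<close>, and that range contains the whole orthogonal complement of
  \<open>G z\<close>.\<close>

lemma ker_shift: "ker (shift T z) = complex_vector.span {G z}"
proof safe
  fix u assume u: "u \<in> ker (shift T z)"
  then have Tu: "T u = Some (z *\<^sub>C u)" by (simp add: ker_def shift_eq_Some)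
  have "\<exists>c. u = c *\<^sub>C G z"
  proof (rule in_line_if_orthogonal_to_complement[OF nonzero(1)])
    fix f assume "cinner f (G z) = 0"
    then obtain v where "S v = Some (f + cnj z *\<^sub>C v)" using solvable(2)[of f "cnj z"] by auto
    from adjoint[OF Tu this] have "cinner u (cnj z *\<^sub>C v) = cinner u (f + cnj z *\<^sub>C v)"
      by (simp add: cinner_scaleC_left cinner_scaleC_right)
    then have "cinner (cnj z *\<^sub>C v) u = cinner (f + cnj z *\<^sub>C v) u"
      by (metis cinner_commute)
    then show "cinner u f = 0" by (simp add: cinner_add_left cinner_eq_zero_commute[of u])
  qed
  then show "u \<in> complex_vector.span {G z}" by (auto simp: complex_vector.span_singleton)
next
  fix u assume "u \<in> complex_vector.span {G z}"
  then show "u \<in> ker (shift T z)"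
    using linear_operatorD(3)[OF linear(1) eigenvector(1)[of z]]
    by (auto simp: complex_vector.span_singleton ker_def shift_eq_Some mult.commute)
qed

text \<open>Testing with \<open>H 0\<close> shows that \<open>w\<close> lies in the range of
  \<open>T\<close>, say \<open>T u' = w\<close>. Then \<open>u - u'\<close> is orthogonal to the
  range of \<open>S\<close>, hence a multiple of \<open>G 0\<close>, which lies in the domain of
  \<open>T\<close> and is mapped to 0.\<close>

lemma maximal:
  assumes "\<And>v b. S v = Some b \<Longrightarrow> cinner w v = cinner u b"
  shows "T u = Some w"
proof -
  have "cinner w (H (cnj 0)) = 0"
    using assms[OF eigenvector(2)[of 0]] by (simp add: cinner_scaleC_right)
  then obtain u' where u': "T u' = Some w" using solvable(1)[of w 0] by auto
  have "\<exists>c. u - u' = c *\<^sub>C G 0"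
  proof (rule in_line_if_orthogonal_to_complement[OF nonzero(1)])
    fix f assume "cinner f (G 0) = 0"
    then obtain v where v: "S v = Some f" using solvable(2)[of f 0] by auto
    show "cinner (u - u') f = 0"
      using assms[OF v] adjoint[OF u' v] by (simp add: cinner_diff_left)
  qed
  then obtain c where c: "u = u' + c *\<^sub>C G 0" by (auto simp: algebra_simps)
  show ?thesis
    using linear_operatorD(2)[OF linear(1) u' linear_operatorD(3)[OF linear(1) eigenvector(1)]]
    unfolding c by simp
qed

text \<open>By \<open>adjoint\<close> and \<open>maximal\<close> the graph of \<open>T\<close> is an
  intersection of closed sets, one for each point of the graph of \<open>S\<close>.\<close>

lemma closed_operator: "closed_operator T"
proof -
  have "{(u, w). T u = Some w} = (\<Inter>(v, b)\<in>{(v, b). S v = Some b}. {(u, w). cinner w v = cinner u b})"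
    by (auto dest: adjoint intro!: maximal)
  then show ?thesis
    using linear unfolding closed_operator_def by (auto intro!: closed_INT closed_cinner_eq)
qed

text \<open>Maximality of the swapped pair makes the defining condition on \<open>w\<close>
  equivalent to \<open>S v = Some w\<close>. Unique existence then means just that \<open>v\<close>
  is in the domain of \<open>S\<close>.\<close>

lemma op_adjoint_eq: "op_adjoint T = S"
proof
  fix v
  interpret swap: adjoint_pair S T H G by (rule swap)
  have "(\<forall>u\<in>dom T. cinner (the (T u)) v = cinner u w) \<longleftrightarrow> S v = Some w" for w
  proof
    assume *: "\<forall>u\<in>dom T. cinner (the (T u)) v = cinner u w"
    show "S v = Some w"
    proof (rule swap.maximal)
      fix u a assume "T u = Some a"
      then have "cinner a v = cinner u w" using * by force
      then show "cinner w u = cinner v a" by (metis cinner_commute)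
    qed
  next
    assume "S v = Some w"
    then show "\<forall>u\<in>dom T. cinner (the (T u)) v = cinner u w"
      using adjoint by auto
  qed
  then show "op_adjoint T v = S v"
    unfolding op_adjoint_def by (cases "S v") auto
qed

lemma nullity_shift: "nullity (shift T z) = 1"
  unfolding nullity_def ker_shift by (rule cdim_line[OF nonzero(1)])

lemma deficiency_shift: "deficiency (shift T z) = 1"
  unfolding deficiency_def ran_shift by (rule codim_orthogonal[OF nonzero(2)])

lemma closed_ran_shift: "closed (ran (shift T z))"
  unfolding ran_shift by (rule closed_orthogonal)

lemma resolvent_set_empty: "resolvent_set T = {}"
proof -
  have "\<not> inj_on (shift T z) (dom T)" for z
  proof
    assume "inj_on (shift T z) (dom T)"
    moreover have "shift T z (G z) = shift T z 0" "G z \<in> dom T" "0 \<in> dom T"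
      using eigenvector(1)[of z] linear_operatorD(1)[OF linear(1)] by (auto simp: shift_def)
    ultimately show False using nonzero(1)[of z] by (auto dest: inj_onD)
  qed
  then show ?thesis by (simp add: resolvent_set_def)
qed

text \<open>All shifts are Fredholm with nullity and deficiency 1, hence of index 0. The fifth
  essential spectrum is nevertheless everything, because \<open>Delta5\<close> retains only
  components that meet the resolvent set, and this set is empty.\<close>

lemma spectral_properties:
  "spectrum T = UNIV" "point_spectrum T = UNIV" "ess_spectrum5 T = UNIV"
  "ess_spectrum1 T = {}" "ess_spectrum2 T = {}" "ess_spectrum3 T = {}" "ess_spectrum4 T = {}"
  "geometric_multiplicity T z = 1"
proof -
  have fin: "nullity (shift T z) \<noteq> \<infinity>" "deficiency (shift T z) \<noteq> \<infinity>" for z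
    by (simp_all add: nullity_shift deficiency_shift)
  show "spectrum T = UNIV" by (simp add: spectrum_def resolvent_set_empty)
  show "ess_spectrum5 T = UNIV" by (simp add: ess_spectrum5_def Delta5_def resolvent_set_empty)
  show "point_spectrum T = UNIV"
    using eigenvector(1) nonzero(1) by (auto simp: point_spectrum_def)
  show "ess_spectrum1 T = {}" "ess_spectrum2 T = {}" "ess_spectrum3 T = {}" "ess_spectrum4 T = {}"
    by (simp_all add: ess_spectrum1_def Delta1_def ess_spectrum2_def Delta2_def ess_spectrum3_def
        Delta3_def ess_spectrum4_def Delta4_def semi_fredholm_def fredholm_def fredholm_index_def
        fin closed_ran_shift) (simp add: nullity_shift deficiency_shift)
  show "geometric_multiplicity T z = 1"
    using nullity_shift[of z] by (simp add: geometric_multiplicity_def nullity_def)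
qed

end

section \<open>The Dirac operators\<close>

lemma abs_ltwo_eq_iff:
  assumes "square_integrable u" "square_integrable v"
  shows "abs_ltwo u = abs_ltwo v \<longleftrightarrow> (AE x in lborel. u x = v x)"
  using Quotient_rel[OF Quotient_ltwo, of u v] assms by auto

lemma square_integrable_scaleC: "square_integrable u \<Longrightarrow> square_integrable (\<lambda>x. c *s u x)"
  by (rule square_integrable_bounded_linear[OF _ bounded_linear_vector_scalar])

lemma square_integrable_matrix: "square_integrable u \<Longrightarrow> square_integrable (\<lambda>x. M *v u x)"
  by (rule square_integrable_bounded_linear[OF _ bounded_linear_matrix])

lemma locally_integrable_square_integrable:
  assumes u: "square_integrable u" shows "locally_integrable u"
  unfolding locally_integrable_def set_integrable_def
proof (intro allI, rule Bochner_Integration.integrable_bound)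
  fix a b :: real
  show "integrable lborel (\<lambda>x. indicator {a..b} x + (norm (u x))\<^sup>2)"
    using u by (auto simp: square_integrable_def emeasure_lborel_Icc_eq intro!: integrable_real_indicator)
  have "norm (u x) \<le> 1 + (norm (u x))\<^sup>2" for x
  proof -
    have "2 * norm (u x) \<le> 1 + (norm (u x))\<^sup>2"
      using sum_squares_bound[of 1 "norm (u x)"] by simp
    then show ?thesis using norm_ge_zero[of "u x"] by linarith
  qed
  then show "AE x in lborel. norm (indicator {a..b} x *\<^sub>R u x) \<le> norm (indicator {a..b} x + (norm (u x))\<^sup>2)"
    by (intro AE_I2) (auto simp: indicator_def)
qed (use u in \<open>auto simp: square_integrable_def\<close>)

section \<open>Representatives for weak derivatives and for multiplication by
  \<open>x\<close>\<close>

lemma has_weak_deriv_abs: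
  assumes "square_integrable u" "square_integrable v"
  shows "has_weak_deriv (abs_ltwo u) (abs_ltwo v) \<longleftrightarrow> (\<forall>\<phi>. test_function \<phi> \<longrightarrow>
     (LINT x|lborel. deriv \<phi> x *\<^sub>R u x) = - (LINT x|lborel. \<phi> x *\<^sub>R v x))"
  using assms by (intro has_weak_deriv.abs_eq) auto

lemma has_weak_deriv_unique:
  assumes "has_weak_deriv U V" "has_weak_deriv U V'"
  shows "V = V'"
proof -
  obtain u v v' where uv: "square_integrable u" "U = abs_ltwo u" "square_integrable v" "V = abs_ltwo v"
    "square_integrable v'" "V' = abs_ltwo v'" by (metis ltwo_cases)
  have int: "integrable lborel (\<lambda>x. \<phi> x *\<^sub>R w x)" if "test_function \<phi>" "square_integrable w" for \<phi> w
    using that by (intro integrable_test_function locally_integrable_square_integrable)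
  have "AE x in lborel. v x - v' x = 0"
  proof (rule AE_zero_if_test_integrals_zero)
    show "locally_integrable (\<lambda>x. v x - v' x)"
      using uv by (intro locally_integrable_square_integrable square_integrable_diff)
    fix \<phi> assume \<phi>: "test_function \<phi>"
    have "(LINT x|lborel. \<phi> x *\<^sub>R v x) = (LINT x|lborel. \<phi> x *\<^sub>R v' x)"
      using assms(1)[unfolded uv has_weak_deriv_abs[OF uv(1,3)]]
        assms(2)[unfolded uv has_weak_deriv_abs[OF uv(1,5)]] \<phi> by simp
    then show "(LINT x|lborel. \<phi> x *\<^sub>R (v x - v' x)) = 0"
      using int[OF \<phi> uv(3)] int[OF \<phi> uv(5)] by (simp add: scaleR_diff_right)
  qed
  then show ?thesis using uv by (simp add: abs_ltwo_eq_iff)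
qed

lemma has_weak_deriv_primitive:
  assumes "square_integrable u" "square_integrable v" "is_primitive u v"
  shows "has_weak_deriv (abs_ltwo u) (abs_ltwo v)"
  using assms by (simp add: has_weak_deriv_abs integral_test_function_by_parts)

lemma weak_deriv_eq: "has_weak_deriv U V \<Longrightarrow> weak_deriv U = V"
  unfolding weak_deriv_def by (rule the_equality) (auto intro: has_weak_deriv_unique)

lemma is_mult_x_abs:
  assumes "square_integrable u" "square_integrable v"
  shows "is_mult_x (abs_ltwo u) (abs_ltwo v) \<longleftrightarrow> (AE x in lborel. v x = x *\<^sub>R u x)"
  using assms by (intro is_mult_x.abs_eq) auto

lemma is_mult_x_unique:
  assumes "is_mult_x U V" "is_mult_x U V'"
  shows "V = V'"
proof -
  obtain u v v' where uv: "square_integrable u" "U = abs_ltwo u" "square_integrable v" "V = abs_ltwo v"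
    "square_integrable v'" "V' = abs_ltwo v'" by (metis ltwo_cases)
  have "AE x in lborel. v x = x *\<^sub>R u x" "AE x in lborel. v' x = x *\<^sub>R u x"
    using assms uv by (simp_all add: is_mult_x_abs)
  then have "AE x in lborel. v x = v' x" by eventually_elim simp
  then show ?thesis using uv by (simp add: abs_ltwo_eq_iff)
qed

lemma mult_x_eq: "is_mult_x U V \<Longrightarrow> mult_x U = V"
  unfolding mult_x_def by (rule the_equality) (auto intro: is_mult_x_unique)

lemma ltwo_ops_abs:
  assumes "square_integrable u"
  shows "c *\<^sub>C abs_ltwo u = abs_ltwo (\<lambda>x. c *s u x)"
    and "mult_matrix M (abs_ltwo u) = abs_ltwo (\<lambda>x. M *v u x)"
    and "square_integrable v \<Longrightarrow> abs_ltwo u + abs_ltwo v = abs_ltwo (\<lambda>x. u x + v x)"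
    and "square_integrable v \<Longrightarrow> cinner (abs_ltwo u) (abs_ltwo v) = (LINT x|lborel. vec_cinner (u x) (v x))"
  using assms
  by (simp_all add: scaleC_ltwo.abs_eq mult_matrix.abs_eq plus_ltwo.abs_eq cinner_ltwo.abs_eq)

text \<open>A sign parameter, so that \<open>A0\<close> (\<open>s = 1\<close>) and
  \<open>A0_star\<close> (\<open>s = - 1\<close>) share all arguments and adjointness becomes the
  change from \<open>s\<close> to \<open>- s\<close>.\<close>

definition dirac :: "real \<Rightarrow> ltwo operator" where
  "dirac s = (\<lambda>u. if u \<in> H1 \<inter> Dom_x
     then Some ((- \<i>) *\<^sub>C mult_matrix sigma1 (weak_deriv u) + (of_real s * \<i>) *\<^sub>C mult_x u) else None)"

lemma A0_eq_dirac: "A0 = dirac 1"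
  by (simp add: A0_def dirac_def fun_eq_iff)

lemma A0_star_eq_dirac: "A0_star = dirac (- 1)"
  by (simp add: A0_star_def dirac_def fun_eq_iff)

definition dirac_fun :: "real \<Rightarrow> (real \<Rightarrow> complex^2) \<Rightarrow> (real \<Rightarrow> complex^2) \<Rightarrow> real \<Rightarrow> complex^2" where
  "dirac_fun s u u' x = (- \<i>) *s (sigma1 *v u' x) + (of_real s * \<i>) *s (x *\<^sub>R u x)"

lemma square_integrable_dirac_fun:
  assumes "square_integrable u'" "square_integrable (\<lambda>x. x *\<^sub>R u x)"
  shows "square_integrable (dirac_fun s u u')"
  unfolding dirac_fun_def[abs_def]
  using assms by (intro square_integrable_add square_integrable_scaleC square_integrable_matrix)

lemma dirac_abs:
  assumes u: "square_integrable u" and u': "square_integrable u'"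
    and xu: "square_integrable (\<lambda>x. x *\<^sub>R u x)" and prim: "is_primitive u u'"
  shows "dirac s (abs_ltwo u) = Some (abs_ltwo (dirac_fun s u u'))"
proof -
  have d: "has_weak_deriv (abs_ltwo u) (abs_ltwo u')"
    using u u' prim by (rule has_weak_deriv_primitive)
  have m: "is_mult_x (abs_ltwo u) (abs_ltwo (\<lambda>x. x *\<^sub>R u x))"
    using u xu by (simp add: is_mult_x_abs)
  have "abs_ltwo u \<in> H1 \<inter> Dom_x" using d m by (auto simp: H1_def Dom_x_def)
  moreover have "(- \<i>) *\<^sub>C mult_matrix sigma1 (abs_ltwo u')
      + (of_real s * \<i>) *\<^sub>C abs_ltwo (\<lambda>x. x *\<^sub>R u x) = abs_ltwo (dirac_fun s u u')"
    unfolding dirac_fun_def[abs_def]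
    by (simp only: ltwo_ops_abs u' xu square_integrable_scaleC square_integrable_matrix)
  ultimately show ?thesis
    by (simp only: dirac_def weak_deriv_eq[OF d] mult_x_eq[OF m] if_True)
qed

text \<open>Replaces the class by its locally absolutely continuous representative, on which
  pointwise calculus is possible. Square-integrability of this function and of its product with
  \<open>x\<close> is carried over along almost everywhere equality.\<close>

lemma dirac_cases:
  assumes "dirac s U = Some W"
  obtains u u' where "square_integrable u" "square_integrable u'" "square_integrable (\<lambda>x. x *\<^sub>R u x)"
    "is_primitive u u'" "U = abs_ltwo u" "W = abs_ltwo (dirac_fun s u u')"
proof -
  have "U \<in> H1 \<inter> Dom_x" using assms by (auto simp: dirac_def split: if_splits)
  then obtain V M where VM: "has_weak_deriv U V" "is_mult_x U M" by (auto simp: H1_def Dom_x_def)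
  obtain u v m where uv: "square_integrable u" "U = abs_ltwo u" "square_integrable v" "V = abs_ltwo v"
    "square_integrable m" "M = abs_ltwo m" by (metis ltwo_cases)
  have "\<exists>f. is_primitive f v \<and> (AE x in lborel. u x = f x)"
    using VM(1) uv by (intro primitive_of_weak_derivative locally_integrable_square_integrable)
      (auto simp: has_weak_deriv_abs)
  then obtain f where f: "is_primitive f v" "AE x in lborel. u x = f x" by blast
  note [measurable] = is_primitive_measurable[OF f(1)]
  have sq_cong: "square_integrable h"
    if "square_integrable g" "AE x in lborel. g x = h x" "h \<in> borel_measurable borel" for g h
  proof -
    have "integrable lborel (\<lambda>x. (norm (g x))\<^sup>2) \<longleftrightarrow> integrable lborel (\<lambda>x. (norm (h x))\<^sup>2)"
      using that by (intro integrable_cong_AE) (auto simp: square_integrable_def)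
    then show ?thesis using that by (simp add: square_integrable_def)
  qed
  have sqf: "square_integrable f"
    using uv(1) f(2) by (rule sq_cong) measurable
  have "AE x in lborel. m x = x *\<^sub>R u x" using VM(2) uv by (simp add: is_mult_x_abs)
  then have "AE x in lborel. m x = x *\<^sub>R f x" using f(2) by eventually_elim simp
  with uv(5) have sqxf: "square_integrable (\<lambda>x. x *\<^sub>R f x)"
    by (rule sq_cong) measurable
  have U: "U = abs_ltwo f" using uv f(2) sqf by (simp add: abs_ltwo_eq_iff)
  from dirac_abs[OF sqf uv(3) sqxf f(1)] assms have "W = abs_ltwo (dirac_fun s f v)"
    by (simp add: U)
  then show ?thesis using that[OF sqf uv(3) sqxf f(1) U] by blast
qed

lemma dirac_fun_add: "dirac_fun s u u' x + dirac_fun s v v' x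
    = dirac_fun s (\<lambda>x. u x + v x) (\<lambda>x. u' x + v' x) x"
  by (simp add: dirac_fun_def scaleR_add_right vector_add_ldistrib matrix_vector_right_distrib)

lemma dirac_fun_scale: "c *s dirac_fun s u u' x = dirac_fun s (\<lambda>x. c *s u x) (\<lambda>x. c *s u' x) x"
  by (simp add: dirac_fun_def vec_eq_iff matrix_vector_mult_def sum_2 sigma1_def algebra_simps)

lemma linear_operator_dirac: "linear_operator (dirac s)"
proof (rule linear_operatorI)
  have "dirac s (abs_ltwo (\<lambda>x. 0)) = Some (abs_ltwo (dirac_fun s (\<lambda>x. 0) (\<lambda>x. 0)))"
    using is_primitive_const[of 0] by (intro dirac_abs) (auto simp: square_integrable_zero)
  moreover have "dirac_fun s (\<lambda>x. 0) (\<lambda>x. 0) = (\<lambda>x. 0)"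
    by (auto simp: dirac_fun_def)
  ultimately show "dirac s 0 = Some 0" by (simp add: zero_ltwo_def)
next
  fix U V A B assume "dirac s U = Some A" "dirac s V = Some B"
  then show "dirac s (U + V) = Some (A + B)"
    by (elim dirac_cases)
      (simp add: ltwo_ops_abs dirac_abs square_integrable_dirac_fun square_integrable_add
        is_primitive_add scaleR_add_right dirac_fun_add)
next
  fix U A c assume "dirac s U = Some A"
  then show "dirac s (c *\<^sub>C U) = Some (c *\<^sub>C A)"
  proof (elim dirac_cases)
    fix u u' assume u: "square_integrable u" "square_integrable u'" "square_integrable (\<lambda>x. x *\<^sub>R u x)"
      "is_primitive u u'" "U = abs_ltwo u" "A = abs_ltwo (dirac_fun s u u')"
    have "x *\<^sub>R (c *s u x) = c *s (x *\<^sub>R u x)" for x by (simp add: vec_eq_iff)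
    then have "square_integrable (\<lambda>x. x *\<^sub>R (c *s u x))"
      using square_integrable_scaleC[OF u(3)] by simp
    from dirac_abs[OF square_integrable_scaleC[OF u(1), of c] square_integrable_scaleC[OF u(2), of c] this
        is_primitive_bounded_linear[OF u(4) bounded_linear_vector_scalar[of c]], of s]
    show ?thesis
      using u by (simp add: ltwo_ops_abs square_integrable_dirac_fun dirac_fun_scale)
  qed
qed

text \<open>Integrate the increments \<open>w (x + 1) - w x\<close> over all \<open>x\<close> in two ways.\<close>

lemma integral_eq_0_if_primitive_integrable:
  fixes w h :: "real \<Rightarrow> 'a::euclidean_space"
  assumes w: "integrable lborel w" and h: "integrable lborel h" and prim: "is_primitive w h"
  shows "(LINT x|lborel. h x) = 0"
proof -
  note [measurable] = is_primitive_measurable[OF prim]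
  \<comment> \<open>\<open>h y\<close> spread over the strip \<open>x \<le> y \<le> x + 1\<close>:
    integrating out \<open>x\<close> returns \<open>h y\<close> because the strip has width 1, and
    integrating out \<open>y\<close> gives the increment of \<open>w\<close>.\<close>
  define k where "k y x = indicator {y - 1..y} x *\<^sub>R h y" for x y
  have k: "k y x = indicator {x..x + 1} y *\<^sub>R h y" for x y
    by (auto simp: k_def indicator_def)
  have [measurable]: "case_prod k \<in> borel_measurable (lborel \<Otimes>\<^sub>M lborel)"
  proof -
    have "case_prod k = (\<lambda>z. if snd z \<le> fst z \<and> fst z \<le> snd z + 1 then h (fst z) else 0)"
      by (auto simp: k_def indicator_def fun_eq_iff)
    then show ?thesis by simp
  qed
  have kint: "integrable (lborel \<Otimes>\<^sub>M lborel) (case_prod k)"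
  proof (rule lborel_pair.Fubini_integrable)
    have "(LINT x|lborel. norm (case_prod k (y, x))) = norm (h y)" for y
      by (simp add: k_def)
    then show "integrable lborel (\<lambda>y. LINT x|lborel. norm (case_prod k (y, x)))"
      using h by simp
    show "AE y in lborel. integrable lborel (\<lambda>x. case_prod k (y, x))"
      by (intro AE_I2) (auto simp: k_def emeasure_lborel_Icc_eq intro!: integrable_scaleR_left integrable_real_indicator)
  qed measurable
  have "(LINT x|lborel. LINT y|lborel. k y x) = (LINT y|lborel. LINT x|lborel. k y x)"
    by (rule lborel_pair.Fubini_integral[OF kint])
  also have "\<dots> = (LINT y|lborel. h y)" by (simp add: k_def)
  also have "(LINT y|lborel. k y x) = w (x + 1) - w x" for x
    using is_primitiveD(2)[OF prim, of x "x + 1"] by (simp add: k set_lebesgue_integral_def)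
  then have "(LINT x|lborel. LINT y|lborel. k y x) = (LINT x|lborel. w (1 + 1 * x) - w x)"
    by (simp add: add.commute)
  also have "\<dots> = 0"
    using w lborel_integral_real_affine[of 1 w 1] lborel_integrable_real_affine[OF w, of 1 1] by simp
  finally show ?thesis by simp
qed

lemma bounded_bilinear_vec_cinner: "bounded_bilinear vec_cinner"
  unfolding bilinear_conv_bounded_bilinear[symmetric] bilinear_def
  by (auto intro!: linearI simp: vec_cinner_def sum_2 algebra_simps scaleR_conv_of_real[where 'a = complex])

text \<open>The terms with \<open>x\<close> cancel, since conjugation and the change from
  \<open>s\<close> to \<open>- s\<close> each reverse a sign. As \<open>sigma1\<close> is Hermitian,
  the rest is \<open>- \<i>\<close> times the derivative of one product.\<close>

lemma vec_cinner_dirac_fun: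
  "vec_cinner (dirac_fun s u u' x) (v x) - vec_cinner (u x) (dirac_fun (- s) v v' x)
    = (- \<i>) * (vec_cinner (sigma1 *v u' x) (v x) + vec_cinner (sigma1 *v u x) (v' x))"
  by (simp add: vec_cinner_def dirac_fun_def sum_2 matrix_vector_mult_def sigma1_def algebra_simps
      scaleR_conv_of_real[where 'a = complex])

text \<open>The product whose derivative remains is integrable together with that derivative, so
  there is no contribution from infinity.\<close>

lemma dirac_adjoint:
  assumes "dirac s U = Some A" "dirac (- s) V = Some B"
  shows "cinner A V = cinner U B"
proof -
  obtain u u' where u: "square_integrable u" "square_integrable u'" "square_integrable (\<lambda>x. x *\<^sub>R u x)"
    "is_primitive u u'" "U = abs_ltwo u" "A = abs_ltwo (dirac_fun s u u')" using assms(1) by (rule dirac_cases)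
  obtain v v' where v: "square_integrable v" "square_integrable v'" "square_integrable (\<lambda>x. x *\<^sub>R v x)"
    "is_primitive v v'" "V = abs_ltwo v" "B = abs_ltwo (dirac_fun (- s) v v')" using assms(2) by (rule dirac_cases)
  let ?h = "\<lambda>x. vec_cinner (sigma1 *v u' x) (v x) + vec_cinner (sigma1 *v u x) (v' x)"
  have "(LINT x|lborel. ?h x) = 0"
  proof (rule integral_eq_0_if_primitive_integrable)
    show "integrable lborel (\<lambda>x. vec_cinner (sigma1 *v u x) (v x))"
      using u v by (intro integrable_vec_cinner square_integrable_matrix)
    show "integrable lborel ?h"
      using u v by (intro Bochner_Integration.integrable_add integrable_vec_cinner square_integrable_matrix)
    show "is_primitive (\<lambda>x. vec_cinner (sigma1 *v u x) (v x)) ?h"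
      by (intro is_primitive_bilinear[OF bounded_bilinear_vec_cinner _ v(4)]
          is_primitive_bounded_linear[OF u(4) bounded_linear_matrix])
  qed
  moreover have "cinner A V - cinner U B
      = (LINT x|lborel. vec_cinner (dirac_fun s u u' x) (v x) - vec_cinner (u x) (dirac_fun (- s) v v' x))"
    using u v by (simp add: ltwo_ops_abs square_integrable_dirac_fun integrable_vec_cinner)
  ultimately show ?thesis unfolding vec_cinner_dirac_fun by simp
qed

text \<open>The eigenvectors \<open>(1, \<sigma>)\<close> of \<open>sigma1\<close>, \<open>\<sigma> = 1\<close> or \<open>\<sigma> = - 1\<close>, diagonalise \<open>dirac s\<close>.\<close>

definition spinor :: "real \<Rightarrow> complex \<Rightarrow> complex^2" where
  "spinor \<sigma> z = vector [z, of_real \<sigma> * z]"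

lemma bounded_linear_spinor: "bounded_linear (spinor \<sigma>)"
proof -
  have "linear (spinor \<sigma>)"
    by (rule linearI) (simp_all add: vec_eq_iff forall_2 spinor_def algebra_simps)
  then show ?thesis by (simp add: linear_conv_bounded_linear)
qed

lemma square_integrable_spinor:
  assumes [measurable]: "q \<in> borel_measurable borel" and q: "integrable lborel (\<lambda>x. (norm (q x))\<^sup>2)"
  shows "square_integrable (\<lambda>x. spinor \<sigma> (q x))"
  unfolding square_integrable_def
proof
  show "(\<lambda>x. spinor \<sigma> (q x)) \<in> borel_measurable lborel"
    using borel_measurable_continuous_onI[OF linear_continuous_on[OF bounded_linear_spinor]]
    by (auto intro: measurable_compose[OF assms(1)])
  have "(norm (spinor \<sigma> z))\<^sup>2 = (1 + \<sigma>\<^sup>2) * (norm z)\<^sup>2" for z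
    by (simp add: norm_vec_def L2_set_def sum_2 spinor_def norm_mult power_mult_distrib algebra_simps)
  then show "integrable lborel (\<lambda>x. (norm (spinor \<sigma> (q x)))\<^sup>2)"
    using q by simp
qed

text \<open>Along \<open>(1, \<sigma>)\<close> the operator \<open>dirac s - z\<close> acts as
  \<open>- \<i> * \<sigma>\<close> times \<open>q' - \<sigma> * s * (x + \<i> * s * z) * q\<close>,
  because \<open>\<sigma>\<close> and \<open>s\<close> square to 1. This is the source of
  \<open>\<mu> = \<i> * s * z\<close> and of \<open>\<epsilon> = \<sigma> * s\<close>: chirality
  \<open>- s\<close> carries the annihilation equation and chirality \<open>s\<close> the creation
  equation.\<close>

lemma dirac_spinor:
  fixes q f :: "real \<Rightarrow> complex"
  assumes q: "is_primitive q (\<lambda>x. f x + complex_of_real \<epsilon> * ((of_real x + \<i> * of_real s * z) * q x))"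
    and w: "integrable lborel (\<lambda>x. (1 + x\<^sup>2) * (norm (q x))\<^sup>2)"
    and f: "f \<in> borel_measurable borel" "integrable lborel (\<lambda>x. (norm (f x))\<^sup>2)"
    and \<epsilon>: "\<epsilon> = 1 \<or> \<epsilon> = - 1" and s: "s = 1 \<or> s = - 1"
  defines "\<sigma> \<equiv> \<epsilon> * s"
  shows "dirac s (abs_ltwo (\<lambda>x. spinor \<sigma> (q x)))
      = Some (abs_ltwo (\<lambda>x. spinor \<sigma> (- \<i> * of_real \<sigma> * f x)) + z *\<^sub>C abs_ltwo (\<lambda>x. spinor \<sigma> (q x)))"
proof -
  define q' where "q' x = f x + complex_of_real \<epsilon> * ((of_real x + \<i> * of_real s * z) * q x)" for x
  have prim: "is_primitive (\<lambda>x. spinor \<sigma> (q x)) (\<lambda>x. spinor \<sigma> (q' x))"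
    using is_primitive_bounded_linear[OF q bounded_linear_spinor] by (simp add: q'_def)
  have mq: "q \<in> borel_measurable borel" by (rule is_primitive_measurable(1)[OF q])
  note sqq = square_integrable_weighted[OF mq w]
  have squ: "square_integrable (\<lambda>x. spinor \<sigma> (q x))" by (rule square_integrable_spinor[OF mq sqq(1)])
  have scale: "spinor \<sigma> (c * y) = c *s spinor \<sigma> y" for c y
    by (simp add: vec_eq_iff forall_2 spinor_def)
  have sqf0: "square_integrable (\<lambda>x. spinor \<sigma> (f x))" by (rule square_integrable_spinor[OF f])
  then have sqf: "square_integrable (\<lambda>x. spinor \<sigma> (- \<i> * of_real \<sigma> * f x))"
    unfolding scale by (rule square_integrable_scaleC)
  have sqx: "square_integrable (\<lambda>x. spinor \<sigma> (of_real x * q x))"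
    using mq by (intro square_integrable_spinor sqq(2)) auto
  have xu: "square_integrable (\<lambda>x. x *\<^sub>R spinor \<sigma> (q x))"
  proof -
    have "x *\<^sub>R spinor \<sigma> (q x) = spinor \<sigma> (of_real x * q x)" for x
      by (simp add: vec_eq_iff forall_2 spinor_def scaleR_conv_of_real[where 'a = complex])
    then show ?thesis using sqx by simp
  qed
  have "spinor \<sigma> (q' x) = spinor \<sigma> (f x) + (of_real \<epsilon> *s spinor \<sigma> (of_real x * q x)
      + (of_real \<epsilon> * \<i> * of_real s * z) *s spinor \<sigma> (q x))" for x
    by (simp add: vec_eq_iff forall_2 spinor_def q'_def algebra_simps)
  then have u': "square_integrable (\<lambda>x. spinor \<sigma> (q' x))"
    using sqf0 sqx squ by (simp add: square_integrable_add square_integrable_scaleC)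
  have "dirac_fun s (\<lambda>x. spinor \<sigma> (q x)) (\<lambda>x. spinor \<sigma> (q' x)) x
      = spinor \<sigma> (- \<i> * of_real \<sigma> * f x) + z *s spinor \<sigma> (q x)" for x
    using \<epsilon> s
    by (auto simp: vec_eq_iff forall_2 spinor_def q'_def dirac_fun_def \<sigma>_def sigma1_def
        matrix_vector_mult_def sum_2 algebra_simps scaleR_conv_of_real[where 'a = complex])
  then have *: "dirac_fun s (\<lambda>x. spinor \<sigma> (q x)) (\<lambda>x. spinor \<sigma> (q' x))
      = (\<lambda>x. spinor \<sigma> (- \<i> * of_real \<sigma> * f x) + z *s spinor \<sigma> (q x))" by (rule ext)
  show "dirac s (abs_ltwo (\<lambda>x. spinor \<sigma> (q x)))
      = Some (abs_ltwo (\<lambda>x. spinor \<sigma> (- \<i> * of_real \<sigma> * f x)) + z *\<^sub>C abs_ltwo (\<lambda>x. spinor \<sigma> (q x)))"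
    by (simp only: dirac_abs[OF squ u' xu prim] * ltwo_ops_abs squ sqf square_integrable_scaleC)
qed

text \<open>Chirality \<open>- s\<close> is the one with the annihilation equation, whose
  homogeneous solution is this Gaussian.\<close>

definition ground :: "real \<Rightarrow> complex \<Rightarrow> ltwo" where
  "ground s z = abs_ltwo (\<lambda>x. spinor (- s) (gauss (\<i> * of_real s * z) x))"

lemma square_integrable_ground: "square_integrable (\<lambda>x. spinor \<sigma> (gauss \<mu> x))"
  by (intro square_integrable_spinor measurable_gauss
      square_integrable_weighted(1)[OF measurable_gauss weighted_square_integrable_gauss])

lemma dirac_ground:
  assumes s: "s = 1 \<or> s = - 1"
  shows "dirac s (ground s z) = Some (z *\<^sub>C ground s z)"
proof -
  have "is_primitive (gauss (\<i> * of_real s * z))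
      (\<lambda>x. 0 + complex_of_real (- 1) * ((of_real x + \<i> * of_real s * z) * gauss (\<i> * of_real s * z) x))"
    using is_primitive_gauss[of "\<i> * of_real s * z"] by simp
  from dirac_spinor[OF this weighted_square_integrable_gauss _ _ _ s]
  have "dirac s (ground s z) = Some (abs_ltwo (\<lambda>x. spinor (- s) 0) + z *\<^sub>C ground s z)"
    by (simp add: ground_def)
  moreover have "spinor (- s) 0 = 0" by (simp add: spinor_def vec_eq_iff forall_2)
  ultimately show ?thesis by (simp add: zero_ltwo_def)
qed

lemma ground_nonzero: "ground s z \<noteq> 0"
proof
  assume "ground s z = 0"
  then have "AE x in lborel. spinor (- s) (gauss (\<i> * of_real s * z) x) = 0"
    unfolding ground_def zero_ltwo_def
    by (subst (asm) abs_ltwo_eq_iff) (auto simp: square_integrable_zero square_integrable_ground)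
  then have "AE x in (lborel :: real measure). False"
    by (rule eventually_mono) (auto simp: spinor_def vec_eq_iff forall_2)
  then show False
    using emeasure_eq_0_AE[of "\<lambda>_. True" "lborel :: real measure"] by simp
qed

section \<open>Splitting into chiralities and solving the Dirac equation\<close>

definition chirality_component :: "real \<Rightarrow> (real \<Rightarrow> complex^2) \<Rightarrow> real \<Rightarrow> complex" where
  "chirality_component \<sigma> g x = (g x $ 1 + of_real \<sigma> * g x $ 2) / 2"

lemma chirality_component_square_integrable:
  assumes g: "square_integrable g"
  shows "chirality_component \<sigma> g \<in> borel_measurable borel"
    and "integrable lborel (\<lambda>x. (norm (chirality_component \<sigma> g x))\<^sup>2)"
    and "locally_integrable (chirality_component \<sigma> g)"
proof -
  define L :: "complex^2 \<Rightarrow> complex" where "L y = (y $ 1 + of_real \<sigma> * y $ 2) / 2" for y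
  have L: "bounded_linear L"
    unfolding linear_conv_bounded_linear[symmetric] L_def
    by (rule linearI) (simp_all add: algebra_simps add_divide_distrib scaleR_conv_of_real[where 'a = complex])
  have eq: "chirality_component \<sigma> g = (\<lambda>x. L (g x))"
    by (simp add: chirality_component_def L_def fun_eq_iff)
  show li: "locally_integrable (chirality_component \<sigma> g)"
    unfolding eq by (rule locally_integrable_bounded_linear[OF locally_integrable_square_integrable[OF g] L])
  then show [measurable]: "chirality_component \<sigma> g \<in> borel_measurable borel"
    by (rule locally_integrable_measurable)
  obtain K where K: "\<And>y. norm (L y) \<le> norm y * K"
    using bounded_linear.bounded[OF L] by blast
  show "integrable lborel (\<lambda>x. (norm (chirality_component \<sigma> g x))\<^sup>2)"
  proof (rule Bochner_Integration.integrable_bound)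
    show "integrable lborel (\<lambda>x. K\<^sup>2 * (norm (g x))\<^sup>2)"
      using g by (simp add: square_integrable_def)
    have "(norm (L (g x)))\<^sup>2 \<le> (norm (g x) * K)\<^sup>2" for x
      using K by (intro power_mono) auto
    then show "AE x in lborel. norm ((norm (chirality_component \<sigma> g x))\<^sup>2) \<le> norm (K\<^sup>2 * (norm (g x))\<^sup>2)"
      by (simp add: eq power_mult_distrib mult.commute)
  qed measurable
qed

lemma spinor_decomposition:
  assumes "s = 1 \<or> s = - 1"
  shows "spinor s (chirality_component s g x) + spinor (- s) (chirality_component (- s) g x) = g x"
  using assms by (auto simp: spinor_def chirality_component_def vec_eq_iff forall_2 field_simps)

text \<open>The regularity of \<open>q\<close> is part of the conclusion so that \<open>q\<close>
  can serve as the next right-hand side when a Jordan chain is built.\<close>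

lemma dirac_solvable_spinor:
  assumes s: "s = 1 \<or> s = - 1"
    and f: "f \<in> borel_measurable borel" "integrable lborel (\<lambda>x. (norm (f x))\<^sup>2)" "locally_integrable f"
  shows "\<exists>q. q \<in> borel_measurable borel \<and> integrable lborel (\<lambda>x. (norm (q x))\<^sup>2) \<and> locally_integrable q
    \<and> dirac s (abs_ltwo (\<lambda>x. spinor (- s) (q x)))
      = Some (abs_ltwo (\<lambda>x. spinor (- s) (f x)) + z *\<^sub>C abs_ltwo (\<lambda>x. spinor (- s) (q x)))"
proof -
  \<comment> \<open>Undoes the factor \<open>- \<i> * \<sigma>\<close> of
    \<open>dirac_spinor\<close> at \<open>\<sigma> = - s\<close>.\<close>
  define k where "k x = - \<i> * of_real s * f x" for x
  have k: "k \<in> borel_measurable borel" "integrable lborel (\<lambda>x. (norm (k x))\<^sup>2)" "locally_integrable k"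
    using f s locally_integrable_bounded_linear[OF f(3) bounded_linear_mult_right, of "- \<i> * of_real s"]
    unfolding k_def[abs_def] by (auto simp: norm_mult)
  from annihilation_surjective[OF k, of "\<i> * of_real s * z"] obtain q where
    q: "is_primitive q (\<lambda>x. k x + complex_of_real (- 1) * ((of_real x + \<i> * of_real s * z) * q x))"
      "integrable lborel (\<lambda>x. (1 + x\<^sup>2) * (norm (q x))\<^sup>2)" by auto
  have m: "q \<in> borel_measurable borel" by (rule is_primitive_measurable(1)[OF q(1)])
  have "- \<i> * of_real (- 1 * s) * k x = f x" for x
    using s by (auto simp: k_def)
  then have "dirac s (abs_ltwo (\<lambda>x. spinor (- s) (q x)))
      = Some (abs_ltwo (\<lambda>x. spinor (- s) (f x)) + z *\<^sub>C abs_ltwo (\<lambda>x. spinor (- s) (q x)))"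
    using dirac_spinor[OF q k(1,2) _ s] by simp
  then show ?thesis
    using m square_integrable_weighted(1)[OF m q(2)]
      locally_integrable_continuous[OF is_primitive_continuous[OF q(1)]] by blast
qed

text \<open>The chiralities decouple, and only chirality \<open>s\<close> imposes a condition. It is
  the stated orthogonality: \<open>ground (- s)\<close> has chirality \<open>s\<close>, and
  conjugation in the inner product turns its Gaussian at \<open>cnj z\<close> into the one with
  \<open>\<mu> = \<i> * s * z\<close> required by the creation equation.\<close>

lemma dirac_solvable:
  assumes s: "s = 1 \<or> s = - 1" and orth: "cinner F (ground (- s) (cnj z)) = 0"
  shows "\<exists>U. dirac s U = Some (F + z *\<^sub>C U)"
proof -
  obtain g where g: "square_integrable g" "F = abs_ltwo g" by (rule ltwo_cases)
  let ?c = "\<lambda>\<sigma>. chirality_component \<sigma> g"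
  note c = chirality_component_square_integrable[OF g(1)]
  obtain q where q: "dirac s (abs_ltwo (\<lambda>x. spinor (- s) (q x)))
      = Some (abs_ltwo (\<lambda>x. spinor (- s) (?c (- s) x)) + z *\<^sub>C abs_ltwo (\<lambda>x. spinor (- s) (q x)))"
    using dirac_solvable_spinor[OF s c] by blast
  define k where "k x = \<i> * of_real s * ?c s x" for x
  have k: "k \<in> borel_measurable borel" "integrable lborel (\<lambda>x. (norm (k x))\<^sup>2)"
    using c[of s] s unfolding k_def[abs_def] by (auto simp: norm_mult)
  let ?\<mu> = "\<i> * of_real s * z"
  have "vec_cinner (g x) (spinor s (gauss (\<i> * of_real (- s) * cnj z) x)) = 2 * (gauss ?\<mu> x * ?c s x)" for x
    by (simp add: vec_cinner_def sum_2 spinor_def cnj_gauss chirality_component_def algebra_simps)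
  then have "(LINT x|lborel. 2 * (gauss ?\<mu> x * ?c s x)) = 0"
    using orth g by (simp add: ground_def ltwo_ops_abs square_integrable_ground)
  then have "(LINT x|lborel. gauss ?\<mu> x * ?c s x) = 0" by simp
  moreover have "gauss ?\<mu> x * k x = \<i> * of_real s * (gauss ?\<mu> x * ?c s x)" for x
    by (simp add: k_def)
  ultimately have "(LINT x|lborel. gauss ?\<mu> x * k x) = 0"
    by (simp only: integral_mult_right_zero mult_zero_right)
  from creation_solvable[OF k this] obtain p where
    p: "is_primitive p (\<lambda>x. k x + complex_of_real 1 * ((of_real x + ?\<mu>) * p x))"
      "integrable lborel (\<lambda>x. (1 + x\<^sup>2) * (norm (p x))\<^sup>2)" by auto
  have "- \<i> * of_real (1 * s) * k x = ?c s x" for x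
    using s by (auto simp: k_def)
  then have p': "dirac s (abs_ltwo (\<lambda>x. spinor s (p x)))
      = Some (abs_ltwo (\<lambda>x. spinor s (?c s x)) + z *\<^sub>C abs_ltwo (\<lambda>x. spinor s (p x)))"
    using dirac_spinor[OF p k _ s] by simp
  let ?U = "abs_ltwo (\<lambda>x. spinor s (p x)) + abs_ltwo (\<lambda>x. spinor (- s) (q x))"
  have "F = abs_ltwo (\<lambda>x. spinor s (?c s x)) + abs_ltwo (\<lambda>x. spinor (- s) (?c (- s) x))"
    using c g by (simp add: ltwo_ops_abs square_integrable_spinor spinor_decomposition[OF s])
  then have "dirac s ?U = Some (F + z *\<^sub>C ?U)"
    using linear_operatorD(2)[OF linear_operator_dirac p' q] by (simp add: scaleC_add_right algebra_simps)
  then show ?thesis by blast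
qed

lemma adjoint_pair_dirac:
  assumes "s = 1 \<or> s = - 1"
  shows "adjoint_pair (dirac s) (dirac (- s)) (ground s) (ground (- s))"
proof
  have s': "- s = 1 \<or> - s = - 1" using assms by auto
  show "cinner a v = cinner u b" if "dirac s u = Some a" "dirac (- s) v = Some b" for u a v b
    using that by (rule dirac_adjoint)
  show "\<exists>u. dirac s u = Some (f + z *\<^sub>C u)" if "cinner f (ground (- s) (cnj z)) = 0" for f z
    using dirac_solvable[OF assms that] .
  show "\<exists>u. dirac (- s) u = Some (f + z *\<^sub>C u)" if "cinner f (ground s (cnj z)) = 0" for f z
    using dirac_solvable[OF s', of f z] that by simp
qed (use assms in \<open>auto intro: linear_operator_dirac dirac_ground simp: ground_nonzero\<close>)

text \<open>The whole chain stays in chirality \<open>- s\<close>, where every right-hand side is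
  admissible, so the equation can be solved again and again starting from the ground state.\<close>

lemma algebraic_multiplicity_dirac:
  assumes s: "s = 1 \<or> s = - 1"
  shows "algebraic_multiplicity (dirac s) z = \<infinity>"
proof -
  let ?P = "\<lambda>q. q \<in> borel_measurable borel \<and> integrable lborel (\<lambda>x. (norm (q x))\<^sup>2) \<and> locally_integrable q"
  let ?v = "\<lambda>q. abs_ltwo (\<lambda>x. spinor (- s) (q x))"
  have step: "\<exists>q. ?P q \<and> dirac s (?v q) = Some (?v f + z *\<^sub>C ?v q)" if "?P f" for f
    using dirac_solvable_spinor[OF s] that by blast
  have "?P (gauss (\<i> * of_real s * z))"
    using square_integrable_weighted(1)[OF measurable_gauss weighted_square_integrable_gauss]
    by (auto intro: locally_integrable_continuous continuous_gauss)
  then obtain Q where Q: "Q 0 = gauss (\<i> * of_real s * z)"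
    "\<And>n. dirac s (?v (Q (Suc n))) = Some (?v (Q n) + z *\<^sub>C ?v (Q (Suc n)))"
    \<comment> \<open>The clause for \<open>n = 0\<close> pins the start of the chain to the
      Gaussian, and \<open>?P\<close> carries the regularity from one step to the next.\<close>
    using dependent_nat_choice[of "\<lambda>n q. ?P q \<and> (n = 0 \<longrightarrow> q = gauss (\<i> * of_real s * z))"
        "\<lambda>n f q. dirac s (?v q) = Some (?v f + z *\<^sub>C ?v q)"] step by blast
  show ?thesis
  proof (rule algebraic_multiplicity_infinite[OF linear_operator_dirac])
    show "shift (dirac s) z (?v (Q 0)) = Some 0" "?v (Q 0) \<noteq> 0"
      using dirac_ground[OF s, of z] ground_nonzero[of s z]
      by (simp_all add: Q(1) ground_def[symmetric] shift_eq_Some)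
    show "shift (dirac s) z (?v (Q (Suc n))) = Some (?v (Q n))" for n
      using Q(2)[of n] by (simp add: shift_eq_Some)
  qed
qed

theorem proposition2p6:
  shows "closed_operator A0
    \<and> op_adjoint A0 = A0_star \<and> dom (op_adjoint A0) = dom A0
    \<and> (\<forall>T\<in>{A0, op_adjoint A0}.
          spectrum T = UNIV \<and> point_spectrum T = UNIV \<and> ess_spectrum5 T = UNIV
        \<and> ess_spectrum1 T = {} \<and> ess_spectrum2 T = {} \<and> ess_spectrum3 T = {}
        \<and> ess_spectrum4 T = {}
        \<and> (\<forall>z. geometric_multiplicity T z = 1 \<and> algebraic_multiplicity T z = \<infinity>))"
proof -
  interpret A: adjoint_pair A0 A0_star "ground 1" "ground (- 1)"
    using adjoint_pair_dirac[of 1] by (simp add: A0_eq_dirac A0_star_eq_dirac)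
  interpret B: adjoint_pair A0_star A0 "ground (- 1)" "ground 1"
    by (rule A.swap)
  have "dom A0_star = dom A0" by (auto simp: A0_def A0_star_def dom_def)
  moreover have "algebraic_multiplicity A0 z = \<infinity>" "algebraic_multiplicity A0_star z = \<infinity>" for z
    by (simp_all add: A0_eq_dirac A0_star_eq_dirac algebraic_multiplicity_dirac)
  ultimately show ?thesis
    using A.spectral_properties B.spectral_properties A.closed_operator A.op_adjoint_eq by auto
qed

end
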